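(* Let $\delta>0$, let $X$ be a $\delta$-hyperbolic length space and let $G$ be a group acting by isometries on $X$. There exists $\sigma_0>0$ with the following property. Let $\mathcal R$ be a $\sigma$-rotation family with $\sigma>\sigma_0$. Let $K$ be the (normal) subgroup of $G$ generated by all the rotation groups $H$ with $(H,v)\in\mathcal R$, and let $\bar G=G/K$. Then the following hold. (i) The quotient $\bar X=X/K$ is $\bar\delta$-hyperbolic for some $\bar\delta\le 900\delta$. (ii) For every $\bar g\in\bar G$ acting loxodromically on $\bar X$, there exist a pre-image $g\in G$ of $\bar g$ and a subset $\mathcal S$ of $\mathcal R$ such that $$\langle g,K\rangle=\langle g\rangle*\left( *_{H\in H(\mathcal S)}H\right).$$
   Context: For points of a metric space, $|x-y|$ denotes the distance and $\langle x,y\rangle_z=\frac12\{|x-z|+|y-z|-|x-y|\}$ the Gromov product. The space $X$ is $\delta$-hyperbolic if $\langle x,z\rangle_t\ge\min\{\langle x,y\rangle_t,\langle y,z\rangle_t\}-\delta$ for all $x,y,z,t\in X$. $B(x,r)$ is the closed ball. An isometry $g$ of a hyperbolic space is loxodromic if for some (equivalently any) point $x$ the map $m\in\mathbb Z\mapsto g^mx$ is a quasi-isometric embedding. A $\sigma$-rotation family ($\sigma>0$) is a non-empty collection $\mathcal R$ of pairs $(H,v)$, where $H$ is a subgroup of $G$ and $v$ a point of $X$, such that: (R1) for every $(H,v)\in\mathcal R$, every $x\in B(v,\sigma/10)$ and every $h\in H\setminus\{1\}$, $|hx-x|=2|v-x|$; (R2) for all $(H,v),(H',v')\in\mathcal R$,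 if $(H,v)\ne(H',v')$ then $|v-v'|\ge\sigma$; (R3) for all $g\in G$ and $(H,v)\in\mathcal R$, the pair $(gHg^{-1},gv)$ belongs to $\mathcal R$. The groups $H$ with $(H,v)\in\mathcal R$ are called rotation groups. For $\mathcal S\subseteq\mathcal R$, $H(\mathcal S)$ denotes the set of all $H$ with $(H,v)\in\mathcal S$. The quotient $\bar X=X/K$ carries the quotient (pseudo-)metric, the distance between two classes being the infimum of distances between points of the corresponding $K$-orbits; $\bar G$ acts on it by isometries. The equality in (ii) means that the subgroup generated by $g$ and $K$ is the internal free product of its subgroups $\langle g\rangle$ and $H\in H(\mathcal S)$. *)

theory Defs
  imports "HOL-Analysis.Analysis" "HOL-Algebra.Group_Action" "HOL-Algebra.Generated_Groups"
begin

section \<open>Hyperbolic length spaces\<close>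

text \<open>
  The next definitions take a bare set and a distance function, so that they also apply to the
  quotient, whose distance is only a pseudo-metric a priori.
\<close>

definition gromov_product :: "('x \<Rightarrow> 'x \<Rightarrow> real) \<Rightarrow> 'x \<Rightarrow> 'x \<Rightarrow> 'x \<Rightarrow> real" where
  "gromov_product d x y z = (d x z + d y z - d x y) / 2"

definition hyperbolic :: "real \<Rightarrow> 'x set \<Rightarrow> ('x \<Rightarrow> 'x \<Rightarrow> real) \<Rightarrow> bool" where
  "hyperbolic \<delta> X d \<longleftrightarrow>
     (\<forall>x\<in>X. \<forall>y\<in>X. \<forall>z\<in>X. \<forall>t\<in>X.
        gromov_product d x z t
          \<ge> min (gromov_product d x y t) (gromov_product d y z t) - \<delta>)"

text \<open>
  A subdivision of the unit interval is given by a sorted list of parameters; it need not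
  contain the end points, which does not affect the supremum.
\<close>

definition path_length :: "('x \<Rightarrow> 'x \<Rightarrow> real) \<Rightarrow> (real \<Rightarrow> 'x) \<Rightarrow> ennreal" where
  "path_length d c =
     (SUP ts \<in> {ts. sorted ts \<and> set ts \<subseteq> {0..1}}.
        \<Sum>i<length ts - 1. ennreal (d (c (ts ! i)) (c (ts ! Suc i))))"

text \<open>
  The infimum over an empty set of paths is \<open>\<infinity>\<close>, so any two points of a length space are joined
  by paths of finite length.
\<close>

definition length_space :: "'x set \<Rightarrow> ('x \<Rightarrow> 'x \<Rightarrow> real) \<Rightarrow> bool" where
  "length_space X d \<longleftrightarrow>
     Metric_space X d \<and>
     (\<forall>x\<in>X. \<forall>y\<in>X.
        ennreal (d x y) =
        (INF c \<in> {c. pathin (Metric_space.mtopology X d) c \<and> c 0 = x \<and> c 1 = y}. path_length d c))"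

section \<open>Isometric actions and loxodromic elements\<close>

definition acts_by_isometries ::
    "('g, 'b) monoid_scheme \<Rightarrow> 'x set \<Rightarrow> ('x \<Rightarrow> 'x \<Rightarrow> real) \<Rightarrow> ('g \<Rightarrow> 'x \<Rightarrow> 'x) \<Rightarrow> bool" where
  "acts_by_isometries G X d \<phi> \<longleftrightarrow>
     group_action G X \<phi> \<and>
     (\<forall>g\<in>carrier G. \<forall>x\<in>X. \<forall>y\<in>X. d (\<phi> g x) (\<phi> g y) = d x y)"

definition quasi_isometric_embedding ::
    "'a set \<Rightarrow> ('a \<Rightarrow> 'a \<Rightarrow> real) \<Rightarrow> 'x set \<Rightarrow> ('x \<Rightarrow> 'x \<Rightarrow> real) \<Rightarrow> ('a \<Rightarrow> 'x) \<Rightarrow> bool" where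
  "quasi_isometric_embedding A dA X d f \<longleftrightarrow>
     f \<in> A \<rightarrow> X \<and>
     (\<exists>k\<ge>1. \<exists>l\<ge>0. \<forall>a\<in>A. \<forall>b\<in>A.
        dA a b / k - l \<le> d (f a) (f b) \<and> d (f a) (f b) \<le> k * dA a b + l)"

definition loxodromic ::
    "('g, 'b) monoid_scheme \<Rightarrow> 'x set \<Rightarrow> ('x \<Rightarrow> 'x \<Rightarrow> real) \<Rightarrow> ('g \<Rightarrow> 'x \<Rightarrow> 'x) \<Rightarrow> 'g \<Rightarrow> bool" where
  "loxodromic G X d \<phi> g \<longleftrightarrow>
     (\<exists>x\<in>X. quasi_isometric_embedding (UNIV :: int set) (\<lambda>m n. real_of_int \<bar>m - n\<bar>) X d
               (\<lambda>m. \<phi> (g [^]\<^bsub>G\<^esub> m) x))"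

section \<open>Rotation families\<close>

definition rotation_family ::
    "('g, 'b) monoid_scheme \<Rightarrow> 'x set \<Rightarrow> ('x \<Rightarrow> 'x \<Rightarrow> real) \<Rightarrow> ('g \<Rightarrow> 'x \<Rightarrow> 'x) \<Rightarrow> real
       \<Rightarrow> ('g set \<times> 'x) set \<Rightarrow> bool" where
  "rotation_family G X d \<phi> \<sigma> \<R> \<longleftrightarrow>
     \<sigma> > 0 \<and>
     \<R> \<noteq> {} \<and>
     (\<forall>(H, v)\<in>\<R>. subgroup H G \<and> v \<in> X) \<and>
     (\<forall>(H, v)\<in>\<R>. \<forall>x\<in>Metric_space.mcball X d v (\<sigma> / 10). \<forall>h\<in>H - {\<one>\<^bsub>G\<^esub>}.
        d (\<phi> h x) x = 2 * d v x) \<and>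
     (\<forall>(H, v)\<in>\<R>. \<forall>(H', v')\<in>\<R>. (H, v) \<noteq> (H', v') \<longrightarrow> d v v' \<ge> \<sigma>) \<and>
     (\<forall>g\<in>carrier G. \<forall>(H, v)\<in>\<R>. ((g <#\<^bsub>G\<^esub> H) #>\<^bsub>G\<^esub> inv\<^bsub>G\<^esub> g, \<phi> g v) \<in> \<R>)"

definition rotation_groups :: "('g set \<times> 'x) set \<Rightarrow> 'g set set" where
  "rotation_groups \<S> = fst ` \<S>"

section \<open>The quotient of an action by a normal subgroup\<close>

definition quotient_space ::
    "('g, 'b) monoid_scheme \<Rightarrow> 'x set \<Rightarrow> ('g \<Rightarrow> 'x \<Rightarrow> 'x) \<Rightarrow> 'g set \<Rightarrow> 'x set set" where
  "quotient_space G X \<phi> K = orbits (G\<lparr>carrier := K\<rparr>) X \<phi>"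

definition quotient_dist :: "('x \<Rightarrow> 'x \<Rightarrow> real) \<Rightarrow> 'x set \<Rightarrow> 'x set \<Rightarrow> real" where
  "quotient_dist d P Q = (INF (x, y) \<in> P \<times> Q. d x y)"

text \<open>
  For a coset \<open>A\<close> of \<open>K\<close> containing \<open>g\<close> and the \<open>K\<close>-orbit \<open>P\<close> of \<open>x\<close>, the value is the \<open>K\<close>-orbit of
  \<open>\<phi> g x\<close>. The restriction matches the convention of \<^locale>\<open>group_action\<close>, where bijections are
  undefined outside the set acted on.
\<close>

definition quotient_action ::
    "('g, 'b) monoid_scheme \<Rightarrow> 'x set \<Rightarrow> ('g \<Rightarrow> 'x \<Rightarrow> 'x) \<Rightarrow> 'g set \<Rightarrow> 'g set \<Rightarrow> 'x set \<Rightarrow> 'x set"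
  where
  "quotient_action G X \<phi> K A = (\<lambda>P\<in>quotient_space G X \<phi> K. \<Union>a\<in>A. \<phi> a ` P)"

section \<open>Internal free products\<close>

text \<open>
  The free product of a family of groups is realised as usual by the reduced words: finite
  sequences of non-trivial elements of the factors, consecutive letters coming from factors with
  different indices. A letter carries the index of its factor, so that the factors are kept apart
  even if they overlap as subsets of \<open>G\<close>.
\<close>

definition reduced_words ::
    "('g, 'b) monoid_scheme \<Rightarrow> 'i set \<Rightarrow> ('i \<Rightarrow> 'g set) \<Rightarrow> ('i \<times> 'g) list set" where
  "reduced_words G I A =
     {w. set w \<subseteq> (SIGMA i:I. A i - {\<one>\<^bsub>G\<^esub>}) \<and> distinct_adj (map fst w)}"

definition word_value :: "('g, 'b) monoid_scheme \<Rightarrow> ('i \<times> 'g) list \<Rightarrow> 'g" where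
  "word_value G w = foldr (\<otimes>\<^bsub>G\<^esub>) (map snd w) \<one>\<^bsub>G\<^esub>"

text \<open>
  The subgroup \<open>L\<close> of \<open>G\<close> is the internal free product of the subgroups \<open>A i\<close>, \<open>i \<in> I\<close>: the
  canonical map from the free product to \<open>G\<close> is a bijection onto \<open>L\<close>.
\<close>

definition internal_free_product ::
    "('g, 'b) monoid_scheme \<Rightarrow> 'g set \<Rightarrow> 'i set \<Rightarrow> ('i \<Rightarrow> 'g set) \<Rightarrow> bool" where
  "internal_free_product G L I A \<longleftrightarrow>
     subgroup L G \<and> (\<forall>i\<in>I. subgroup (A i) G) \<and>
     bij_betw (word_value G) (reduced_words G I A) L"

text \<open>
  The family consisting of one distinguished subgroup \<open>C\<close> (index \<^const>\<open>None\<close>) and of the members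
  of a set of subgroups (each indexed by itself, so that it occurs once), to be used with the
  index set \<open>insert None (Some ` \<H>)\<close>.
\<close>

definition adjoin_factor :: "'g set \<Rightarrow> 'g set option \<Rightarrow> 'g set" where
  "adjoin_factor C i = (case i of None \<Rightarrow> C | Some H \<Rightarrow> H)"

end

(*
  The turns of a chain of points are measured by Gromov products. A chain whose turns are small compared
  with its steps stays close to a geodesic, and every point is almost as close to one of its segments as
  it is to the geodesic, up to 2 delta, whatever the bound on the turns (chain_near). Starting from a set A
  invariant under a group N0, one enlarges A and N0 step by step (a windmill): at each stage the apices
  that have become close to the current set Y see the whole of Y in a single direction, so a non-trivial
  rotation about one of them moves Y to the opposite side. Hence a reduced product of such rotations draws
  a chain with small turns: the rotation groups and the current group generate their free product, and
  the enlarged set is again quasi-convex, with constants that do not deteriorate.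

  With A a point this gives a Greendlinger lemma: if k in K is non-trivial, a geodesic from x to k x passes
  near an apex about which it can be rotated to become shorter. For (i), a geodesic quadrilateral of the
  quotient is lifted to a polygon that need not close up. By the Greendlinger lemma it can be closed by
  rotating parts of its sides about apices near them; the sides remain chains with small turns because
  they are minimal in the quotient. The four point inequality then follows from the one in X.

  For (ii), choose g in the coset and x such that d(x, g x) is almost minimal among all choices, and let
  A be the hull of the orbit of x under g and N0 the group generated by g. An apex v close to A sees A in
  two directions; minimality, applied to h g for h in the rotation group of v, shows that no rotation about
  v brings one of them close to the other, so that the windmill can be started from A.
*)

theory Submission
  imports Defs
begin

section \<open>Chains in almost geodesic hyperbolic spaces\<close>

text \<open>The chain lemmas need long steps, but loxodromy on the quotient does not make
  \<open>g\<close> translate far in \<open>X\<close>. The length comes from the apices: an apex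
  close to \<open>A\<close> is moved by \<open>g\<close> to another apex, hence by at least
  \<sigma>, and then \<open>x\<close> is moved as far up to 52 \<delta>. If no apex is close to
  \<open>A\<close>, the first step of the windmill has nothing to check. The quasi-convexity bound
  of a windmill does grow with the stage; what stays fixed is its margin of 10 \<delta> to the
  radius at which apices have been absorbed. This margin makes a new apex see \<open>Y\<close> in a
  single direction. The enlarged set is not quasi-convex outright, since its chains run through
  apices that need not belong to it; hence the second alternative in \<open>quasi\<close>. Condition
  (R1) is local and enters only through \<open>rot_fix\<close> and \<open>rot_gp\<close>. For the
  sides of a polygon in the quotient, minimality replaces it: the turn at an apex is bounded
  whatever rotation is made there, so a side can be rotated any number of times.\<close>

lemma path_length_two:
  fixes d :: "'x \<Rightarrow> 'x \<Rightarrow> real"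
  assumes "0 \<le> s" "s \<le> 1"
  shows "ennreal (d (c 0) (c s)) + ennreal (d (c s) (c 1)) \<le> path_length d c"
proof -
  have "(\<Sum>i<length [0,s,1] - 1. ennreal (d (c ([0,s,1] ! i)) (c ([0,s,1] ! Suc i)))) \<le> path_length d c"
    unfolding path_length_def by (rule SUP_upper) (use assms in auto)
  then show ?thesis by (simp add: numeral_2_eq_2)
qed

text \<open>A length space need not be geodesic. Along a path of length below
  \<open>d x y + \<epsilon>\<close> the distance to \<open>x\<close> varies continuously, so it
  takes the value \<open>t\<close> exactly; the lengths of the two pieces then bound the distance to
  \<open>y\<close>.\<close>

lemma length_space_almost_between:
  assumes "length_space X d" "x \<in> X" "y \<in> X" "0 \<le> t" "t \<le> d x y" "\<epsilon> > 0"
  shows "\<exists>z\<in>X. d x z = t \<and> d z y \<le> d x y - t + \<epsilon>"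
proof -
  interpret Metric_space X d using assms(1) by (simp add: length_space_def)
  have "(INF c \<in> {c. pathin mtopology c \<and> c 0 = x \<and> c 1 = y}. path_length d c) < ennreal (d x y + \<epsilon>)"
  proof -
    have "ennreal (d x y) = (INF c \<in> {c. pathin mtopology c \<and> c 0 = x \<and> c 1 = y}. path_length d c)"
      using assms(1-3) by (simp add: length_space_def)
    moreover have "ennreal (d x y) < ennreal (d x y + \<epsilon>)"
      using assms by (simp add: ennreal_less_iff)
    ultimately show ?thesis by simp
  qed
  then obtain c where c: "pathin mtopology c" "c 0 = x" "c 1 = y" "path_length d c < ennreal (d x y + \<epsilon>)"
    by (auto simp: INF_less_iff)
  have cX: "c s \<in> X" if "0 \<le> s" "s \<le> 1" for s
    using c(1) that unfolding pathin_def continuous_map_def by (auto simp: Pi_iff)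
  have "continuous_map mtopology euclideanreal (d x)"
    using continuous_on_mdist[of x Self] assms(2) by (simp add: mtopology_of_def)
  then have "continuous_map (top_of_set {0..1}) euclideanreal (d x \<circ> c)"
    using c(1) unfolding pathin_def by (rule continuous_map_compose[rotated])
  then have "continuous_on {0..1} (d x \<circ> c)" by simp
  moreover have "(d x \<circ> c) 0 \<le> t" "t \<le> (d x \<circ> c) 1" using c assms by auto
  ultimately obtain s where s: "0 \<le> s" "s \<le> 1" "d x (c s) = t"
    using IVT'[of "d x \<circ> c" 0 t 1] by auto
  have "ennreal (d (c 0) (c s)) + ennreal (d (c s) (c 1)) < ennreal (d x y + \<epsilon>)"
    using path_length_two[OF s(1,2)] c(4) by (rule le_less_trans)
  then have "ennreal (d x (c s) + d (c s) y) < ennreal (d x y + \<epsilon>)"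
    using c by (simp flip: ennreal_plus)
  then have "d x (c s) + d (c s) y < d x y + \<epsilon>"
    by (simp add: ennreal_less_iff del: ennreal_plus)
  then show ?thesis using s cX by (intro bexI[of _ "c s"]) auto
qed

locale hyp = Metric_space X d for X :: "'x set" and d +
  fixes \<delta> :: real
  assumes delta_pos: "\<delta> > 0"
    and hyp4: "\<lbrakk>x \<in> X; y \<in> X; z \<in> X; t \<in> X\<rbrakk> \<Longrightarrow>
      min (gromov_product d x y t) (gromov_product d y z t) - \<delta> \<le> gromov_product d x z t"
    and almost_between: "\<lbrakk>x \<in> X; y \<in> X; 0 \<le> s; s \<le> d x y; \<epsilon> > 0\<rbrakk> \<Longrightarrow>
      \<exists>z\<in>X. d x z = s \<and> d z y \<le> d x y - s + \<epsilon>"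
begin

abbreviation gp where "gp \<equiv> gromov_product d"

lemma gp_commute: "gp x y z = gp y x z"
  by (simp add: gromov_product_def commute add.commute)

lemma gp_swap: "gp x y z + gp z y x = d x z"
  by (simp add: gromov_product_def commute field_simps)

lemma gp_eq: "2 * gp x y z = d x z + d y z - d x y"
  by (simp add: gromov_product_def)

lemma gp_double: "d x z + d z y = d x y + 2 * gp x y z"
  using gp_eq[of x y z] commute[of y z] by simp

lemma gp_nonneg: "\<lbrakk>x \<in> X; y \<in> X; z \<in> X\<rbrakk> \<Longrightarrow> 0 \<le> gp x y z"
  using triangle[of x z y] by (simp add: gromov_product_def commute[of y z])

lemma gp_le: "\<lbrakk>x \<in> X; y \<in> X; z \<in> X\<rbrakk> \<Longrightarrow> gp x y z \<le> d x z"
  using gp_swap[of x y z] gp_nonneg[of z y x] by simp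

lemma gp_le': "\<lbrakk>x \<in> X; y \<in> X; z \<in> X\<rbrakk> \<Longrightarrow> gp x y z \<le> d y z"
  using gp_le[of y x z] by (simp add: gp_commute)

lemma gp_same [simp]: "x \<in> X \<Longrightarrow> gp x x z = d x z"
  by (simp add: gromov_product_def)

lemma gp_base [simp]: "x \<in> X \<Longrightarrow> gp x y x = 0" "y \<in> X \<Longrightarrow> gp x y y = 0"
  by (simp_all add: gromov_product_def commute)

lemma hyp5: "\<lbrakk>x \<in> X; y \<in> X; z \<in> X; w \<in> X; t \<in> X\<rbrakk> \<Longrightarrow>
    min (gp x y t) (min (gp y z t) (gp z w t)) - 2 * \<delta> \<le> gp x w t"
  using hyp4[of x y z t] hyp4[of x z w t] delta_pos by linarith

lemma four_point: "\<lbrakk>x \<in> X; y \<in> X; z \<in> X; t \<in> X\<rbrakk> \<Longrightarrow>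
    d x z + d y t \<le> max (d x y + d z t) (d y z + d x t) + 2 * \<delta>"
  using hyp4[of x y z t] gp_eq[of x y t] gp_eq[of y z t] gp_eq[of x z t] by linarith

text \<open>The bound \<open>a + \<delta>\<close> reproduces itself. As the step is long, the bound
  at \<open>c j\<close> means that \<open>c i\<close> and \<open>c j\<close> are seen in the same
  direction from \<open>c (j + 1)\<close>. The next turn is then measured from \<open>c i\<close>
  instead of \<open>c j\<close> at the cost of one \<delta>, always against the hypothesis
  \<open>a\<close> and never against the previous estimate.\<close>

lemma chain_gp_left:
  fixes c :: "nat \<Rightarrow> 'x"
  assumes X: "\<And>i. i \<le> n \<Longrightarrow> c i \<in> X"
    and turn: "\<And>i. \<lbrakk>0 < i; i < n\<rbrakk> \<Longrightarrow> gp (c (i - 1)) (c (i + 1)) (c i) \<le> a"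
    and long: "\<And>i. \<lbrakk>0 < i; i + 1 < n\<rbrakk> \<Longrightarrow> 2 * a + 4 * \<delta> < d (c i) (c (i + 1))"
    and "i < j" "j < n"
  shows "gp (c i) (c (j + 1)) (c j) \<le> a + \<delta>"
  using assms(4,5)
proof (induction j)
  case (Suc j)
  show ?case
  proof (cases "i = j")
    case True
    then show ?thesis using turn[of "Suc j"] Suc.prems delta_pos by simp
  next
    case False
    then have "i < j" using Suc by simp
    have *: "c i \<in> X" "c j \<in> X" "c (Suc j) \<in> X" "c (Suc (Suc j)) \<in> X" using Suc.prems X by auto
    have "gp (c i) (c (Suc j)) (c j) \<le> a + \<delta>" using Suc \<open>i < j\<close> by simp
    moreover have "2 * a + 4 * \<delta> < d (c j) (c (Suc j))" using long[of j] Suc.prems \<open>i < j\<close> by simp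
    ultimately have "gp (c j) (c i) (c (Suc j)) > a + \<delta>"
      using gp_swap[of "c j" "c i" "c (Suc j)"] gp_commute delta_pos by (smt (verit))
    moreover have "gp (c j) (c (Suc (Suc j))) (c (Suc j)) \<le> a"
      using turn[of "Suc j"] Suc.prems by simp
    ultimately show ?thesis
      using hyp4[OF *(2,1,4,3)] by simp
  qed
qed simp

lemma chain_gp:
  fixes c :: "nat \<Rightarrow> 'x"
  assumes X: "\<And>i. i \<le> n \<Longrightarrow> c i \<in> X"
    and turn: "\<And>i. \<lbrakk>0 < i; i < n\<rbrakk> \<Longrightarrow> gp (c (i - 1)) (c (i + 1)) (c i) \<le> a"
    and long: "\<And>i. \<lbrakk>0 < i; i + 1 < n\<rbrakk> \<Longrightarrow> 2 * a + 6 * \<delta> \<le> d (c i) (c (i + 1))"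
    and "i < j" "j < k" "k \<le> n"
  shows "gp (c i) (c k) (c j) \<le> a + 2 * \<delta>"
proof -
  have long': "2 * a + 4 * \<delta> < d (c i) (c (i + 1))" if "0 < i" "i + 1 < n" for i
    using long[OF that] delta_pos by simp
  have L: "gp (c i) (c (j + 1)) (c j) \<le> a + \<delta>" if "i < j" "j < n" for i j
    using X turn long' that by (rule chain_gp_left)
  \<comment> \<open>The reversed chain satisfies the same hypotheses; this bounds the product of
    \<open>c (j - 1)\<close> with the far end \<open>c k\<close>. Replacing \<open>c (j - 1)\<close>
    by \<open>c i\<close> costs the second \<delta>.\<close>
  define c' where "c' i = c (n - i)" for i
  have R0: "gp (c' i) (c' (j + 1)) (c' j) \<le> a + \<delta>" if "i < j" "j < n" for i j
  proof (rule chain_gp_left[where n = n])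
    show "c' i \<in> X" if "i \<le> n" for i using X[of "n - i"] by (simp add: c'_def)
    show "gp (c' (i - 1)) (c' (i + 1)) (c' i) \<le> a" if "0 < i" "i < n" for i
      using turn[of "n - i"] that by (simp add: c'_def gp_commute Suc_diff_le)
    show "2 * a + 4 * \<delta> < d (c' i) (c' (i + 1))" if "0 < i" "i + 1 < n" for i
      using long'[of "n - i - 1"] that by (simp add: c'_def commute Suc_diff_Suc)
  qed (use that in auto)
  have R: "gp (c (j - 1)) (c k) (c j) \<le> a + \<delta>"
    using R0[of "n - k" "n - j"] assms(4-6) by (simp add: c'_def gp_commute)
  show ?thesis
  proof (cases "j = i + 1")
    case True
    then show ?thesis using R delta_pos by simp
  next
    case False
    then have *: "i < j - 1" "j - 1 + 1 = j" "j < n" using assms(4-6) by auto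
    have X4: "c i \<in> X" "c (j - 1) \<in> X" "c k \<in> X" "c j \<in> X" using X assms(4-6) by auto
    have "gp (c i) (c j) (c (j - 1)) \<le> a + \<delta>" using L[of i "j - 1"] * by simp
    moreover have "2 * a + 6 * \<delta> \<le> d (c (j - 1)) (c j)" using long[of "j - 1"] * by simp
    ultimately have "gp (c (j - 1)) (c i) (c j) \<ge> a + 4 * \<delta>"
      using gp_swap[of "c (j - 1)" "c i" "c j"] gp_commute delta_pos by (smt (verit))
    then show ?thesis using hyp4[OF X4(2,1,3,4)] R delta_pos by linarith
  qed
qed

text \<open>The loss \<open>2 * \<delta>\<close> depends neither on the length of the chain nor on its turning bound \<open>a\<close>.\<close>

lemma chain_near:
  fixes c :: "nat \<Rightarrow> 'x"
  assumes X: "\<And>i. i \<le> n \<Longrightarrow> c i \<in> X"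
    and turn: "\<And>i. \<lbrakk>0 < i; i < n\<rbrakk> \<Longrightarrow> gp (c (i - 1)) (c (i + 1)) (c i) \<le> a"
    and long: "\<And>i. \<lbrakk>0 < i; i + 1 < n\<rbrakk> \<Longrightarrow> 2 * a + 6 * \<delta> \<le> d (c i) (c (i + 1))"
    and "0 < n" and p: "p \<in> X"
  shows "\<exists>i<n. gp (c i) (c (i + 1)) p \<le> gp (c 0) (c n) p + 2 * \<delta>"
proof -
  define s where "s = gp (c 0) (c n) p"
  \<comment> \<open>The required segment is one at which the product with the end point
    \<open>c n\<close> crosses \<open>s + \<delta>\<close>, or the last one if no crossing
    occurs.\<close>
  have "\<exists>i<n. gp (c i) (c n) p \<le> s + \<delta> \<and> (i + 1 < n \<longrightarrow> s + \<delta> < gp (c (i + 1)) (c n) p)"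
  proof (rule ccontr)
    assume *: "\<not> ?thesis"
    have "i < n \<Longrightarrow> gp (c i) (c n) p \<le> s + \<delta>" for i
    proof (induction i)
      case 0 then show ?case using delta_pos by (simp add: s_def)
    next
      case (Suc i) then show ?case using * by (metis Suc_eq_plus1 Suc_lessD not_less)
    qed
    then show False using * \<open>0 < n\<close> by (metis Suc_eq_plus1 Suc_pred less_irrefl lessI)
  qed
  then obtain i where i: "i < n" "gp (c i) (c n) p \<le> s + \<delta>"
    and i1: "i + 1 < n \<Longrightarrow> s + \<delta> < gp (c (i + 1)) (c n) p" by blast
  have XX: "c 0 \<in> X" "c i \<in> X" "c (i + 1) \<in> X" "c n \<in> X" using X i(1) by auto
  \<comment> \<open>The chain hardly turns at \<open>c j\<close>, so \<open>gp (c 0) p (c j)\<close>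
    or \<open>gp p (c n) (c j)\<close> is at most \<open>a + 3 * \<delta>\<close>; adding the
    matching product at \<open>p\<close> gives the distance. If both ends of a segment are this
    close to \<open>p\<close>, its length of at least \<open>2 * a + 6 * \<delta>\<close> brings its
    product at \<open>p\<close> down to \<open>s + 2 * \<delta>\<close>: here \<open>a\<close>
    cancels.\<close>
  have far: "d p (c j) \<le> s + a + 5 * \<delta>"
    if "0 < j" "j < n" "gp (c 0) (c j) p \<le> s + 2 * \<delta>" "gp (c j) (c n) p \<le> s + 2 * \<delta>" for j
  proof -
    have cj: "c j \<in> X" using X that by auto
    have "gp (c 0) (c n) (c j) \<le> a + 2 * \<delta>"
      using X turn long that by (intro chain_gp[where n = n]) auto
    then show ?thesis using hyp4[OF XX(1) p XX(4) cj] gp_swap[of p "c 0" "c j"] gp_swap[of p "c n" "c j"]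
        that gp_commute[of "c j" "c 0" p] gp_commute[of p "c 0" "c j"] gp_commute[of p "c n" "c j"] gp_commute[of "c j" "c n" p]
      by linarith
  qed
  have "gp (c i) (c (i + 1)) p \<le> s + 2 * \<delta>"
  proof (rule ccontr)
    assume neg: "\<not> ?thesis"
    show False
    proof (cases "i + 1 = n")
      case True
      then show ?thesis using neg i delta_pos by simp
    next
      case False
      then have in1: "i + 1 < n" using i by simp
      have b1: "gp (c 0) (c (i + 1)) p \<le> s + \<delta>"
        using hyp4[OF XX(1,3,4) p] i1[OF in1] by (simp add: s_def)
      have a0: "gp (c 0) (c i) p \<le> s + 2 * \<delta>"
        using hyp4[OF XX(1,2,3) p] b1 neg by linarith
      have bn: "gp (c (i + 1)) (c n) p \<le> s + 2 * \<delta>"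
        using hyp4[OF XX(2,3,4) p] i(2) neg by linarith
      show False
      proof (cases "i = 0")
        case True
        then have "d (c 0) p \<le> s + 2 * \<delta>" using a0 XX by simp
        then show False using neg True gp_le[OF XX(1,3) p] by simp
      next
        case i0: False
        have "d p (c i) \<le> s + a + 5 * \<delta>" using far[of i] i0 i a0 delta_pos by linarith
        moreover have "d p (c (i + 1)) \<le> s + a + 5 * \<delta>" using far[of "i + 1"] in1 b1 bn delta_pos by linarith
        moreover have "2 * a + 6 * \<delta> \<le> d (c i) (c (i + 1))" using long[of i] i0 in1 by simp
        ultimately show False using neg gp_double[of "c i" p "c (i + 1)"] commute[of "c i" p] by linarith
      qed
    qed
  qed
  then show ?thesis using i by (auto simp: s_def)
qed

text \<open>\<open>z\<close> is placed where the inscribed circle of the comparison triangle touches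
  the side \<open>x y\<close>; it stands in for a projection of \<open>q\<close> to a
  geodesic.\<close>

lemma triangle_center:
  assumes X: "x \<in> X" "y \<in> X" "q \<in> X"
  shows "\<exists>z\<in>X. gp x y z \<le> \<delta> \<and> d q z \<le> gp x y q + 3 * \<delta> \<and> d x z = gp y q x \<and> d z y \<le> gp x q y + \<delta>"
proof -
  have "gp y q x \<le> d x y" using gp_le[of y q x] X commute by simp
  then obtain z where z: "z \<in> X" "d x z = gp y q x" "d z y \<le> d x y - gp y q x + \<delta>"
    using almost_between[of x y "gp y q x" \<delta>] X gp_nonneg[of y q x] delta_pos by auto
  have 1: "gp x y z \<le> \<delta>" using z gp_eq[of x y z] commute[of z y] delta_pos by linarith
  have 2: "d q z \<le> gp x y q + 3 * \<delta>"
    using four_point[OF X(1) X(3) X(2) z(1)] z(2,3) gp_eq[of y q x] gp_eq[of x y q]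
      commute[of x q] commute[of y q] commute[of y x] commute[of z y] delta_pos
    by linarith
  have 3: "d z y \<le> gp x q y + \<delta>" using z(3) gp_swap[of y q x] gp_commute[of y q x] commute[of y x] gp_commute by (smt (verit))
  show ?thesis using 1 2 3 z by blast
qed

text \<open>The centre of the triangle \<open>a b c\<close>, taken on the diagonal
  \<open>a c\<close>, is close to \<open>a b\<close> and \<open>b c\<close>, and by the four point
  inequality also to one of the two sides at \<open>e\<close>. Either of these is opposite to a side
  already reached.\<close>

lemma quad_center:
  assumes X: "a \<in> X" "b \<in> X" "c \<in> X" "e \<in> X"
  shows "\<exists>p\<in>X. gp a b p \<le> 2 * \<delta> \<and> gp c e p \<le> 2 * \<delta> \<or> gp b c p \<le> 2 * \<delta> \<and> gp e a p \<le> 2 * \<delta>"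
proof -
  obtain p where p: "p \<in> X" "gp a c p \<le> \<delta>" "d b p \<le> gp a c b + 3 * \<delta>" "d a p = gp c b a" "d p c \<le> gp a b c + \<delta>"
    using triangle_center[of a c b] X by blast
  have 1: "gp a b p \<le> 2 * \<delta>" and 2: "gp b c p \<le> 2 * \<delta>"
    using p(3-5) delta_pos gp_eq[of a b p] gp_eq[of b c p] gp_eq[of a c b] gp_eq[of c b a] gp_eq[of a b c]
      commute[of a b] commute[of a c] commute[of b c] commute[of c p] by linarith+
  have "gp c e p \<le> 2 * \<delta> \<or> gp e a p \<le> 2 * \<delta>"
    using hyp4[OF X(3,4,1) p(1)] p(2) gp_commute[of a c p] by linarith
  then show ?thesis using 1 2 p(1) by blast
qed

end

section \<open>Rotations and words\<close>

locale hyp_act = hyp X d \<delta> + group G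
  for X :: "'x set" and d \<delta> and G :: "('g, 'b) monoid_scheme" (structure) +
  fixes \<phi> :: "'g \<Rightarrow> 'x \<Rightarrow> 'x"
  assumes isometric_action: "acts_by_isometries G X d \<phi>"
begin

lemma act_group_action: "group_action G X \<phi>"
  using isometric_action by (simp add: acts_by_isometries_def)

lemma act_closed [simp]: "\<lbrakk>g \<in> carrier G; x \<in> X\<rbrakk> \<Longrightarrow> \<phi> g x \<in> X"
  using group_action.element_image[OF act_group_action] by blast

lemma act_mult: "\<lbrakk>g \<in> carrier G; h \<in> carrier G; x \<in> X\<rbrakk> \<Longrightarrow> \<phi> (g \<otimes> h) x = \<phi> g (\<phi> h x)"
  using group_action.composition_rule[OF act_group_action] by blast

lemma act_one [simp]: "x \<in> X \<Longrightarrow> \<phi> \<one> x = x"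
  using group_action.id_eq_one[OF act_group_action] by (metis restrict_apply')

lemma act_inv [simp]: "\<lbrakk>g \<in> carrier G; x \<in> X\<rbrakk> \<Longrightarrow> \<phi> (inv g) (\<phi> g x) = x"
  using act_mult[of "inv g" g x] by simp

lemma act_inv' [simp]: "\<lbrakk>g \<in> carrier G; x \<in> X\<rbrakk> \<Longrightarrow> \<phi> g (\<phi> (inv g) x) = x"
  using act_mult[of g "inv g" x] by simp

lemma act_eq_iff: "\<lbrakk>g \<in> carrier G; x \<in> X; y \<in> X\<rbrakk> \<Longrightarrow> \<phi> g x = \<phi> g y \<longleftrightarrow> x = y"
  by (metis act_inv)

lemma act_dist [simp]: "\<lbrakk>g \<in> carrier G; x \<in> X; y \<in> X\<rbrakk> \<Longrightarrow> d (\<phi> g x) (\<phi> g y) = d x y"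
  using isometric_action by (simp add: acts_by_isometries_def)

lemma act_gp [simp]:
  "\<lbrakk>g \<in> carrier G; x \<in> X; y \<in> X; z \<in> X\<rbrakk> \<Longrightarrow> gp (\<phi> g x) (\<phi> g y) (\<phi> g z) = gp x y z"
  by (simp add: gromov_product_def)

lemma act_dist_inv:
  "\<lbrakk>g \<in> carrier G; x \<in> X; y \<in> X\<rbrakk> \<Longrightarrow> d (\<phi> (inv g) x) y = d x (\<phi> g y)"
  using act_dist[of g "\<phi> (inv g) x" y] by simp

lemma act_gp_inv:
  "\<lbrakk>g \<in> carrier G; x \<in> X; y \<in> X; p \<in> X\<rbrakk> \<Longrightarrow> gp x y (\<phi> (inv g) p) = gp (\<phi> g x) (\<phi> g y) p"
  using act_gp[of g x y "\<phi> (inv g) p"] by simp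

end

lemma (in group) inv_mult_cancel:
  "\<lbrakk>x \<in> carrier G; y \<in> carrier G\<rbrakk> \<Longrightarrow> inv x \<otimes> (x \<otimes> y) = y"
  "\<lbrakk>x \<in> carrier G; y \<in> carrier G\<rbrakk> \<Longrightarrow> x \<otimes> (inv x \<otimes> y) = y"
  by (simp_all flip: m_assoc)

locale rot_fam = hyp_act X d \<delta> G \<phi>
  for X :: "'x set" and d \<delta> and G :: "('g, 'b) monoid_scheme" (structure) and \<phi> +
  fixes V :: "'x set" and rot :: "'x \<Rightarrow> 'g set" and \<sigma> :: real
  assumes V_sub: "V \<subseteq> X"
    and rot_subgroup: "v \<in> V \<Longrightarrow> subgroup (rot v) G"
    and rotates: "\<lbrakk>v \<in> V; h \<in> rot v; h \<noteq> \<one>; x \<in> X; d v x \<le> \<sigma> / 10\<rbrakk> \<Longrightarrow> d (\<phi> h x) x = 2 * d v x"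
    and sep: "\<lbrakk>v \<in> V; w \<in> V; v \<noteq> w\<rbrakk> \<Longrightarrow> \<sigma> \<le> d v w"
    and V_inv: "\<lbrakk>g \<in> carrier G; v \<in> V\<rbrakk> \<Longrightarrow> \<phi> g v \<in> V"
    and rot_conj: "\<lbrakk>g \<in> carrier G; v \<in> V; h \<in> rot v\<rbrakk> \<Longrightarrow> g \<otimes> h \<otimes> inv g \<in> rot (\<phi> g v)"
    and sigma: "1000 * \<delta> < \<sigma>"
begin

lemma V_X [simp]: "v \<in> V \<Longrightarrow> v \<in> X"
  using V_sub by blast

lemma rot_carrier: "\<lbrakk>v \<in> V; h \<in> rot v\<rbrakk> \<Longrightarrow> h \<in> carrier G"
  using rot_subgroup subgroup.subset by blast

lemma rot_fix: "\<lbrakk>v \<in> V; h \<in> rot v\<rbrakk> \<Longrightarrow> \<phi> h v = v"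
proof (cases "h = \<one>")
  case False
  assume *: "v \<in> V" "h \<in> rot v"
  then have "d (\<phi> h v) v = 0" using rotates[of v h v] False sigma delta_pos by simp
  then show ?thesis using * rot_carrier by simp
qed simp

text \<open>(R1) only covers the ball of radius \<sigma>/10 about \<open>v\<close>. For a farther
  \<open>x\<close>, a point \<open>z\<close> at that distance on the way to \<open>x\<close> is
  turned back completely and lies in the direction of \<open>x\<close> as seen from
  \<open>v\<close>; two four point steps carry the conclusion over to \<open>x\<close>.\<close>

lemma rot_gp:
  assumes v: "v \<in> V" "h \<in> rot v" "h \<noteq> \<one>" and x: "x \<in> X"
  shows "gp x (\<phi> h x) v \<le> 2 * \<delta>"
proof -
  have h: "h \<in> carrier G" using v rot_carrier by blast
  have hv: "\<phi> h v = v" using v rot_fix by blast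
  have dv: "d (\<phi> h y) v = d y v" if "y \<in> X" for y using act_dist[of h y v] hv h that v by simp
  show ?thesis
  proof (cases "d v x \<le> \<sigma> / 10")
    case True
    then have "d (\<phi> h x) x = 2 * d v x" using rotates v x by blast
    then have "gp x (\<phi> h x) v = 0"
      using dv[OF x] gp_eq[of x "\<phi> h x" v] commute[of x "\<phi> h x"] commute[of v x] by simp
    then show ?thesis using delta_pos by simp
  next
    case False
    obtain z where z: "z \<in> X" "d v z = \<sigma> / 10" "d z x \<le> d v x - \<sigma> / 10 + \<delta>"
      using almost_between[of v x "\<sigma> / 10" \<delta>] v x False sigma delta_pos by auto
    have hz: "\<phi> h z \<in> X" "\<phi> h x \<in> X" using z x h by auto
    have "d (\<phi> h z) z = 2 * d v z" using rotates v z by simp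
    then have 0: "gp z (\<phi> h z) v = 0"
      using dv[OF z(1)] gp_eq[of z "\<phi> h z" v] commute[of z "\<phi> h z"] commute[of v z] by simp
    have 1: "gp z x v > 4 * \<delta>"
      using z False sigma gp_eq[of z x v] commute[of x v] commute[of z v] delta_pos by linarith
    moreover have "gp (\<phi> h x) (\<phi> h z) v = gp z x v"
      using act_gp[of h x z v] h hv x z v gp_commute by simp
    ultimately show ?thesis
      using hyp5[OF z(1) x hz(2,1), of v] 0 v delta_pos by auto
  qed
qed

definition wprod :: "('x \<times> 'g) list \<Rightarrow> 'g" where
  "wprod ws = foldr (\<lambda>(v, h) k. h \<otimes> k) ws \<one>"

definition is_word :: "('x \<times> 'g) list \<Rightarrow> bool" where
  "is_word ws \<longleftrightarrow> (\<forall>(v, h)\<in>set ws. v \<in> V \<and> h \<in> rot v)"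

text \<open>
  The word \<open>(v\<^sub>1, h\<^sub>1), \<dots>, (v\<^sub>n, h\<^sub>n)\<close> and the end points \<open>s\<close>, \<open>s'\<close> draw the chain
  \<open>s, v\<^sub>1, h\<^sub>1 v\<^sub>2, h\<^sub>1 h\<^sub>2 v\<^sub>3, \<dots>, h\<^sub>1 \<dots> h\<^sub>n s'\<close>.
\<close>

definition wpts :: "'x \<Rightarrow> ('x \<times> 'g) list \<Rightarrow> 'x \<Rightarrow> 'x list" where
  "wpts s ws s' = s # map fst ws @ [s']"

definition wchain :: "'x \<Rightarrow> ('x \<times> 'g) list \<Rightarrow> 'x \<Rightarrow> nat \<Rightarrow> 'x" where
  "wchain s ws s' i = \<phi> (wprod (take i ws)) (wpts s ws s' ! i)"

lemma wprod_Nil [simp]: "wprod [] = \<one>"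
  by (simp add: wprod_def)

lemma wprod_Cons [simp]: "wprod ((v, h) # ws) = h \<otimes> wprod ws"
  by (simp add: wprod_def)

lemma is_word_Nil [simp]: "is_word []"
  by (simp add: is_word_def)

lemma is_word_Cons [simp]: "is_word ((v, h) # ws) \<longleftrightarrow> v \<in> V \<and> h \<in> rot v \<and> is_word ws"
  by (simp add: is_word_def)

lemma is_word_append [simp]: "is_word (us @ ws) \<longleftrightarrow> is_word us \<and> is_word ws"
  by (auto simp: is_word_def)

lemma is_word_take: "is_word ws \<Longrightarrow> is_word (take i ws)"
  by (auto simp: is_word_def dest: in_set_takeD)

lemma wprod_closed [simp]: "is_word ws \<Longrightarrow> wprod ws \<in> carrier G"
proof (induction ws)
  case (Cons x ws)
  then show ?case using rot_carrier by (cases x) auto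
qed simp

lemma wprod_append: "\<lbrakk>is_word us; is_word ws\<rbrakk> \<Longrightarrow> wprod (us @ ws) = wprod us \<otimes> wprod ws"
proof (induction us)
  case (Cons x us)
  then show ?case using rot_carrier by (cases x) (auto simp: m_assoc)
qed simp

lemma wpts_X: "\<lbrakk>is_word ws; s \<in> X; s' \<in> X; i \<le> Suc (length ws)\<rbrakk> \<Longrightarrow> wpts s ws s' ! i \<in> X"
proof (cases i)
  case (Suc j)
  assume *: "is_word ws" "s' \<in> X" "i \<le> Suc (length ws)"
  show ?thesis
  proof (cases "j < length ws")
    case True
    then have "ws ! j \<in> set ws" by simp
    then have "fst (ws ! j) \<in> V" using *(1) by (auto simp: is_word_def)
    then show ?thesis using True Suc by (simp add: wpts_def nth_append)
  next
    case False
    then show ?thesis using * Suc by (simp add: wpts_def nth_append)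
  qed
qed (simp add: wpts_def)

lemma wchain_X: "\<lbrakk>is_word ws; s \<in> X; s' \<in> X; i \<le> Suc (length ws)\<rbrakk> \<Longrightarrow> wchain s ws s' i \<in> X"
  by (simp add: wchain_def wpts_X is_word_take)

lemma wchain_0 [simp]: "s \<in> X \<Longrightarrow> wchain s ws s' 0 = s"
  by (simp add: wchain_def wpts_def)

lemma wchain_last [simp]: "wchain s ws s' (Suc (length ws)) = \<phi> (wprod ws) s'"
  by (simp add: wchain_def wpts_def nth_append)

lemma wpts_letter: "i < length ws \<Longrightarrow> wpts s ws s' ! Suc i = fst (ws ! i)"
  by (simp add: wpts_def nth_append)

lemma is_word_nth: "\<lbrakk>is_word ws; i < length ws\<rbrakk> \<Longrightarrow> fst (ws ! i) \<in> V \<and> snd (ws ! i) \<in> rot (fst (ws ! i))"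
  unfolding is_word_def using bspec[OF _ nth_mem[of i ws]] by (fastforce simp: case_prod_beta)

lemma wprod_take_Suc:
  assumes "is_word ws" "i < length ws"
  shows "wprod (take (Suc i) ws) = wprod (take i ws) \<otimes> snd (ws ! i)"
proof -
  obtain v h where vh: "ws ! i = (v, h)" by force
  then have vh': "v \<in> V" "h \<in> rot v" using is_word_nth[OF assms] by auto
  have "take (Suc i) ws = take i ws @ [(v, h)]" using assms(2) vh by (metis take_Suc_conv_app_nth)
  then show ?thesis
    using wprod_append[OF is_word_take[OF assms(1)], of "[(v, h)]" i] vh vh' rot_carrier[OF vh'] by simp
qed

text \<open>A letter fixes its own apex, so point \<open>i + 1\<close> can be read with the prefix
  of length \<open>i\<close> as well as with that of length \<open>i + 1\<close>. Thus both ends of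
  a segment are translates by the same group element.\<close>

lemma wchain_Suc:
  assumes "is_word ws" "s \<in> X" "s' \<in> X" "i \<le> length ws"
  shows "wchain s ws s' (Suc i) = \<phi> (wprod (take i ws)) (wpts s ws s' ! Suc i)"
proof (cases "i < length ws")
  case True
  have v: "fst (ws ! i) \<in> V" "snd (ws ! i) \<in> rot (fst (ws ! i))"
    using is_word_nth assms True by auto
  then have "snd (ws ! i) \<in> carrier G" by (rule rot_carrier)
  then show ?thesis
    using assms True v rot_fix[OF v]
    by (simp add: wchain_def wprod_take_Suc wpts_letter act_mult is_word_take)
next
  case False
  then show ?thesis using assms by (simp add: wchain_def)
qed

lemma wchain_turn:
  assumes ws: "is_word ws" "s \<in> X" "s' \<in> X" "i < length ws"
  shows "gp (wchain s ws s' i) (wchain s ws s' (Suc (Suc i))) (wchain s ws s' (Suc i))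
       = gp (wpts s ws s' ! i) (\<phi> (snd (ws ! i)) (wpts s ws s' ! Suc (Suc i))) (fst (ws ! i))"
proof -
  define P where "P = wprod (take i ws)"
  have P: "P \<in> carrier G" using ws is_word_take by (simp add: P_def)
  have h: "snd (ws ! i) \<in> carrier G" using is_word_nth[OF ws(1,4)] rot_carrier by blast
  have X: "wpts s ws s' ! i \<in> X" "wpts s ws s' ! Suc i \<in> X" "wpts s ws s' ! Suc (Suc i) \<in> X"
    using ws wpts_X by auto
  have "wchain s ws s' i = \<phi> P (wpts s ws s' ! i)" by (simp add: wchain_def P_def)
  moreover have "wchain s ws s' (Suc i) = \<phi> P (wpts s ws s' ! Suc i)"
    using wchain_Suc ws by (simp add: P_def)
  moreover have "wchain s ws s' (Suc (Suc i)) = \<phi> P (\<phi> (snd (ws ! i)) (wpts s ws s' ! Suc (Suc i)))"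
    using wchain_Suc[OF ws(1-3), of "Suc i"] ws(4) wprod_take_Suc[OF ws(1,4)] X P h
    by (simp add: P_def act_mult)
  ultimately show ?thesis using P X h ws(4) by (simp add: wpts_letter)
qed

context
  fixes ws s s' a
  assumes ws: "is_word ws" "distinct_adj (map fst ws)" and s: "s \<in> X" "s' \<in> X"
    and turn: "\<And>i. i < length ws \<Longrightarrow>
      gp (wpts s ws s' ! i) (\<phi> (snd (ws ! i)) (wpts s ws s' ! Suc (Suc i))) (fst (ws ! i)) \<le> a"
    and a: "2 * a + 6 * \<delta> \<le> \<sigma>"
begin

lemma wchain_turn_le:
  "\<lbrakk>0 < i; i < Suc (length ws)\<rbrakk> \<Longrightarrow>
    gp (wchain s ws s' (i - 1)) (wchain s ws s' (i + 1)) (wchain s ws s' i) \<le> a"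
  using wchain_turn[OF ws(1) s, of "i - 1"] turn[of "i - 1"] by simp

lemma wchain_long:
  assumes i: "0 < i" "i + 1 < Suc (length ws)"
  shows "2 * a + 6 * \<delta> \<le> d (wchain s ws s' i) (wchain s ws s' (i + 1))"
proof -
  obtain j where j: "i = Suc j" "Suc j < length ws" using i by (cases i) auto
  have "fst (ws ! j) \<noteq> fst (ws ! Suc j)"
    using ws(2) j by (auto simp: distinct_adj_conv_nth)
  moreover have "fst (ws ! j) \<in> V" "fst (ws ! Suc j) \<in> V" using is_word_nth[OF ws(1)] j by auto
  ultimately have "\<sigma> \<le> d (fst (ws ! j)) (fst (ws ! Suc j))" using sep by blast
  moreover have "wchain s ws s' i = \<phi> (wprod (take i ws)) (fst (ws ! j))"
    using j by (simp add: wchain_def wpts_letter)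
  moreover have "wchain s ws s' (i + 1) = \<phi> (wprod (take i ws)) (fst (ws ! Suc j))"
    using wchain_Suc[OF ws(1) s, of i] j by (simp add: wpts_letter)
  ultimately show ?thesis
    using is_word_nth[OF ws(1)] j a ws is_word_take by simp
qed

lemma word_first_gp:
  assumes "ws \<noteq> []"
  shows "gp s (\<phi> (wprod ws) s') (fst (hd ws)) \<le> a + 2 * \<delta>"
proof -
  have "gp (wchain s ws s' 0) (wchain s ws s' (Suc (length ws))) (wchain s ws s' 1) \<le> a + 2 * \<delta>"
    by (rule chain_gp[where n = "Suc (length ws)"])
      (use wchain_X[OF ws(1) s] wchain_turn_le wchain_long assms in auto)
  moreover have "wchain s ws s' 1 = fst (hd ws)"
    using wchain_Suc[OF ws(1) s, of 0] assms is_word_nth[OF ws(1), of 0]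
    by (simp add: wpts_letter hd_conv_nth)
  ultimately show ?thesis using s by simp
qed

lemma word_near:
  assumes p: "p \<in> X"
  shows "\<exists>i\<le>length ws. gp (wpts s ws s' ! i) (wpts s ws s' ! Suc i) (\<phi> (inv (wprod (take i ws))) p)
      \<le> gp s (\<phi> (wprod ws) s') p + 2 * \<delta>"
proof -
  have "\<exists>i<Suc (length ws). gp (wchain s ws s' i) (wchain s ws s' (i + 1)) p
      \<le> gp (wchain s ws s' 0) (wchain s ws s' (Suc (length ws))) p + 2 * \<delta>"
    by (rule chain_near[where n = "Suc (length ws)"])
      (use wchain_X[OF ws(1) s] wchain_turn_le wchain_long p in auto)
  then obtain i where i: "i \<le> length ws"
    "gp (wchain s ws s' i) (wchain s ws s' (Suc i)) p \<le> gp s (\<phi> (wprod ws) s') p + 2 * \<delta>"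
    using s by (auto simp: less_Suc_eq_le)
  have "wchain s ws s' i = \<phi> (wprod (take i ws)) (wpts s ws s' ! i)" by (simp add: wchain_def)
  then show ?thesis
    using i wchain_Suc[OF ws(1) s i(1)] wpts_X[OF ws(1) s] p ws is_word_take[OF ws(1)]
    by (intro exI[of _ i]) (simp add: act_gp_inv)
qed

end

definition conj_word :: "'g \<Rightarrow> ('x \<times> 'g) list \<Rightarrow> ('x \<times> 'g) list" where
  "conj_word m = map (\<lambda>(v, h). (\<phi> m v, m \<otimes> h \<otimes> inv m))"

lemma conj_word_Nil [simp]: "conj_word m [] = []"
  by (simp add: conj_word_def)

lemma conj_word_Cons [simp]: "conj_word m ((v, h) # ws) = (\<phi> m v, m \<otimes> h \<otimes> inv m) # conj_word m ws"
  by (simp add: conj_word_def)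

lemma conj_word_is_Nil [simp]: "conj_word m ws = [] \<longleftrightarrow> ws = []"
  by (simp add: conj_word_def)

lemma wprod_conj: "\<lbrakk>m \<in> carrier G; is_word ws\<rbrakk> \<Longrightarrow> wprod (conj_word m ws) = m \<otimes> wprod ws \<otimes> inv m"
proof (induction ws)
  case (Cons x ws)
  obtain v h where x: "x = (v, h)" by force
  then have "h \<in> carrier G" "is_word ws" using Cons rot_carrier by auto
  then show ?case using Cons x by (simp add: m_assoc inv_mult_cancel)
qed (simp add: r_inv)

end

section \<open>One step of a windmill\<close>

locale tree_step = rot_fam X d \<delta> G \<phi> V rot \<sigma>
  for X :: "'x set" and d \<delta> and G :: "('g, 'b) monoid_scheme" (structure) and \<phi> V rot \<sigma> +
  fixes N :: "'g set" and Y W :: "'x set" and a :: real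
  assumes N_subgroup: "subgroup N G"
    and Y_sub: "Y \<subseteq> X"
    and Y_inv: "\<lbrakk>n \<in> N; y \<in> Y\<rbrakk> \<Longrightarrow> \<phi> n y \<in> Y"
    and W_sub: "W \<subseteq> V"
    and W_inv: "\<lbrakk>n \<in> N; v \<in> W\<rbrakk> \<Longrightarrow> \<phi> n v \<in> W"
    and turn: "\<lbrakk>v \<in> W; h \<in> rot v; h \<noteq> \<one>; s \<in> Y \<union> (W - {v}); s' \<in> Y \<union> (W - {v})\<rbrakk> \<Longrightarrow> gp s (\<phi> h s') v \<le> a"
    and a_le: "2 * a + 6 * \<delta> \<le> \<sigma>"
begin

abbreviation "N' \<equiv> generate G (N \<union> \<Union>(rot ` W))"

definition reduced :: "('x \<times> 'g) list \<Rightarrow> bool" where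
  "reduced ws \<longleftrightarrow> (\<forall>(v, h)\<in>set ws. v \<in> W \<and> h \<in> rot v \<and> h \<noteq> \<one>) \<and> distinct_adj (map fst ws)"

lemma W_V: "v \<in> W \<Longrightarrow> v \<in> V"
  using W_sub by blast

lemma N_carrier: "n \<in> N \<Longrightarrow> n \<in> carrier G"
  using N_subgroup subgroup.subset by blast

lemma gens_carrier: "N \<union> \<Union>(rot ` W) \<subseteq> carrier G"
  using N_carrier rot_carrier W_V by blast

lemma reduced_Nil [simp]: "reduced []"
  by (simp add: reduced_def)

lemma reduced_Cons: "reduced ((v, h) # ws) \<longleftrightarrow>
    v \<in> W \<and> h \<in> rot v \<and> h \<noteq> \<one> \<and> (ws \<noteq> [] \<longrightarrow> v \<noteq> fst (hd ws)) \<and> reduced ws"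
  by (auto simp: reduced_def distinct_adj_Cons hd_map)

lemma reduced_is_word: "reduced ws \<Longrightarrow> is_word ws"
  unfolding reduced_def is_word_def using W_V by fast

lemma reduced_distinct: "reduced ws \<Longrightarrow> distinct_adj (map fst ws)"
  by (simp add: reduced_def)

lemma reduced_nth: "\<lbrakk>reduced ws; i < length ws\<rbrakk> \<Longrightarrow>
    fst (ws ! i) \<in> W \<and> snd (ws ! i) \<in> rot (fst (ws ! i)) \<and> snd (ws ! i) \<noteq> \<one>"
  unfolding reduced_def using bspec[OF _ nth_mem[of i ws]] by (fastforce simp: case_prod_beta)

lemma wprod_in_N': "reduced ws \<Longrightarrow> wprod ws \<in> N'"
proof (induction ws)
  case Nil
  then show ?case by (simp add: generate.one)
next
  case (Cons x ws)
  obtain v h where "x = (v, h)" by force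
  with Cons show ?case by (auto simp: reduced_Cons intro!: generate.eng intro: generate.incl)
qed

lemma reduced_take: "reduced ws \<Longrightarrow> reduced (take i ws)"
  using distinct_adj_appendD1[of "take i (map fst ws)" "drop i (map fst ws)"]
  unfolding append_take_drop_id by (auto simp: reduced_def take_map dest!: in_set_takeD)

lemma reduced_mult:
  assumes "v \<in> W" "h \<in> rot v" "reduced ws"
  shows "\<exists>us. reduced us \<and> wprod us = h \<otimes> wprod ws"
proof (cases "h = \<one>")
  case True
  then show ?thesis using assms by (auto intro!: exI[of _ ws] simp: reduced_is_word)
next
  case h1: False
  have h: "h \<in> carrier G" using assms rot_carrier W_V by blast
  show ?thesis
  proof (cases "ws = [] \<or> fst (hd ws) \<noteq> v")
    case True
    then show ?thesis using assms h1 by (intro exI[of _ "(v, h) # ws"]) (auto simp: reduced_Cons)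
  next
    case False
    then obtain h' ws' where ws: "ws = (v, h') # ws'" by (cases ws) auto
    have h': "h' \<in> rot v" and ws': "reduced ws'" using assms(3) ws by (auto simp: reduced_Cons)
    have h'G: "h' \<in> carrier G" using assms h' rot_carrier W_V by blast
    have wG: "wprod ws' \<in> carrier G" using ws' reduced_is_word by simp
    have hh: "h \<otimes> h' \<in> rot v"
      using subgroup.m_closed[OF rot_subgroup] assms h' W_V by blast
    have eq: "h \<otimes> wprod ws = (h \<otimes> h') \<otimes> wprod ws'" using ws h h'G wG by (simp add: m_assoc)
    show ?thesis
    proof (cases "h \<otimes> h' = \<one>")
      case True
      then show ?thesis using eq ws' wG by auto
    next
      case False
      then show ?thesis using eq ws' hh assms ws
        by (intro exI[of _ "(v, h \<otimes> h') # ws'"]) (auto simp: reduced_Cons)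
    qed
  qed
qed

lemma reduced_conj:
  assumes "m \<in> N" "reduced ws"
  shows "reduced (conj_word m ws)"
  using assms(2)
proof (induction ws)
  case (Cons x ws)
  obtain v h where x: "x = (v, h)" by force
  have m: "m \<in> carrier G" using assms N_carrier by blast
  have v: "v \<in> W" "h \<in> rot v" "h \<noteq> \<one>" "reduced ws" using Cons.prems x by (auto simp: reduced_Cons)
  then have h: "h \<in> carrier G" using rot_carrier W_V by blast
  have "m \<otimes> h \<otimes> inv m \<noteq> \<one>"
  proof
    assume "m \<otimes> h \<otimes> inv m = \<one>"
    then have "inv m \<otimes> (m \<otimes> h \<otimes> inv m) \<otimes> m = \<one>" using m by simp
    then have "h = \<one>" using m h by (simp add: m_assoc inv_mult_cancel)
    then show False using v by simp
  qed
  moreover have "ws \<noteq> [] \<longrightarrow> \<phi> m v \<noteq> fst (hd (conj_word m ws))"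
  proof
    assume "ws \<noteq> []"
    then obtain w h' ws' where ws: "ws = (w, h') # ws'" by (metis list.exhaust prod.collapse)
    then have "v \<noteq> w" "w \<in> W" using Cons.prems x by (auto simp: reduced_Cons)
    then have "\<phi> m v \<noteq> \<phi> m w" using act_eq_iff[of m v w] m v W_V by simp
    then show "\<phi> m v \<noteq> fst (hd (conj_word m ws))" using ws by simp
  qed
  ultimately show ?case using Cons x v W_inv[OF assms(1)] rot_conj[OF m] W_V
    by (auto simp: reduced_Cons)
qed simp

text \<open>The products \<open>wprod ws \<otimes> m\<close> are stable under left multiplication by
  generators: a rotation is merged with the first letter by \<open>reduced_mult\<close>, and an
  element of \<open>N\<close> moves past a word by conjugating its letters, which keeps the apices
  in \<open>W\<close>.\<close>

lemma normal_form:
  assumes "k \<in> N'"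
  shows "\<exists>ws m. reduced ws \<and> m \<in> N \<and> k = wprod ws \<otimes> m"
proof -
  define M where "M = {wprod ws \<otimes> m | ws m. reduced ws \<and> m \<in> N}"
  have MI: "wprod ws \<otimes> m \<in> M" if "reduced ws" "m \<in> N" for ws m using that by (auto simp: M_def)
  have one: "\<one> \<in> N" using N_subgroup by (simp add: subgroup.one_closed)
  have MG: "k \<in> carrier G" if "k \<in> M" for k
    using that N_carrier reduced_is_word by (auto simp: M_def)
  have rotM: "h \<otimes> k \<in> M" if hv: "v \<in> W" "h \<in> rot v" and k: "k \<in> M" for v h k
  proof -
    obtain ws m where k: "reduced ws" "m \<in> N" "k = wprod ws \<otimes> m" using k by (auto simp: M_def)
    obtain us where us: "reduced us" "wprod us = h \<otimes> wprod ws" using reduced_mult hv k by blast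
    have "h \<in> carrier G" using hv rot_carrier W_V by blast
    then have "h \<otimes> k = wprod us \<otimes> m" using us k N_carrier reduced_is_word by (simp add: m_assoc)
    then show ?thesis using MI[OF us(1) k(2)] by simp
  qed
  have NM: "n \<otimes> k \<in> M" if n: "n \<in> N" and k: "k \<in> M" for n k
  proof -
    obtain ws m where k: "reduced ws" "m \<in> N" "k = wprod ws \<otimes> m" using k by (auto simp: M_def)
    have "n \<otimes> k = wprod (conj_word n ws) \<otimes> (n \<otimes> m)"
      using n k N_carrier reduced_is_word by (simp add: wprod_conj m_assoc inv_mult_cancel)
    then show ?thesis using MI reduced_conj n k subgroup.m_closed[OF N_subgroup] by simp
  qed
  have MM: "k \<otimes> l \<in> M" if k: "k \<in> M" and l: "l \<in> M" for k l
  proof -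
    obtain ws m where k: "reduced ws" "m \<in> N" "k = wprod ws \<otimes> m" using k by (auto simp: M_def)
    have "wprod us \<otimes> l' \<in> M" if "reduced us" "l' \<in> M" for us l'
      using that
    proof (induction us)
      case (Cons x us)
      obtain v h where x: "x = (v, h)" by force
      have v: "v \<in> W" "h \<in> rot v" "reduced us" using Cons.prems x by (auto simp: reduced_Cons)
      have "h \<in> carrier G" using v rot_carrier W_V by blast
      then have "wprod (x # us) \<otimes> l' = h \<otimes> (wprod us \<otimes> l')"
        using v x MG Cons.prems reduced_is_word by (simp add: m_assoc)
      then show ?case using Cons v rotM by simp
    qed (simp add: MG)
    moreover have "k \<otimes> l = wprod ws \<otimes> (m \<otimes> l)"
      using k l MG N_carrier reduced_is_word by (simp add: m_assoc)
    ultimately show ?thesis using NM k l by simp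
  qed
  have NinM: "n \<in> M" if "n \<in> N" for n using MI[of "[]" n] that N_carrier by simp
  have oneM: "\<one> \<in> M" using NinM one by blast
  have gens: "x \<in> M" if x: "x \<in> N \<union> \<Union>(rot ` W)" for x
  proof (cases "x \<in> N")
    case False
    then obtain v where "v \<in> W" "x \<in> rot v" using x False by blast
    then show ?thesis using rotM[OF _ _ oneM] rot_carrier W_V by fastforce
  qed (use NinM in blast)
  have inv_gens: "inv x \<in> N \<union> \<Union>(rot ` W)" if "x \<in> N \<union> \<Union>(rot ` W)" for x
    using that subgroup.m_inv_closed[OF N_subgroup] subgroup.m_inv_closed[OF rot_subgroup] W_V by blast
  have "k \<in> M" using assms by (induction rule: generate.induct) (use oneM gens inv_gens MM in auto)
  then show ?thesis by (auto simp: M_def)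
qed

text \<open>A chain may also end at an apex other than the neighbouring one: \<open>shorten\<close>
  starts the tail of a word at the apex of the letter it removes.\<close>

definition end_ok :: "'x \<Rightarrow> 'x list \<Rightarrow> bool" where
  "end_ok s vs \<longleftrightarrow> s \<in> Y \<or> s \<in> W \<and> (vs \<noteq> [] \<longrightarrow> s \<noteq> hd vs)"

lemma Y_end_ok: "y \<in> Y \<Longrightarrow> end_ok y vs"
  by (simp add: end_ok_def)

lemma YW_X: "s \<in> Y \<union> W \<Longrightarrow> s \<in> X"
  using Y_sub W_V by auto

lemma end_ok_X: "end_ok s vs \<Longrightarrow> s \<in> X"
  using YW_X by (auto simp: end_ok_def)

context
  fixes ws s s'
  assumes ws: "reduced ws" and s: "end_ok s (map fst ws)" "end_ok s' (rev (map fst ws))"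
begin

lemma wpts_YW: "i \<le> Suc (length ws) \<Longrightarrow> wpts s ws s' ! i \<in> Y \<union> W"
  using s reduced_nth[OF ws] by (cases i) (auto simp: wpts_def nth_append end_ok_def less_Suc_eq)

lemma reduced_turn:
  assumes i: "i < length ws"
  shows "gp (wpts s ws s' ! i) (\<phi> (snd (ws ! i)) (wpts s ws s' ! Suc (Suc i))) (fst (ws ! i)) \<le> a"
proof (rule turn)
  show "fst (ws ! i) \<in> W" "snd (ws ! i) \<in> rot (fst (ws ! i))" "snd (ws ! i) \<noteq> \<one>"
    using reduced_nth[OF ws i] by auto
  have adj: "fst (ws ! j) \<noteq> fst (ws ! Suc j)" if "Suc j < length ws" for j
    using reduced_distinct[OF ws] that by (auto simp: distinct_adj_conv_nth)
  show "wpts s ws s' ! i \<in> Y \<union> (W - {fst (ws ! i)})"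
  proof (cases i)
    case 0
    then show ?thesis using s(1) i by (auto simp: end_ok_def wpts_def hd_conv_nth)
  next
    case (Suc j)
    then show ?thesis using i adj[of j] reduced_nth[OF ws, of j] by (simp add: wpts_letter)
  qed
  show "wpts s ws s' ! Suc (Suc i) \<in> Y \<union> (W - {fst (ws ! i)})"
  proof (cases "Suc i < length ws")
    case True
    then show ?thesis using i adj[of i] reduced_nth[OF ws, of "Suc i"] by (simp add: wpts_letter)
  next
    case False
    then have "Suc i = length ws" using i by simp
    then have "fst (ws ! i) = hd (rev (map fst ws))" "wpts s ws s' ! Suc (Suc i) = s'"
      by (auto simp: hd_rev last_map last_conv_nth wpts_def nth_append)
         (metis Suc_eq_plus1 add_diff_cancel_right' i last_conv_nth last_map list.size(3) not_less0)
    then show ?thesis using s(2) i by (auto simp: end_ok_def)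
  qed
qed

lemma reduced_first_gp:
  "ws \<noteq> [] \<Longrightarrow> gp s (\<phi> (wprod ws) s') (fst (hd ws)) \<le> a + 2 * \<delta>"
  using word_first_gp[OF reduced_is_word[OF ws] reduced_distinct[OF ws] end_ok_X[OF s(1)] end_ok_X[OF s(2)] reduced_turn a_le]
  by blast

lemma reduced_near:
  assumes "p \<in> X"
  shows "\<exists>P\<in>N'. \<exists>t\<in>Y \<union> W. \<exists>t'\<in>Y \<union> W. gp t t' (\<phi> (inv P) p) \<le> gp s (\<phi> (wprod ws) s') p + 2 * \<delta>"
  using word_near[OF reduced_is_word[OF ws] reduced_distinct[OF ws] end_ok_X[OF s(1)] end_ok_X[OF s(2)] reduced_turn a_le assms]
  using wpts_YW wprod_in_N'[OF reduced_take[OF ws]] by (meson Suc_le_mono le_SucI)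

end

text \<open>Rotating back at the first vertex of the word brings the end point to the side of \<open>Y\<close>.\<close>

lemma shorten:
  assumes ws: "reduced ((v, h) # ws)" and m: "m \<in> N" and y: "y \<in> Y" "y' \<in> Y"
    and sees: "\<And>s. s \<in> Y \<union> (W - {v}) \<Longrightarrow> r \<le> gp y s v" and r: "r \<le> \<sigma> - a - 2 * \<delta>"
  defines "k \<equiv> wprod ((v, h) # ws) \<otimes> m"
  shows "d y (\<phi> (inv h \<otimes> k) y') \<le> d y (\<phi> k y') + 2 * (a + 2 * \<delta>) - 2 * (r - \<delta>)"
proof -
  have v: "v \<in> W" "h \<in> rot v" "reduced ws" using ws by (auto simp: reduced_Cons)
  have hG: "h \<in> carrier G" using v rot_carrier W_V by blast
  have hv: "\<phi> h v = v" using v rot_fix W_V by blast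
  have mG: "m \<in> carrier G" using m N_carrier by blast
  have wsG: "wprod ws \<in> carrier G" using v reduced_is_word by simp
  have X: "y \<in> X" "y' \<in> X" "v \<in> X" using y v Y_sub W_V by auto
  have my: "\<phi> m y' \<in> Y" using Y_inv m y by blast
  then have myX: "\<phi> m y' \<in> X" using Y_sub by blast
  define l where "l = wprod ws \<otimes> m"
  have l: "l \<in> carrier G" using mG wsG by (simp add: l_def)
  have k: "k = h \<otimes> l" using hG mG wsG by (simp add: k_def l_def m_assoc)
  have ly: "\<phi> l y' = \<phi> (wprod ws) (\<phi> m y')" using mG wsG X by (simp add: l_def act_mult)
  have ky: "\<phi> k y' = \<phi> (wprod ((v, h) # ws)) (\<phi> m y')"
    using mG wsG X hG by (simp add: k_def act_mult)
  have hk: "inv h \<otimes> k = l" using k hG l by (simp add: inv_mult_cancel)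
  have 1: "gp y (\<phi> k y') v \<le> a + 2 * \<delta>"
    using reduced_first_gp[OF ws Y_end_ok[OF y(1)] Y_end_ok[OF my]] ky by simp
  \<comment> \<open>Once \<open>h\<close> is undone, the end point is on the side of
    \<open>Y\<close> as seen from \<open>v\<close>: it belongs to \<open>Y\<close>, or it lies
    behind the next apex \<open>w\<close>, which \<open>sees\<close> puts in that direction. Its
    distance to \<open>v\<close> is unchanged, so the gain is twice the difference of the
    products.\<close>
  have 2: "r - \<delta> \<le> gp y (\<phi> l y') v"
  proof (cases "ws = []")
    case True
    then have "\<phi> l y' \<in> Y" using ly my myX by simp
    then show ?thesis using sees[of "\<phi> l y'"] delta_pos by simp
  next
    case False
    define w where "w = fst (hd ws)"
    have w: "w \<in> W" "w \<noteq> v" using False ws by (cases ws; auto simp: reduced_Cons w_def)+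
    have wX: "w \<in> X" using w W_V by simp
    have "end_ok v (map fst ws)" using v w False by (simp add: end_ok_def w_def hd_map)
    then have "gp v (\<phi> l y') w \<le> a + 2 * \<delta>"
      using reduced_first_gp[OF v(3) _ Y_end_ok[OF my], of v] False ly by (simp add: w_def)
    moreover have "\<sigma> \<le> d v w" using sep v w W_V by blast
    ultimately have "\<sigma> - a - 2 * \<delta> \<le> gp w (\<phi> l y') v"
      using gp_swap[of v "\<phi> l y'" w] by linarith
    moreover have "r \<le> gp y w v" using sees w by simp
    ultimately show ?thesis
      using hyp4[of y w "\<phi> l y'" v] X wX l r by simp
  qed
  have "d (\<phi> k y') v = d (\<phi> l y') v"
    using act_dist[of h "\<phi> l y'" v] k hG l X hv by (simp add: act_mult)
  then show ?thesis
    using 1 2 gp_eq[of y "\<phi> k y'" v] gp_eq[of y "\<phi> l y'" v] hk by simp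
qed

text \<open>Otherwise the chain drawn from a point \<open>y\<close> of \<open>Y\<close> would return
  to \<open>y\<close>, and its product at the first apex would be the full distance from
  \<open>y\<close> to that apex, which \<open>far\<close> makes too large.\<close>

lemma reduced_not_one:
  assumes ws: "reduced ws" "ws \<noteq> []" and m: "m \<in> N"
    and far: "\<And>v. v \<in> W \<Longrightarrow> \<exists>y\<in>Y. a + 2 * \<delta> < d y v"
  shows "wprod ws \<otimes> m \<noteq> \<one>"
proof
  assume 1: "wprod ws \<otimes> m = \<one>"
  have "fst (hd ws) \<in> W" using ws by (cases ws) (auto simp: reduced_Cons)
  then obtain y where y: "y \<in> Y" "a + 2 * \<delta> < d y (fst (hd ws))" using far by blast
  have "\<phi> m y \<in> Y" using Y_inv m y by blast
  then have "gp y (\<phi> (wprod ws) (\<phi> m y)) (fst (hd ws)) \<le> a + 2 * \<delta>"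
    using reduced_first_gp[OF ws(1) Y_end_ok[OF y(1)] Y_end_ok] ws by blast
  moreover have "\<phi> (wprod ws) (\<phi> m y) = y"
    using act_mult[of "wprod ws" m y] 1 ws m N_carrier reduced_is_word y Y_sub by auto
  ultimately show False using y Y_sub by (auto simp: subset_iff)
qed

end

section \<open>Windmills\<close>

locale windmill = rot_fam X d \<delta> G \<phi> V rot \<sigma>
  for X :: "'x set" and d \<delta> and G :: "('g, 'b) monoid_scheme" (structure) and \<phi> V rot \<sigma> +
  fixes N0 :: "'g set" and A :: "'x set" and a0 :: real
  assumes N0_subgroup: "subgroup N0 G"
    and A_sub: "A \<subseteq> X" and A_ne: "A \<noteq> {}"
    and A_inv: "\<lbrakk>n \<in> N0; y \<in> A\<rbrakk> \<Longrightarrow> \<phi> n y \<in> A"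
    and a0: "4 * \<delta> \<le> a0" "2 * a0 + 6 * \<delta> \<le> \<sigma>"
    and turn0: "\<And>W v h s s'. \<lbrakk>W = {v \<in> V. \<exists>y\<in>A. d v y < 24 * \<delta>}; v \<in> W; h \<in> rot v; h \<noteq> \<one>;
        s \<in> A \<union> (W - {v}); s' \<in> A \<union> (W - {v})\<rbrakk> \<Longrightarrow> gp s (\<phi> h s') v \<le> a0"
    and A_quasiconvex: "\<lbrakk>y \<in> A; y' \<in> A; p \<in> X\<rbrakk> \<Longrightarrow> \<exists>z\<in>A. d p z \<le> gp y y' p + 6 * \<delta>"
begin

text \<open>The radius at which apices are absorbed. A stage loses 2 \<delta> in
  \<open>reduced_near\<close> and 2 \<delta> in a quadrilateral; since the second alternative of
  \<open>quasi\<close> contains twice a Gromov product, the increment is 8 \<delta>. The initial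
  value is the 6 \<delta> of \<open>A_quasiconvex\<close> plus the 18 \<delta> subtracted in
  \<open>quasi\<close>.\<close>

definition \<rho> :: "nat \<Rightarrow> real" where
  "\<rho> n = 24 * \<delta> + 8 * \<delta> * real n"

definition nbhd :: "'g set \<Rightarrow> real \<Rightarrow> 'x set" where
  "nbhd N r = {v \<in> V. \<exists>k\<in>N. \<exists>y\<in>A. d v (\<phi> k y) < r}"

text \<open>The group is an argument because \<open>Nn\<close> is still being defined where this is
  used. The radius is that of the preceding stage, but the translates of \<open>A\<close> are those
  by the current group.\<close>

definition old_apices :: "'g set \<Rightarrow> nat \<Rightarrow> 'x set" where
  "old_apices N n = (if n = 0 then {} else nbhd N (\<rho> n - 8 * \<delta>))"

primrec Nn :: "nat \<Rightarrow> 'g set" where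
  "Nn 0 = N0"
| "Nn (Suc n) = generate G (Nn n \<union> \<Union>(rot ` (nbhd (Nn n) (\<rho> n) - old_apices (Nn n) n)))"

definition Yn :: "nat \<Rightarrow> 'x set" where
  "Yn n = {\<phi> k y | k y. k \<in> Nn n \<and> y \<in> A}"

definition Ap :: "nat \<Rightarrow> 'x set" where
  "Ap n = old_apices (Nn n) n"

definition Wn :: "nat \<Rightarrow> 'x set" where
  "Wn n = nbhd (Nn n) (\<rho> n) - Ap n"

lemma Nn_Suc: "Nn (Suc n) = generate G (Nn n \<union> \<Union>(rot ` Wn n))"
  by (simp add: Wn_def Ap_def Nn.simps(2))

declare Nn.simps(2) [simp del]

lemma Ap_0 [simp]: "Ap 0 = {}"
  by (simp add: Ap_def old_apices_def)

lemma Ap_Suc: "Ap (Suc n) = nbhd (Nn (Suc n)) (\<rho> n)"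
  by (simp add: Ap_def old_apices_def \<rho>_def algebra_simps)

lemma \<rho>_Suc: "\<rho> (Suc n) = \<rho> n + 8 * \<delta>"
  by (simp add: \<rho>_def algebra_simps)

lemma \<rho>_ge: "24 * \<delta> \<le> \<rho> n"
  using delta_pos by (simp add: \<rho>_def)

lemma Wn_sub: "Wn n \<subseteq> V"
  by (auto simp: Wn_def nbhd_def)

lemma Wn_V: "v \<in> Wn n \<Longrightarrow> v \<in> V"
  using Wn_sub by blast

lemma Ap_sub: "Ap n \<subseteq> V"
  by (auto simp: Ap_def nbhd_def old_apices_def)

lemma A_X: "y \<in> A \<Longrightarrow> y \<in> X"
  using A_sub by blast

lemma Nn_subgroup: "subgroup (Nn n) G"
proof (induction n)
  case (Suc n)
  have "Nn n \<subseteq> carrier G" using Suc subgroup.subset by blast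
  moreover have "\<Union>(rot ` Wn n) \<subseteq> carrier G" using Wn_sub rot_carrier by blast
  ultimately show ?case unfolding Nn_Suc by (intro generate_is_subgroup) auto
qed (simp add: N0_subgroup)

lemma Nn_carrier: "k \<in> Nn n \<Longrightarrow> k \<in> carrier G"
  using Nn_subgroup subgroup.subset by blast

lemma Nn_mono_Suc: "Nn n \<subseteq> Nn (Suc n)"
  unfolding Nn_Suc by (auto intro: generate.incl)

lemma Nn_mono: "m \<le> n \<Longrightarrow> Nn m \<subseteq> Nn n"
  using lift_Suc_mono_le[of Nn, OF Nn_mono_Suc] .

lemma Yn_X: "y \<in> Yn n \<Longrightarrow> y \<in> X"
  using Nn_carrier A_X by (auto simp: Yn_def)

lemma A_Yn: "y \<in> A \<Longrightarrow> y \<in> Yn n"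
  using subgroup.one_closed[OF Nn_subgroup] A_X by (force simp: Yn_def)

lemma Yn_0: "Yn 0 = A"
  using A_inv A_Yn[of _ 0] by (auto simp: Yn_def)

lemma Yn_inv: "\<lbrakk>k \<in> Nn n; y \<in> Yn n\<rbrakk> \<Longrightarrow> \<phi> k y \<in> Yn n"
  unfolding Yn_def using act_mult A_X Nn_carrier subgroup.m_closed[OF Nn_subgroup]
  by (smt (verit) mem_Collect_eq)

lemma Yn_mono: "y \<in> Yn n \<Longrightarrow> y \<in> Yn (Suc n)"
  using Nn_mono_Suc by (auto simp: Yn_def)

lemma nbhd_iff: "v \<in> nbhd (Nn n) r \<longleftrightarrow> v \<in> V \<and> (\<exists>y\<in>Yn n. d v y < r)"
  by (auto simp: nbhd_def Yn_def)

lemma nbhd_inv: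
  assumes "k \<in> Nn n" "v \<in> nbhd (Nn n) r"
  shows "\<phi> k v \<in> nbhd (Nn n) r"
proof -
  obtain y where y: "y \<in> Yn n" "d v y < r" "v \<in> V" using assms nbhd_iff by blast
  then have "d (\<phi> k v) (\<phi> k y) < r" using Nn_carrier[OF assms(1)] Yn_X by simp
  then show ?thesis using y Yn_inv[OF assms(1)] V_inv Nn_carrier[OF assms(1)] nbhd_iff by blast
qed

lemma Ap_inv: "\<lbrakk>k \<in> Nn n; v \<in> Ap n\<rbrakk> \<Longrightarrow> \<phi> k v \<in> Ap n"
  by (cases n) (use nbhd_inv[of k n v] Ap_Suc in auto)

lemma Wn_inv:
  assumes k: "k \<in> Nn n" and v: "v \<in> Wn n"
  shows "\<phi> k v \<in> Wn n"
proof -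
  have "\<phi> k v \<notin> Ap n"
  proof
    assume "\<phi> k v \<in> Ap n"
    then have "\<phi> (inv k) (\<phi> k v) \<in> Ap n"
      using Ap_inv subgroup.m_inv_closed[OF Nn_subgroup k] by blast
    then show False using v Wn_sub Nn_carrier[OF k] by (auto simp: Wn_def nbhd_def)
  qed
  then show ?thesis using nbhd_inv[OF k] v by (simp add: Wn_def)
qed

lemma Wn_near: "v \<in> Wn n \<Longrightarrow> \<exists>y\<in>Yn n. d v y < \<rho> n"
  using nbhd_iff by (auto simp: Wn_def)

lemma not_Ap_far: "\<lbrakk>v \<in> V; v \<notin> Ap (Suc n); y \<in> Yn (Suc n)\<rbrakk> \<Longrightarrow> \<rho> n \<le> d v y"
  using nbhd_iff[of v "Suc n"] unfolding Ap_Suc by force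

definition quasi :: "nat \<Rightarrow> bool" where
  "quasi n \<longleftrightarrow> (\<forall>y\<in>Yn n. \<forall>y'\<in>Yn n. \<forall>p\<in>X.
      (\<exists>z\<in>Yn n. d p z \<le> gp y y' p + \<rho> n - 18 * \<delta>) \<or>
      (\<exists>z\<in>Yn n. \<exists>u\<in>Ap n. d p z + d p u \<le> \<rho> n + 2 * gp y y' p))"

lemma quasi_0: "quasi 0"
  unfolding quasi_def Yn_0 using A_quasiconvex by (auto simp: \<rho>_def algebra_simps)

text \<open>In the first alternative of \<open>quasi\<close>, the distance \<open>\<rho> n\<close>
  kept by an apex not yet absorbed exceeds the constant
  \<open>\<rho> (Suc n) - 18 * \<delta>\<close> by 10 \<delta>. In the second, the absorbed apex is
  at distance at least \<sigma> from \<open>v\<close>, which makes the product even larger.\<close>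

lemma sees_Yn:
  assumes Q: "quasi (Suc n)" and v: "v \<in> V" "v \<notin> Ap (Suc n)" and y: "y \<in> Yn (Suc n)" "y' \<in> Yn (Suc n)"
  shows "10 * \<delta> \<le> gp y y' v"
proof -
  consider z where "z \<in> Yn (Suc n)" "d v z \<le> gp y y' v + \<rho> (Suc n) - 18 * \<delta>"
    | z u where "z \<in> Yn (Suc n)" "u \<in> Ap (Suc n)" "d v z + d v u \<le> \<rho> (Suc n) + 2 * gp y y' v"
    using Q y v unfolding quasi_def by (meson V_X)
  then show ?thesis
  proof cases
    case 1
    then show ?thesis using not_Ap_far[OF v 1(1)] \<rho>_Suc[of n] by linarith
  next
    case 2
    have "u \<in> V" "u \<noteq> v" using 2 v Ap_sub by auto
    then have "\<sigma> \<le> d v u" using sep v by blast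
    then show ?thesis using 2 not_Ap_far[OF v 2(1)] \<rho>_Suc[of n] sigma delta_pos by linarith
  qed
qed

lemma sees:
  assumes Q: "quasi (Suc n)" and v: "v \<in> Wn (Suc n)" and y: "y \<in> Yn (Suc n)"
    and s: "s \<in> Yn (Suc n) \<union> (Wn (Suc n) - {v})"
  shows "9 * \<delta> \<le> gp y s v"
proof -
  have v': "v \<in> V" "v \<notin> Ap (Suc n)" using v Wn_V by (auto simp: Wn_def)
  show ?thesis
  proof (cases "s \<in> Yn (Suc n)")
    case True
    then show ?thesis using sees_Yn[OF Q v' y] delta_pos by fastforce
  next
    case False
    then have s': "s \<in> Wn (Suc n)" "s \<noteq> v" "s \<in> V" using s Wn_V by auto
    obtain z where z: "z \<in> Yn (Suc n)" "d s z < \<rho> (Suc n)" using Wn_near s' by blast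
    have "\<sigma> \<le> d s v" using sep s' v' by blast
    then have "10 * \<delta> \<le> gp z s v"
      using z not_Ap_far[OF v' z(1)] \<rho>_Suc[of n] gp_eq[of z s v] commute[of z s] commute[of z v] sigma delta_pos
      by linarith
    moreover have "10 * \<delta> \<le> gp y z v" using sees_Yn[OF Q v' y z(1)] .
    ultimately show ?thesis
      using hyp4[of y z s v] Yn_X y z s' v' by simp
  qed
qed

text \<open>From \<open>v\<close>, all admissible points lie in the direction of one point
  \<open>y\<close>, with products at least 9 \<delta>. Since \<open>h\<close> turns \<open>y\<close>
  away up to 2 \<delta>, it turns them all away; two four point steps give 4 \<delta>.\<close>

lemma tree_step_Suc:
  assumes Q: "quasi (Suc n)"
  shows "tree_step X d \<delta> G \<phi> V rot \<sigma> (Nn (Suc n)) (Yn (Suc n)) (Wn (Suc n)) (4 * \<delta>)"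
proof (intro tree_step.intro rot_fam_axioms tree_step_axioms.intro)
  fix v h s s'
  assume v: "v \<in> Wn (Suc n)" and h: "h \<in> rot v" "h \<noteq> \<one>"
    and s: "s \<in> Yn (Suc n) \<union> (Wn (Suc n) - {v})" "s' \<in> Yn (Suc n) \<union> (Wn (Suc n) - {v})"
  obtain y where y: "y \<in> Yn (Suc n)" using A_ne A_Yn by blast
  have vV: "v \<in> V" using v Wn_sub by blast
  have hG: "h \<in> carrier G" and hv: "\<phi> h v = v" using h vV rot_carrier rot_fix by blast+
  have X: "y \<in> X" "s \<in> X" "s' \<in> X" "v \<in> X" using y s vV Yn_X Wn_V V_X by blast+
  have "9 * \<delta> \<le> gp y s v" "9 * \<delta> \<le> gp y s' v" using sees[OF Q v y] s by auto
  moreover have "gp (\<phi> h s') (\<phi> h y) v = gp y s' v"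
    using act_gp[of h s' y v] hG X hv gp_commute[of y s'] by simp
  moreover have "gp y (\<phi> h y) v \<le> 2 * \<delta>" using rot_gp vV h X by blast
  ultimately show "gp s (\<phi> h s') v \<le> 4 * \<delta>"
    using hyp5[of y s "\<phi> h s'" "\<phi> h y" v] X hG delta_pos by auto
qed (use Nn_subgroup Yn_X Yn_inv Wn_sub Wn_inv sigma delta_pos in auto)

lemma tree_step_0: "tree_step X d \<delta> G \<phi> V rot \<sigma> (Nn 0) (Yn 0) (Wn 0) a0"
proof -
  have W: "Wn 0 = {v \<in> V. \<exists>y\<in>A. d v y < 24 * \<delta>}"
    using nbhd_iff[of _ 0] by (auto simp: Wn_def Yn_0 \<rho>_def)
  show ?thesis
  proof (intro tree_step.intro rot_fam_axioms tree_step_axioms.intro)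
    show "gp s (\<phi> h s') v \<le> a0"
      if "v \<in> Wn 0" "h \<in> rot v" "h \<noteq> \<one>" "s \<in> Yn 0 \<union> (Wn 0 - {v})" "s' \<in> Yn 0 \<union> (Wn 0 - {v})" for v h s s'
      using turn0[OF W] that unfolding Yn_0 by blast
  qed (use Nn_subgroup[of 0] Yn_X[of _ 0] Yn_inv[of _ 0] Wn_sub[of 0] Wn_inv[of _ 0] a0 in auto)
qed

text \<open>At stage \<open>0\<close> an apex need not see \<open>A\<close> in a single direction,
  so there the bound is the hypothesis \<open>turn0\<close>; \<open>4 * \<delta> \<le> a0\<close>
  lets one constant serve all stages.\<close>

lemma tree_step_quasi: "quasi n \<Longrightarrow> tree_step X d \<delta> G \<phi> V rot \<sigma> (Nn n) (Yn n) (Wn n) a0"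
proof (cases n)
  case (Suc m)
  assume "quasi n"
  then interpret T: tree_step X d \<delta> G \<phi> V rot \<sigma> "Nn n" "Yn n" "Wn n" "4 * \<delta>"
    using tree_step_Suc Suc by simp
  show ?thesis
  proof (intro tree_step.intro rot_fam_axioms tree_step_axioms.intro)
    show "gp s (\<phi> h s') v \<le> a0"
      if "v \<in> Wn n" "h \<in> rot v" "h \<noteq> \<one>" "s \<in> Yn n \<union> (Wn n - {v})" "s' \<in> Yn n \<union> (Wn n - {v})" for v h s s'
      using T.turn[OF that] a0(1) by simp
  qed (use T.N_subgroup T.Y_sub T.Y_inv T.W_sub T.W_inv a0 in auto)
qed (use tree_step_0 in simp)

lemma AW_Ap_Suc:
  assumes P: "P \<in> Nn (Suc n)" and u: "u \<in> Ap n \<union> Wn n"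
  shows "\<phi> P u \<in> Ap (Suc n)"
proof -
  have "u \<in> nbhd (Nn n) (\<rho> n)"
  proof (cases "u \<in> Wn n")
    case False
    then have u: "u \<in> Ap n" using u by simp
    then obtain m where "n = Suc m" by (cases n) auto
    then have "u \<in> V" "\<exists>y\<in>Yn n. d u y < \<rho> m" using u nbhd_iff by (auto simp: Ap_Suc)
    then show ?thesis using \<open>n = Suc m\<close> \<rho>_Suc[of m] delta_pos nbhd_iff by fastforce
  qed (simp add: Wn_def)
  then have "u \<in> nbhd (Nn (Suc n)) (\<rho> n)" using nbhd_iff Yn_mono by blast
  then show ?thesis using nbhd_inv[OF P] by (simp add: Ap_Suc)
qed

text \<open>With the first end point moved into \<open>A\<close>, the second is reached by a normal
  form, whose chain has a segment \<open>s s'\<close> close to \<open>p\<close> up to translation.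
  Its ends may be apices and are then replaced by nearby points \<open>z\<close>, \<open>z'\<close>
  of \<open>Yn n\<close>. In the quadrilateral \<open>s z z' s'\<close> either \<open>z z'\<close>
  is close to \<open>p\<close>, and stage \<open>n\<close> applies, or a segment from an apex to its
  neighbour in \<open>Yn n\<close> is, which is the second alternative at the next stage.\<close>

lemma quasi_Suc:
  assumes Q: "quasi n"
  shows "quasi (Suc n)"
proof -
  interpret T: tree_step X d \<delta> G \<phi> V rot \<sigma> "Nn n" "Yn n" "Wn n" a0
    by (rule tree_step_quasi[OF Q])
  show ?thesis
    unfolding quasi_def
  proof (intro ballI)
    fix x x' p
    assume x: "x \<in> Yn (Suc n)" "x' \<in> Yn (Suc n)" and p: "p \<in> X"
    define t where "t = gp x x' p"
    obtain k y k' y' where ky: "k \<in> Nn (Suc n)" "y \<in> A" "x = \<phi> k y" "k' \<in> Nn (Suc n)" "y' \<in> A" "x' = \<phi> k' y'"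
      using x by (auto simp: Yn_def)
    have kG: "k \<in> carrier G" "k' \<in> carrier G" using ky Nn_carrier by blast+
    define q where "q = \<phi> (inv k) p"
    have q: "q \<in> X" using p kG by (simp add: q_def)
    define l where "l = inv k \<otimes> k'"
    have lG: "l \<in> carrier G" using kG by (simp add: l_def)
    have l: "l \<in> Nn (Suc n)"
      using ky subgroup.m_closed[OF Nn_subgroup] subgroup.m_inv_closed[OF Nn_subgroup] by (simp add: l_def)
    have yX: "y \<in> X" "y' \<in> X" using ky A_X by auto
    have t: "gp y (\<phi> l y') q = t"
      using act_gp[of "inv k" x x' p] ky(3,6) kG yX p by (simp add: t_def q_def l_def act_mult)
    obtain ws m where wm: "T.reduced ws" "m \<in> Nn n" "l = wprod ws \<otimes> m"
      using T.normal_form l Nn_Suc by blast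
    have my: "\<phi> m y' \<in> Yn n" using wm(2) ky(5) by (auto simp: Yn_def)
    have ly: "\<phi> l y' = \<phi> (wprod ws) (\<phi> m y')"
      using wm T.reduced_is_word Nn_carrier yX by (simp add: act_mult)
    obtain P s s' where P: "P \<in> Nn (Suc n)" and s: "s \<in> Yn n \<union> Wn n" "s' \<in> Yn n \<union> Wn n"
      and ss: "gp s s' (\<phi> (inv P) q) \<le> t + 2 * \<delta>"
      using T.reduced_near[OF wm(1) T.Y_end_ok[OF A_Yn[OF ky(2)]] T.Y_end_ok[OF my] q] ly t Nn_Suc by auto
    have PG: "P \<in> carrier G" using P Nn_carrier by blast
    define r where "r = \<phi> (inv P) q"
    have r: "r \<in> X" using PG q by (simp add: r_def)
    define B where "B = k \<otimes> P"
    have B: "B \<in> Nn (Suc n)" using ky P subgroup.m_closed[OF Nn_subgroup] by (simp add: B_def)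
    have BG: "B \<in> carrier G" using B Nn_carrier by blast
    have pB: "p = \<phi> B r" using PG kG q p by (simp add: B_def r_def q_def act_mult)
    have near: "\<exists>z\<in>Yn n. d s z < \<rho> n" if "s \<in> Yn n \<union> Wn n" for s
      using that Wn_near \<rho>_ge[of n] delta_pos Yn_X by force
    obtain z z' where z: "z \<in> Yn n" "d s z < \<rho> n" "s \<in> Yn n \<Longrightarrow> z = s"
      and z': "z' \<in> Yn n" "d s' z' < \<rho> n" "s' \<in> Yn n \<Longrightarrow> z' = s'"
    proof -
      have "\<exists>z\<in>Yn n. d s z < \<rho> n \<and> (s \<in> Yn n \<longrightarrow> z = s)" if "s \<in> Yn n \<union> Wn n" for s
        using near[OF that] \<rho>_ge[of n] delta_pos Yn_X by (cases "s \<in> Yn n") force+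
      then show ?thesis using s that by meson
    qed
    have X4: "s \<in> X" "z \<in> X" "z' \<in> X" "s' \<in> X" using s z z' Yn_X T.YW_X by auto
    have goalA: "\<exists>w\<in>Yn (Suc n). d p w \<le> t + \<rho> (Suc n) - 18 * \<delta>"
      if "w \<in> Yn n" "d r w \<le> t + \<rho> n - 10 * \<delta>" for w
      using that Yn_inv[OF B Yn_mono[OF that(1)]] pB BG r Yn_X[OF that(1)] \<rho>_Suc[of n]
      by (intro bexI[of _ "\<phi> B w"]) auto
    have goalB: "\<exists>w\<in>Yn (Suc n). \<exists>u\<in>Ap (Suc n). d p w + d p u \<le> \<rho> (Suc n) + 2 * t"
      if "w \<in> Yn n" "u \<in> Ap n \<union> Wn n" "d r w + d r u \<le> \<rho> n + 2 * t + 8 * \<delta>" for w u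
    proof (intro bexI)
      have "u \<in> X" using that(2) Ap_sub Wn_V V_X by blast
      then show "d p (\<phi> B w) + d p (\<phi> B u) \<le> \<rho> (Suc n) + 2 * t"
        using that pB BG r Yn_X \<rho>_Suc[of n] by simp
    qed (use that B Yn_inv Yn_mono AW_Ap_Suc in auto)
    have side: "(\<exists>w\<in>Yn (Suc n). d p w \<le> t + \<rho> (Suc n) - 18 * \<delta>) \<or>
        (\<exists>w\<in>Yn (Suc n). \<exists>u\<in>Ap (Suc n). d p w + d p u \<le> \<rho> (Suc n) + 2 * t)"
      if "s \<in> Yn n \<union> Wn n" "z \<in> Yn n" "d s z < \<rho> n" "s \<in> Yn n \<Longrightarrow> z = s" "gp s z r \<le> t + 4 * \<delta>" for s z
    proof (cases "s \<in> Yn n")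
      case True
      then have "d r s \<le> t + 4 * \<delta>" using that Yn_X commute by simp
      then show ?thesis using goalA[OF True] \<rho>_ge[of n] delta_pos by auto
    next
      case False
      have "d r z + d r s \<le> \<rho> n + 2 * t + 8 * \<delta>"
        using that(3,5) gp_eq[of s z r] commute[of r z] commute[of r s] by linarith
      then show ?thesis using goalB[OF that(2)] False that(1) by blast
    qed
    have "gp s z r \<le> t + 4 * \<delta> \<or> gp z z' r \<le> t + 4 * \<delta> \<or> gp s' z' r \<le> t + 4 * \<delta>"
      using hyp5[OF X4 r] ss gp_commute[of s' z'] by (auto simp: r_def)
    moreover have "(\<exists>w\<in>Yn (Suc n). d p w \<le> t + \<rho> (Suc n) - 18 * \<delta>) \<or>
        (\<exists>w\<in>Yn (Suc n). \<exists>u\<in>Ap (Suc n). d p w + d p u \<le> \<rho> (Suc n) + 2 * t)"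
      if "gp z z' r \<le> t + 4 * \<delta>"
    proof -
      consider w where "w \<in> Yn n" "d r w \<le> gp z z' r + \<rho> n - 18 * \<delta>"
        | w u where "w \<in> Yn n" "u \<in> Ap n" "d r w + d r u \<le> \<rho> n + 2 * gp z z' r"
        using Q z z' r unfolding quasi_def by meson
      then show ?thesis
      proof cases
        case 1
        then show ?thesis using goalA[OF 1(1)] that delta_pos by auto
      next
        case 2
        then show ?thesis using goalB[OF 2(1), of u] that by auto
      qed
    qed
    ultimately show "(\<exists>z\<in>Yn (Suc n). d p z \<le> gp x x' p + \<rho> (Suc n) - 18 * \<delta>) \<or>
        (\<exists>z\<in>Yn (Suc n). \<exists>u\<in>Ap (Suc n). d p z + d p u \<le> \<rho> (Suc n) + 2 * gp x x' p)"
      using side[OF s(1) z] side[OF s(2) z'] unfolding t_def by blast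
  qed
qed

lemma quasi_all: "quasi n"
  by (induction n) (simp_all add: quasi_0 quasi_Suc)

lemmas tree_step_all = tree_step_quasi[OF quasi_all]

text \<open>Translating by \<open>inv k\<close> brings the apex close to \<open>A\<close>, hence
  among those treated at stage \<open>n\<close> or before; conjugating its rotations back by
  \<open>k\<close> stays in the new group.\<close>

lemma rot_Ap: "u \<in> Ap n \<Longrightarrow> rot u \<subseteq> Nn n"
proof (induction n arbitrary: u)
  case (Suc n)
  obtain k y where ky: "k \<in> Nn (Suc n)" "y \<in> A" "d u (\<phi> k y) < \<rho> n" and u: "u \<in> V"
    using Suc.prems unfolding Ap_Suc nbhd_def by auto
  have kG: "k \<in> carrier G" using ky Nn_carrier by blast
  define w where "w = \<phi> (inv k) u"
  have wV: "w \<in> V" using V_inv u kG by (simp add: w_def)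
  have uw: "u = \<phi> k w" using u kG by (simp add: w_def)
  have "d w y < \<rho> n" using ky act_dist_inv[of k u y] kG u A_X by (simp add: w_def)
  then have "w \<in> nbhd (Nn n) (\<rho> n)" using nbhd_iff wV A_Yn ky by blast
  then have "w \<in> Ap n \<or> w \<in> Wn n" by (simp add: Wn_def)
  then have w: "rot w \<subseteq> Nn (Suc n)"
    using Suc.IH[of w] Nn_mono_Suc[of n] by (auto simp: Nn_Suc intro: generate.incl)
  show ?case
  proof
    fix h assume h: "h \<in> rot u"
    then have hG: "h \<in> carrier G" using rot_carrier u by blast
    have "inv k \<otimes> h \<otimes> inv (inv k) \<in> rot w" unfolding w_def by (rule rot_conj) (use kG u h in auto)
    then have "inv k \<otimes> h \<otimes> k \<in> Nn (Suc n)" using w kG by auto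
    then have "k \<otimes> (inv k \<otimes> h \<otimes> k) \<otimes> inv k \<in> Nn (Suc n)"
      using ky subgroup.m_closed[OF Nn_subgroup] subgroup.m_inv_closed[OF Nn_subgroup] by blast
    then show "h \<in> Nn (Suc n)" using kG hG by (simp add: m_assoc inv_mult_cancel)
  qed
qed simp

lemma rot_in_Nn:
  assumes "v \<in> V"
  shows "\<exists>n. rot v \<subseteq> Nn n"
proof -
  obtain y where y: "y \<in> A" using A_ne by blast
  obtain n where "d v y < real n * (8 * \<delta>)"
    using reals_Archimedean3[of "8 * \<delta>"] delta_pos by fastforce
  then have "d v y < \<rho> n" using delta_pos by (simp add: \<rho>_def algebra_simps)
  then have "v \<in> nbhd (Nn n) (\<rho> n)" using nbhd_iff assms A_Yn y by blast
  then have "v \<in> Ap n \<or> v \<in> Wn n" by (simp add: Wn_def)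
  then show ?thesis
  proof
    assume "v \<in> Wn n"
    then have "rot v \<subseteq> Nn (Suc n)" by (auto simp: Nn_Suc intro: generate.incl)
    then show ?thesis by blast
  qed (use rot_Ap in blast)
qed

lemma Nn_exhaust:
  assumes "k \<in> generate G (N0 \<union> \<Union>(rot ` V))"
  shows "\<exists>n. k \<in> Nn n"
  using assms
proof (induction rule: generate.induct)
  case one
  then show ?case using subgroup.one_closed[OF Nn_subgroup] by blast
next
  case (incl h)
  then show ?case using rot_in_Nn Nn.simps(1) by blast
next
  case (inv h)
  then have "\<exists>n. h \<in> Nn n" using rot_in_Nn Nn.simps(1) by blast
  then show ?case using subgroup.m_inv_closed[OF Nn_subgroup] by blast
next
  case (eng h1 h2)
  then obtain m n where "h1 \<in> Nn m" "h2 \<in> Nn n" by blast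
  then have "h1 \<in> Nn (max m n)" "h2 \<in> Nn (max m n)" using Nn_mono[of m "max m n"] Nn_mono[of n "max m n"] by auto
  then show ?case using subgroup.m_closed[OF Nn_subgroup] by blast
qed

lemma Nn_in_generate: "Nn n \<subseteq> generate G (N0 \<union> \<Union>(rot ` V))"
proof (induction n)
  case (Suc n)
  have "N0 \<union> \<Union>(rot ` V) \<subseteq> carrier G"
    using N0_subgroup subgroup.subset rot_carrier by blast
  moreover have "\<Union>(rot ` Wn n) \<subseteq> generate G (N0 \<union> \<Union>(rot ` V))"
    using Wn_sub by (auto intro!: generate.incl)
  ultimately show ?case
    unfolding Nn_Suc using Suc by (intro generate_subgroup_incl generate_is_subgroup) auto
qed (auto intro: generate.incl)

end

section \<open>Hyperbolicity of the quotient\<close>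

context rot_fam
begin

abbreviation "K \<equiv> generate G (\<Union>(rot ` V))"

lemma rots_carrier: "\<Union>(rot ` V) \<subseteq> carrier G"
  using rot_carrier by blast

lemma K_subgroup: "subgroup K G"
  by (rule generate_is_subgroup[OF rots_carrier])

lemma K_carrier: "k \<in> K \<Longrightarrow> k \<in> carrier G"
  using K_subgroup subgroup.subset by blast

lemmas K_mult = subgroup.m_closed[OF K_subgroup]
lemmas K_inv = subgroup.m_inv_closed[OF K_subgroup]
lemmas K_one = subgroup.one_closed[OF K_subgroup]

lemma rot_K: "\<lbrakk>v \<in> V; h \<in> rot v\<rbrakk> \<Longrightarrow> h \<in> K"
  by (auto intro: generate.incl)

lemma wprod_K: "is_word ws \<Longrightarrow> wprod ws \<in> K"
proof (induction ws)
  case (Cons x ws)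
  then show ?case using rot_K K_mult by (cases x) auto
qed (simp add: K_one)

text \<open>The windmill is started from the point \<open>x\<close> with the trivial group. At the
  first stage whose group contains \<open>k\<close>, the normal form has a letter, and undoing the
  first letter shortens. Only at the initial step is there no gain; but there at most one apex is
  within 24 \<delta> of \<open>x\<close>, so \<open>k\<close> is itself a rotation.\<close>

lemma greendlinger:
  assumes x: "x \<in> X" and k: "k \<in> K"
  shows "k = \<one> \<or> (\<exists>v\<in>V. d v x < 24 * \<delta> \<and> k \<in> rot v) \<or>
    (\<exists>v\<in>V. \<exists>h\<in>rot v. gp x (\<phi> k x) v \<le> 6 * \<delta> \<and> d x (\<phi> (h \<otimes> k) x) \<le> d x (\<phi> k x) - 4 * \<delta>)"
proof -
  have close: "v = w" if "v \<in> V" "w \<in> V" "d v x < 24 * \<delta>" "d w x < 24 * \<delta>" for v w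
  proof (rule ccontr)
    assume "v \<noteq> w"
    then have "\<sigma> \<le> d v w" using sep that by blast
    then show False using triangle[of v x w] that x commute[of x w] sigma delta_pos by simp
  qed
  interpret windmill X d \<delta> G \<phi> V rot \<sigma> "{\<one>}" "{x}" "4 * \<delta>"
  proof (intro windmill.intro rot_fam_axioms windmill_axioms.intro)
    show "gp s (\<phi> h s') v \<le> 4 * \<delta>"
      if "W = {v \<in> V. \<exists>y\<in>{x}. d v y < 24 * \<delta>}" "v \<in> W" "h \<in> rot v" "h \<noteq> \<one>"
        "s \<in> {x} \<union> (W - {v})" "s' \<in> {x} \<union> (W - {v})" for W v h s s'
    proof -
      have "s = x" "s' = x" "v \<in> V" using that close by auto
      then show ?thesis using rot_gp[of v h x] that x delta_pos by simp
    qed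
    show "\<exists>z\<in>{x}. d p z \<le> gp y y' p + 6 * \<delta>" if "y \<in> {x}" "y' \<in> {x}" "p \<in> X" for y y' p
      using that x delta_pos commute by simp
  qed (use x sigma delta_pos in \<open>auto simp: triv_subgroup\<close>)
  have "k \<in> generate G ({\<one>} \<union> \<Union>(rot ` V))"
    using k mono_generate[of "\<Union>(rot ` V)" "{\<one>} \<union> \<Union>(rot ` V)"] by blast
  then obtain n0 where "k \<in> Nn n0" using Nn_exhaust by blast
  then obtain n where n: "k \<in> Nn n" "\<And>m. m < n \<Longrightarrow> k \<notin> Nn m"
    using ex_least_nat_le[of "\<lambda>n. k \<in> Nn n"] by blast
  show ?thesis
  proof (cases n)
    case 0
    then show ?thesis using n by simp
  next
    case (Suc m)
    interpret T: tree_step X d \<delta> G \<phi> V rot \<sigma> "Nn m" "Yn m" "Wn m" "4 * \<delta>"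
      by (rule tree_step_all)
    obtain ws l where wl: "T.reduced ws" "l \<in> Nn m" "k = wprod ws \<otimes> l"
      using T.normal_form n(1) Suc Nn_Suc by blast
    have "ws \<noteq> []" using wl n(2)[of m] Suc Nn_carrier by auto
    then obtain v h us where ws: "ws = (v, h) # us" by (metis list.exhaust prod.collapse)
    have v: "v \<in> Wn m" "h \<in> rot v" using wl ws by (auto simp: T.reduced_Cons)
    have vV: "v \<in> V" using v Wn_V by blast
    have hG: "h \<in> carrier G" using v vV rot_carrier by blast
    have xY: "x \<in> Yn m" using A_Yn by simp
    show ?thesis
    proof (cases m)
      case 0
      have W0: "w \<in> V \<and> d w x < 24 * \<delta>" if "w \<in> Wn 0" for w
        using Wn_near[OF that] Wn_V[OF that] by (auto simp: Yn_0 \<rho>_def)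
      have "us = []"
      proof (rule ccontr)
        assume "us \<noteq> []"
        then obtain w g us' where "us = (w, g) # us'" by (metis list.exhaust prod.collapse)
        then have "w \<in> Wn m" "w \<noteq> v" using wl(1) ws by (auto simp: T.reduced_Cons)
        then show False using W0 close v 0 by blast
      qed
      then have "k = h" using wl ws 0 hG by simp
      then show ?thesis using W0 v 0 by blast
    next
      case (Suc j)
      \<comment> \<open>The value \<open>9 * \<delta>\<close> comes from \<open>sees\<close>. The
        product at \<open>v\<close> rises from at most 6 \<delta> to at least 8 \<delta>, which is
        the gain of 4 \<delta>.\<close>
      have "d x (\<phi> (inv h \<otimes> k) x) \<le> d x (\<phi> k x) + 2 * (4 * \<delta> + 2 * \<delta>) - 2 * (9 * \<delta> - \<delta>)"
        unfolding wl(3) ws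
      proof (rule T.shorten)
        show "9 * \<delta> \<le> gp x s v" if "s \<in> Yn m \<union> (Wn m - {v})" for s
          using sees[OF quasi_all, of v j x s] v xY that Suc by simp
      qed (use wl ws xY sigma delta_pos in auto)
      moreover have "gp x (\<phi> k x) v \<le> 6 * \<delta>"
      proof -
        have "\<phi> l x \<in> Yn m" using xY wl Yn_inv by blast
        moreover have "\<phi> k x = \<phi> (wprod ws) (\<phi> l x)"
          using wl Nn_carrier T.reduced_is_word x by (simp add: act_mult)
        ultimately show ?thesis
          using T.reduced_first_gp[OF wl(1) T.Y_end_ok[OF xY] T.Y_end_ok[of "\<phi> l x"]] ws by simp
      qed
      moreover have "inv h \<in> rot v" using subgroup.m_inv_closed[OF rot_subgroup] vV v by blast
      ultimately show ?thesis using vV by (intro disjI2 bexI[of _ v] bexI[of _ "inv h"]) auto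
    qed
  qed
qed

text \<open>\<open>greendlinger\<close> is applied at \<open>v\<close> itself: a fixed point cannot
  be brought closer, and the only apex within 24 \<delta> of \<open>v\<close> is
  \<open>v\<close>.\<close>

lemma K_stabilizer:
  assumes "v \<in> V" "k \<in> K" "\<phi> k v = v"
  shows "k \<in> rot v"
proof -
  have "\<not> (\<exists>w\<in>V. \<exists>h\<in>rot w. d v (\<phi> (h \<otimes> k) v) \<le> d v (\<phi> k v) - 4 * \<delta>)"
    using assms delta_pos by (smt (verit) V_X mdist_zero nonneg)
  moreover have "w = v" if "w \<in> V" "d w v < 24 * \<delta>" for w
    using sep[of w v] that assms(1) sigma delta_pos by (cases "w = v") auto
  ultimately show ?thesis
    using greendlinger[of v k] assms subgroup.one_closed[OF rot_subgroup] by auto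
qed

section \<open>The quotient pseudo-distance, read on points of \<open>X\<close>\<close>

definition orb :: "'x \<Rightarrow> 'x set" where
  "orb x = {\<phi> k x | k. k \<in> K}"

definition db :: "'x \<Rightarrow> 'x \<Rightarrow> real" where
  "db x y = quotient_dist d (orb x) (orb y)"

lemma quotient_space_orb: "quotient_space G X \<phi> K = orb ` X"
  by (auto simp: quotient_space_def orbits_def orbit_def orb_def)

lemma orb_self: "x \<in> X \<Longrightarrow> x \<in> orb x"
  using K_one unfolding orb_def by (intro CollectI exI[of _ \<one>]) simp

lemma orb_act: 
  assumes "x \<in> X" "k \<in> K"
  shows "orb (\<phi> k x) = orb x"
proof
  show "orb (\<phi> k x) \<subseteq> orb x"
    using assms K_mult K_carrier by (auto simp: orb_def) (metis act_mult)
  show "orb x \<subseteq> orb (\<phi> k x)"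
  proof
    fix y assume "y \<in> orb x"
    then obtain l where l: "l \<in> K" "y = \<phi> l x" by (auto simp: orb_def)
    then have "y = \<phi> (l \<otimes> inv k) (\<phi> k x)" using assms K_carrier by (simp add: act_mult)
    then show "y \<in> orb (\<phi> k x)" using K_mult K_inv l assms by (auto simp: orb_def)
  qed
qed

lemma db_act [simp]:
  "\<lbrakk>x \<in> X; k \<in> K\<rbrakk> \<Longrightarrow> db (\<phi> k x) y = db x y"
  "\<lbrakk>y \<in> X; k \<in> K\<rbrakk> \<Longrightarrow> db x (\<phi> k y) = db x y"
  by (simp_all add: db_def orb_act)

lemma bdd_below_d: "bdd_below ((\<lambda>(x, y). d x y) ` S)"
  by (rule bdd_belowI[of _ 0]) auto

lemma quotient_dist_le: "\<lbrakk>p \<in> P; q \<in> Q\<rbrakk> \<Longrightarrow> quotient_dist d P Q \<le> d p q"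
  unfolding quotient_dist_def by (rule cINF_lower2[OF bdd_below_d, of "(p, q)"]) auto

lemma db_le: "\<lbrakk>x \<in> X; y \<in> X\<rbrakk> \<Longrightarrow> db x y \<le> d x y"
  using quotient_dist_le orb_self by (simp add: db_def)

lemma db_commute: "db x y = db y x"
proof -
  have "(\<lambda>(x, y). d x y) ` (orb x \<times> orb y) = (\<lambda>(x, y). d x y) ` (orb y \<times> orb x)"
    using commute by force
  then show ?thesis by (simp add: db_def quotient_dist_def)
qed

lemma db_approx:
  assumes "x \<in> X" "y \<in> X" "\<epsilon> > 0"
  shows "\<exists>k\<in>K. d x (\<phi> k y) \<le> db x y + \<epsilon>"
proof -
  have "orb x \<times> orb y \<noteq> {}" using orb_self assms by blast
  then obtain p q where pq: "p \<in> orb x" "q \<in> orb y" "d p q < db x y + \<epsilon>"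
    using cINF_less_iff[OF _ bdd_below_d, of "orb x \<times> orb y" "db x y + \<epsilon>"] assms(3)
    by (auto simp: db_def quotient_dist_def)
  then obtain k l where kl: "k \<in> K" "l \<in> K" "p = \<phi> k x" "q = \<phi> l y" by (auto simp: orb_def)
  then have "d x (\<phi> (inv k \<otimes> l) y) = d p q"
    using assms K_carrier act_dist_inv[of k q x] commute by (simp add: act_mult)
  then show ?thesis using pq K_mult K_inv kl by (intro bexI[of _ "inv k \<otimes> l"]) auto
qed

lemma db_triangle:
  assumes X: "x \<in> X" "y \<in> X" "z \<in> X"
  shows "db x z \<le> db x y + db y z"
proof (rule field_le_epsilon)
  fix e :: real assume e: "0 < e"
  obtain k where k: "k \<in> K" "d x (\<phi> k y) \<le> db x y + e / 2" using db_approx[OF X(1,2), of "e / 2"] e by auto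
  obtain l where l: "l \<in> K" "d y (\<phi> l z) \<le> db y z + e / 2" using db_approx[OF X(2,3), of "e / 2"] e by auto
  have G: "k \<in> carrier G" "l \<in> carrier G" using k l K_carrier by auto
  have "db x z \<le> d x (\<phi> (k \<otimes> l) z)"
    using db_le[of x "\<phi> (k \<otimes> l) z"] X G k l K_mult by simp
  also have "\<dots> \<le> d x (\<phi> k y) + d (\<phi> k y) (\<phi> k (\<phi> l z))"
    using triangle[of x "\<phi> k y" "\<phi> k (\<phi> l z)"] X G by (simp add: act_mult)
  also have "\<dots> \<le> db x y + db y z + e" using k l X G by simp
  finally show "db x z \<le> db x y + db y z + e" .
qed

section \<open>Rotating the sides of a lifted polygon\<close>

definition side_adj :: "'x \<Rightarrow> 'x \<Rightarrow> 'x \<Rightarrow> 'x \<Rightarrow> bool" where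
  "side_adj a b c c' \<longleftrightarrow> gp a c' c \<le> 13 * \<delta> \<and> gp c b c' \<le> 13 * \<delta>"

text \<open>
  A list of apices lying close to a segment from \<open>a\<close> to \<open>b\<close>, in the order in which they are met.
\<close>

definition side_pts :: "'x \<Rightarrow> 'x \<Rightarrow> 'x list \<Rightarrow> bool" where
  "side_pts a b vs \<longleftrightarrow> (\<forall>w\<in>set vs. w \<in> V \<and> gp a b w \<le> 12 * \<delta>) \<and> distinct_adj vs \<and>
     successively (side_adj a b) (a # vs @ [b])"

text \<open>The new apex is compared with \<open>a\<close> and \<open>b\<close>, not only with its
  neighbours, so the constants survive any number of insertions. As apices are \<sigma> apart,
  \<open>w\<close> sees \<open>a\<close> behind \<open>c\<close> and \<open>b\<close> behind
  \<open>c'\<close>; hence 10 \<delta> for \<open>c\<close>, \<open>c'\<close> becomes 12 \<delta>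
  for \<open>a\<close>, \<open>b\<close>, and one more \<delta> gives the 13 \<delta> of
  \<open>side_adj\<close>.\<close>

lemma side_insert:
  assumes vs: "side_pts a b (us @ vs)" and ab: "a \<in> X" "b \<in> X" and w: "w \<in> V"
    and c: "c = last (a # us)" "c' = hd (vs @ [b])"
    and gp: "gp c c' w \<le> 10 * \<delta>"
    and ne: "us \<noteq> [] \<Longrightarrow> c \<noteq> w" "vs \<noteq> [] \<Longrightarrow> c' \<noteq> w"
  shows "side_pts a b (us @ w # vs)"
proof -
  have wX: "w \<in> X" using w by simp
  have succ: "successively (side_adj a b) ((a # us) @ (vs @ [b]))" using vs by (simp add: side_pts_def)
  then have adj: "side_adj a b c c'" using c by (simp add: successively_append_iff del: append_Cons)
  have cV: "us \<noteq> [] \<Longrightarrow> c \<in> V \<and> gp a b c \<le> 12 * \<delta>" using vs c by (auto simp: side_pts_def)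
  have c'V: "vs \<noteq> [] \<Longrightarrow> c' \<in> V \<and> gp a b c' \<le> 12 * \<delta>" using vs c by (auto simp: side_pts_def)
  have ca: "us = [] \<Longrightarrow> c = a" and c'b: "vs = [] \<Longrightarrow> c' = b" using c by auto
  have X: "c \<in> X" "c' \<in> X" using cV c'V ca c'b ab by (cases "us = []"; cases "vs = []"; simp)+
  have cw: "us \<noteq> [] \<Longrightarrow> \<sigma> \<le> d c w" using cV ne sep w by blast
  have c'w: "vs \<noteq> [] \<Longrightarrow> \<sigma> \<le> d c' w" using c'V ne sep w by blast
  have cc': "\<lbrakk>us \<noteq> []; vs \<noteq> []\<rbrakk> \<Longrightarrow> \<sigma> \<le> d c c'"
  proof -
    assume ne: "us \<noteq> []" "vs \<noteq> []"
    then have "c \<noteq> c'" using vs c by (auto simp: side_pts_def distinct_adj_append_iff)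
    then show ?thesis using sep cV c'V ne by blast
  qed
  note S = sigma delta_pos
  note A = adj[unfolded side_adj_def]
  have gwc: "us \<noteq> [] \<Longrightarrow> \<sigma> - 10 * \<delta> \<le> gp w c' c"
    using cw gp gp_swap[of w c' c] gp_commute commute by (smt (verit))
  have gwc': "vs \<noteq> [] \<Longrightarrow> \<sigma> - 10 * \<delta> \<le> gp c w c'"
    using c'w gp gp_swap[of w c c'] gp_commute commute by (smt (verit))
  have g1: "\<sigma> - 14 * \<delta> \<le> gp c a w" if "us \<noteq> []"
    using gwc[OF that] hyp4[OF ab(1) wX X(2,1)] A cw[OF that] gp_swap[of c a w] gp_commute[of a w c] S
    by linarith
  have g2: "\<sigma> - 14 * \<delta> \<le> gp c' b w" if "vs \<noteq> []"
    using gwc'[OF that] hyp4[OF X(1) wX ab(2) X(2)] A c'w[OF that] gp_swap[of c' b w] gp_commute[of w b c'] S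
    by linarith
  have w12: "gp a b w \<le> 12 * \<delta>"
  proof (rule ccontr)
    assume n: "\<not> ?thesis"
    have "12 * \<delta> < gp c a w"
      using g1 ca gp_le[of a b w] n ab wX S by (cases "us = []") auto
    moreover have "12 * \<delta> < gp b c' w"
      using g2 c'b gp_le'[of a b w] n ab wX S gp_commute[of c' b w] by (cases "vs = []") auto
    ultimately show False using hyp5[OF X(1) ab X(2) wX] n gp by linarith
  qed
  have adj1: "side_adj a b c w"
  proof (cases "us = []")
    case True
    then show ?thesis using ca w12 ab wX S by (simp add: side_adj_def)
  next
    case False
    have "\<sigma> - 15 * \<delta> \<le> gp w b c"
    proof (cases "vs = []")
      case True
      then show ?thesis using gwc[OF False] c'b S by simp
    next
      case vs: False
      have "\<sigma> - 13 * \<delta> \<le> gp c' b c"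
        using cc'[OF False vs] A gp_swap[of c b c'] gp_commute[of c b c'] gp_commute[of c' b c] by linarith
      then show ?thesis using gwc[OF False] hyp4[OF wX X(2) ab(2) X(1)] S by linarith
    qed
    then have "gp a w c \<le> 13 * \<delta>"
      using hyp4[OF ab(1) wX ab(2) X(1)] cV[OF False] S by linarith
    moreover have "gp c b w \<le> 13 * \<delta>"
      using hyp4[OF ab(1) X(1) ab(2) wX] w12 g1[OF False] gp_commute[of a c w] S by linarith
    ultimately show ?thesis by (simp add: side_adj_def)
  qed
  have adj2: "side_adj a b w c'"
  proof (cases "vs = []")
    case True
    then show ?thesis using c'b w12 ab wX S by (simp add: side_adj_def)
  next
    case False
    have "\<sigma> - 15 * \<delta> \<le> gp a w c'"
    proof (cases "us = []")
      case True
      then show ?thesis using gwc'[OF False] ca S by simp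
    next
      case us: False
      have "\<sigma> - 13 * \<delta> \<le> gp a c c'"
        using cc'[OF us False] A gp_swap[of c' a c] gp_commute[of a c' c] gp_commute[of a c c'] commute[of c c'] by linarith
      then show ?thesis using gwc'[OF False] hyp4[OF ab(1) X(1) wX X(2)] S by linarith
    qed
    then have "gp w b c' \<le> 13 * \<delta>"
      using hyp4[OF ab(1) wX ab(2) X(2)] c'V[OF False] S by linarith
    moreover have "gp a c' w \<le> 13 * \<delta>"
      using hyp4[OF ab(1) X(2) ab(2) wX] w12 g2[OF False] S by linarith
    ultimately show ?thesis by (simp add: side_adj_def)
  qed
  have "distinct_adj (us @ w # vs)"
    using vs ne c by (auto simp: side_pts_def distinct_adj_append_iff distinct_adj_Cons)
  moreover have "successively (side_adj a b) ((a # us) @ (w # vs @ [b]))"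
    using succ adj1 adj2 c by (auto simp: successively_append_iff successively_Cons simp del: append_Cons)
  ultimately show ?thesis using vs w w12 by (auto simp: side_pts_def)
qed

text \<open>Unlike in \<open>reduced\<close>, letters may be trivial. The turn at an apex is bounded
  for every rotation, including the identity, so merging two rotations never forces an apex to be
  removed.\<close>

definition side_el :: "'x \<Rightarrow> 'x \<Rightarrow> 'g \<Rightarrow> bool" where
  "side_el a b e \<longleftrightarrow> (\<exists>ws. is_word ws \<and> side_pts a b (map fst ws) \<and> wprod ws = e)"

lemma side_el_one: "\<lbrakk>a \<in> X; b \<in> X\<rbrakk> \<Longrightarrow> side_el a b \<one>"
  unfolding side_el_def using delta_pos
  by (intro exI[of _ "[]"]) (simp add: side_pts_def side_adj_def)

lemma side_el_K: "side_el a b e \<Longrightarrow> e \<in> K"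
  using wprod_K by (auto simp: side_el_def)

context
  fixes a b ws
  assumes ab: "a \<in> X" "b \<in> X" "d a b \<le> db a b + \<delta>"
    and ws: "is_word ws" "side_pts a b (map fst ws)"
begin

lemma side_wpts_adj: "i \<le> length ws \<Longrightarrow> side_adj a b (wpts a ws b ! i) (wpts a ws b ! Suc i)"
  using ws(2) by (auto simp: side_pts_def wpts_def successively_conv_nth simp del: nth_Cons_Suc)

lemma side_wpts_near: "i \<le> length ws \<Longrightarrow> gp a b (wpts a ws b ! Suc i) \<le> 12 * \<delta>"
  using ws(2) ab delta_pos by (auto simp: side_pts_def wpts_def nth_append)

text \<open>The turning bound comes from the near-minimality of the distance from \<open>a\<close> to \<open>b\<close>.\<close>

lemma side_turn:
  assumes i: "i < length ws"
  shows "gp (wpts a ws b ! i) (\<phi> (snd (ws ! i)) (wpts a ws b ! Suc (Suc i))) (fst (ws ! i)) \<le> 39 * \<delta>"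
proof -
  define c w e h where "c = wpts a ws b ! i" and "w = fst (ws ! i)"
    and "e = wpts a ws b ! Suc (Suc i)" and "h = snd (ws ! i)"
  have w: "w = wpts a ws b ! Suc i" using wpts_letter[OF i] by (simp add: w_def)
  have X: "c \<in> X" "w \<in> X" "e \<in> X"
    using wpts_X[OF ws(1) ab(1,2)] i by (auto simp: c_def w e_def)
  have h: "h \<in> rot w" "w \<in> V" using is_word_nth[OF ws(1) i] by (auto simp: h_def w_def)
  have hG: "h \<in> carrier G" using h rot_carrier by blast
  have adj: "gp a w c \<le> 13 * \<delta>" "gp w b e \<le> 13 * \<delta>" "gp a b w \<le> 12 * \<delta>"
    using side_wpts_adj[of i] side_wpts_adj[of "Suc i"] side_wpts_near[of i] i
    by (auto simp: side_adj_def c_def e_def w)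
  \<comment> \<open>The path through \<open>c\<close> and \<open>\<phi> h e\<close> joins the same
    classes as \<open>a\<close> and \<open>b\<close>, so it cannot beat \<open>d a b\<close> by more
    than \<delta>. The losses are 2 * 13 \<delta> twice, 2 * 12 \<delta> and \<delta>; half of their
    sum is below 39 \<delta>.\<close>
  have "db a b \<le> d a c + db c e + d e b"
    using db_triangle[of a c b] db_triangle[of c e b] db_le[of a c] db_le[of e b] X ab by simp
  moreover have "db c e \<le> d c (\<phi> h e)"
    using db_le[of c "\<phi> h e"] rot_K h X hG by simp
  moreover have "d (\<phi> h e) w = d e w" using act_dist[of h e w] rot_fix[OF h(2,1)] X hG by simp
  ultimately have "gp c (\<phi> h e) w \<le> 39 * \<delta>"
    using ab(3) adj gp_eq[of c "\<phi> h e" w] gp_eq[of a w c] gp_eq[of w b e] gp_eq[of a b w]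
      commute[of w c] commute[of b e] commute[of w e] commute[of b w] delta_pos by linarith
  then show ?thesis by (simp add: c_def w_def e_def h_def)
qed

lemma side_distinct: "distinct_adj (map fst ws)"
  using ws by (simp add: side_pts_def)

lemma side_word_near:
  assumes "p \<in> X"
  shows "\<exists>i\<le>length ws. gp (wpts a ws b ! i) (wpts a ws b ! Suc i) (\<phi> (inv (wprod (take i ws))) p)
      \<le> gp a (\<phi> (wprod ws) b) p + 2 * \<delta>"
  using word_near[OF ws(1) side_distinct ab(1,2) side_turn _ assms] sigma delta_pos by simp

text \<open>The path from \<open>a\<close> to \<open>b\<close> through \<open>c\<close>, the
  translate \<open>q\<close> of \<open>p\<close>, and \<open>c'\<close> is longer than
  \<open>d a b\<close> by at most 2 * (t + 2 \<delta>) + 2 * 13 \<delta> + 2 * 12 \<delta>;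
  near-minimality adds the last \<delta> of the 55 \<delta>.\<close>

lemma side_near:
  assumes p: "p \<in> X" and t: "gp a (\<phi> (wprod ws) b) p \<le> t"
  shows "db a p + db p b \<le> db a b + 2 * t + 55 * \<delta>"
proof -
  obtain i where i: "i \<le> length ws"
    "gp (wpts a ws b ! i) (wpts a ws b ! Suc i) (\<phi> (inv (wprod (take i ws))) p) \<le> t + 2 * \<delta>"
    using side_word_near[OF p] t by force
  define c c' P where "c = wpts a ws b ! i" and "c' = wpts a ws b ! Suc i" and "P = wprod (take i ws)"
  have P: "P \<in> K" "P \<in> carrier G" using wprod_K is_word_take ws by (auto simp: P_def)
  define q where "q = \<phi> (inv P) p"
  have X: "c \<in> X" "c' \<in> X" "q \<in> X" using wpts_X[OF ws(1) ab(1,2)] i P p by (auto simp: c_def c'_def q_def)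
  have adj: "gp a c' c \<le> 13 * \<delta>" "gp a b c' \<le> 12 * \<delta>" "gp c c' q \<le> t + 2 * \<delta>"
    using side_wpts_adj[OF i(1)] side_wpts_near[OF i(1)] i by (auto simp: side_adj_def c_def c'_def q_def P_def)
  have "db a p = db a q" "db p b = db q b" using P p K_inv by (auto simp: q_def)
  moreover have "db a q \<le> d a c + d c q" "db q b \<le> d q c' + d c' b"
    using db_le[of a q] db_le[of q b] triangle[of a c q] triangle[of q c' b] X ab by auto
  ultimately show ?thesis
    using adj ab(3) gp_eq[of a c' c] gp_eq[of a b c'] gp_eq[of c c' q] commute[of c' c] commute[of b c'] commute[of c' q] by linarith
qed

text \<open>\<open>v\<close> is close to a segment of the drawn chain, and the prefix
  \<open>P\<close> carries this segment back to one between consecutive points of the unrotated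
  side. The rotation conjugated by \<open>P\<close> is inserted there, or merged if its apex is an
  end of the segment. The 8 \<delta> here and the 2 \<delta> of \<open>word_near\<close> make the 10
  \<delta> of \<open>side_insert\<close>.\<close>

lemma side_rotate:
  assumes v: "v \<in> V" "h \<in> rot v" and t: "gp a (\<phi> (wprod ws) b) v \<le> 8 * \<delta>"
  shows "side_el a b (h \<otimes> wprod ws)"
proof -
  have vX: "v \<in> X" using v by simp
  obtain i where i: "i \<le> length ws"
    "gp (wpts a ws b ! i) (wpts a ws b ! Suc i) (\<phi> (inv (wprod (take i ws))) v) \<le> 10 * \<delta>"
    using side_word_near[OF vX] t by force
  define us vs where "us = take i ws" and "vs = drop i ws"
  have uv: "ws = us @ vs" "is_word us" "is_word vs" using ws by (auto simp: us_def vs_def)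
      (metis append_take_drop_id is_word_append)+
  define P where "P = wprod us"
  have P: "P \<in> carrier G" and Q: "wprod vs \<in> carrier G" using uv by (auto simp: P_def)
  have hG: "h \<in> carrier G" using v rot_carrier by blast
  define w where "w = \<phi> (inv P) v"
  define h' where "h' = inv P \<otimes> h \<otimes> P"
  have w: "w \<in> V" using V_inv v P by (simp add: w_def)
  have h': "h' \<in> rot w" using rot_conj[of "inv P" v h] v P by (simp add: h'_def w_def)
  have h'G: "h' \<in> carrier G" using h' w rot_carrier by blast
  have eq: "h \<otimes> wprod ws = P \<otimes> h' \<otimes> wprod vs"
    using uv P Q hG by (simp add: wprod_append h'_def m_assoc inv_mult_cancel flip: P_def)
  have c: "wpts a ws b ! i = last (a # map fst us)" "wpts a ws b ! Suc i = hd (map fst vs @ [b])"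
  proof -
    show "wpts a ws b ! i = last (a # map fst us)"
      using i(1) by (cases i) (auto simp: wpts_def nth_append us_def last_conv_nth take_map)
    show "wpts a ws b ! Suc i = hd (map fst vs @ [b])"
      using i(1) by (auto simp: wpts_def nth_append vs_def hd_append hd_drop_conv_nth drop_map hd_map)
  qed
  show ?thesis
  proof (cases "us \<noteq> [] \<and> last (a # map fst us) = w")
    case True
    then obtain us' g where us': "us = us' @ [(w, g)]"
      by (metis last_ConsR last_map list.map_disc_iff prod.collapse rev_exhaust last_snoc)
    have g: "g \<in> rot w" "is_word us'" using uv us' by auto
    have gG: "g \<in> carrier G" using g w rot_carrier by blast
    have "g \<otimes> h' \<in> rot w" using subgroup.m_closed[OF rot_subgroup[OF w]] g h' by blast
    moreover have "wprod (us' @ (w, g \<otimes> h') # vs) = h \<otimes> wprod ws"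
      unfolding eq P_def us' using g uv gG h'G w h' calculation Q
      by (simp add: wprod_append m_assoc)
    moreover have "map fst (us' @ (w, g \<otimes> h') # vs) = map fst ws" using uv us' by simp
    moreover have "side_pts a b (map fst (us' @ (w, g \<otimes> h') # vs))"
      unfolding calculation(3) by (rule ws(2))
    ultimately show ?thesis unfolding side_el_def
      using g uv w by (intro exI[of _ "us' @ (w, g \<otimes> h') # vs"]) auto
  next
    case us: False
    show ?thesis
    proof (cases "vs \<noteq> [] \<and> hd (map fst vs @ [b]) = w")
      case True
      then obtain g vs' where vs': "vs = (w, g) # vs'" by (cases vs) auto
      have g: "g \<in> rot w" "is_word vs'" using uv vs' by auto
      have gG: "g \<in> carrier G" using g w rot_carrier by blast
      have "h' \<otimes> g \<in> rot w" using subgroup.m_closed[OF rot_subgroup[OF w]] g h' by blast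
      moreover have "wprod (us @ (w, h' \<otimes> g) # vs') = h \<otimes> wprod ws"
        unfolding eq P_def vs' using g uv gG h'G w h' calculation
        by (simp add: wprod_append m_assoc)
      moreover have "map fst (us @ (w, h' \<otimes> g) # vs') = map fst ws" using uv vs' by simp
      moreover have "side_pts a b (map fst (us @ (w, h' \<otimes> g) # vs'))"
        unfolding calculation(3) by (rule ws(2))
      ultimately show ?thesis unfolding side_el_def
        using g uv w by (intro exI[of _ "us @ (w, h' \<otimes> g) # vs'"]) auto
    next
      case vs: False
      have "side_pts a b (map fst us @ w # map fst vs)"
      proof (rule side_insert[OF _ ab(1,2) w refl refl])
        show "side_pts a b (map fst us @ map fst vs)" using ws(2) uv(1) by simp
        show "gp (last (a # map fst us)) (hd (map fst vs @ [b])) w \<le> 10 * \<delta>"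
          using i(2) c by (simp add: w_def P_def us_def)
      qed (use us vs in auto)
      moreover have "wprod (us @ (w, h') # vs) = h \<otimes> wprod ws"
        unfolding eq P_def using uv h'G w h' by (simp add: wprod_append m_assoc)
      ultimately show ?thesis unfolding side_el_def
        using uv w h' by (intro exI[of _ "us @ (w, h') # vs"]) auto
    qed
  qed
qed

end

lemma side_el_rotate:
  "\<lbrakk>a \<in> X; b \<in> X; d a b \<le> db a b + \<delta>; side_el a b e; v \<in> V; h \<in> rot v; gp a (\<phi> e b) v \<le> 8 * \<delta>\<rbrakk>
    \<Longrightarrow> side_el a b (h \<otimes> e)"
  using side_rotate unfolding side_el_def by blast

lemma side_el_near:
  "\<lbrakk>a \<in> X; b \<in> X; d a b \<le> db a b + \<delta>; side_el a b e; p \<in> X; gp a (\<phi> e b) p \<le> t\<rbrakk>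
    \<Longrightarrow> db a p + db p b \<le> db a b + 2 * t + 55 * \<delta>"
  using side_near unfolding side_el_def by blast

text \<open>
  The four sides are lifted one after the other; \<open>k\<close> is the defect of the lifted polygon, which is
  removed by rotating the sides about the apices given by \<open>greendlinger\<close>.
\<close>

context
  fixes x1 x2 x3 x4 k
  assumes X: "x1 \<in> X" "x2 \<in> X" "x3 \<in> X" "x4 \<in> X" and k: "k \<in> K"
    and near: "d x1 x2 \<le> db x1 x2 + \<delta>" "d x2 x3 \<le> db x2 x3 + \<delta>" "d x3 x4 \<le> db x3 x4 + \<delta>"
      "d x4 (\<phi> k x1) \<le> db x4 (\<phi> k x1) + \<delta>"
begin

text \<open>Each factor moves everything that follows it, so \<open>\<phi> E x1\<close> is the end
  of the rotated polygon that starts at \<open>x1\<close>; the polygon is closed when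
  \<open>E\<close> fixes \<open>x1\<close>.\<close>

definition "polygon E \<longleftrightarrow> (\<exists>e1 e2 e3 e4. side_el x1 x2 e1 \<and> side_el x2 x3 e2 \<and> side_el x3 x4 e3 \<and>
    side_el x4 (\<phi> k x1) e4 \<and> E = e1 \<otimes> e2 \<otimes> e3 \<otimes> e4 \<otimes> k)"

lemma kG: "k \<in> carrier G" "\<phi> k x1 \<in> X"
  using k X K_carrier by auto

lemma polygon_K: "polygon E \<Longrightarrow> E \<in> K"
  using side_el_K K_mult k by (auto simp: polygon_def)

lemma conj_apex:
  assumes "F \<in> carrier G" "v \<in> V" "h \<in> rot v"
  shows "\<phi> (inv F) v \<in> V" "inv F \<otimes> h \<otimes> F \<in> rot (\<phi> (inv F) v)" "h \<in> carrier G"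
  using V_inv rot_conj[of "inv F" v h] assms rot_carrier by auto

text \<open>An apex within 6 \<delta> of the closing segment is within 8 \<delta> of one of the four
  drawn sides. Rotating that side there carries the later sides along, so after conjugation by the
  preceding factors the effect on \<open>E\<close> is left multiplication by
  \<open>h\<close>.\<close>

lemma polygon_rotate:
  assumes E: "polygon E" and v: "v \<in> V" "h \<in> rot v" and t: "gp x1 (\<phi> E x1) v \<le> 6 * \<delta>"
  shows "polygon (h \<otimes> E)"
proof -
  obtain e1 e2 e3 e4 where e: "side_el x1 x2 e1" "side_el x2 x3 e2" "side_el x3 x4 e3"
    "side_el x4 (\<phi> k x1) e4" "E = e1 \<otimes> e2 \<otimes> e3 \<otimes> e4 \<otimes> k" using E by (auto simp: polygon_def)
  have eG: "e1 \<in> carrier G" "e2 \<in> carrier G" "e3 \<in> carrier G" "e4 \<in> carrier G"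
    using e side_el_K K_carrier by blast+
  note G = eG kG
  have hG: "h \<in> carrier G" and vX: "v \<in> X" using v rot_carrier by auto
  define F2 F3 F4 where "F2 = e1" and "F3 = e1 \<otimes> e2" and "F4 = e1 \<otimes> e2 \<otimes> e3"
  have FG: "F2 \<in> carrier G" "F3 \<in> carrier G" "F4 \<in> carrier G" using G by (auto simp: F2_def F3_def F4_def)
  define q1 q2 q3 q4 where "q1 = \<phi> e1 x2" and "q2 = \<phi> F2 (\<phi> e2 x3)"
    and "q3 = \<phi> F3 (\<phi> e3 x4)" and "q4 = \<phi> F4 (\<phi> e4 (\<phi> k x1))"
  have q: "q1 = \<phi> F2 x2" "q2 = \<phi> F3 x3" "q3 = \<phi> F4 x4" "q4 = \<phi> E x1"
    using X G e(5) by (auto simp: q1_def q2_def q3_def q4_def F2_def F3_def F4_def act_mult)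
  have qX: "q1 \<in> X" "q2 \<in> X" "q3 \<in> X" "q4 \<in> X" using q X FG e G by auto
  have "gp x1 q1 v \<le> 8 * \<delta> \<or> gp q1 q2 v \<le> 8 * \<delta> \<or> gp q2 q3 v \<le> 8 * \<delta> \<or> gp q3 q4 v \<le> 8 * \<delta>"
  proof (rule ccontr)
    assume "\<not> ?thesis"
    then have "8 * \<delta> < gp x1 q1 v" "8 * \<delta> < gp q1 q2 v" "8 * \<delta> < gp q2 q3 v" "8 * \<delta> < gp q3 q4 v"
      by auto
    moreover have "gp x1 q4 v \<le> 6 * \<delta>" using t q(4) by simp
    ultimately show False
      using hyp4[OF qX(2-4) vX] hyp4[OF X(1) qX(1,2) vX] hyp4[OF X(1) qX(2,4) vX] by linarith
  qed
  then consider "gp x1 q1 v \<le> 8 * \<delta>" | "gp q1 q2 v \<le> 8 * \<delta>" | "gp q2 q3 v \<le> 8 * \<delta>" | "gp q3 q4 v \<le> 8 * \<delta>" by blast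
  then show ?thesis
  proof cases
    case 1
    have "side_el x1 x2 (h \<otimes> e1)"
      using side_el_rotate[OF X(1,2) near(1) e(1) v] 1 by (simp add: q1_def)
    moreover have "h \<otimes> E = (h \<otimes> e1) \<otimes> e2 \<otimes> e3 \<otimes> e4 \<otimes> k" using e(5) G hG by (simp add: m_assoc)
    ultimately show ?thesis unfolding polygon_def using e by blast
  next
    case 2
    define h' where "h' = inv F2 \<otimes> h \<otimes> F2"
    have "gp x2 (\<phi> e2 x3) (\<phi> (inv F2) v) \<le> 8 * \<delta>"
      using 2 act_gp_inv[of F2 x2 "\<phi> e2 x3" v] FG X G vX by (simp add: q(1) q2_def)
    then have "side_el x2 x3 (h' \<otimes> e2)"
      using side_el_rotate[OF X(2,3) near(2) e(2)] conj_apex[OF FG(1) v] by (simp add: h'_def)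
    moreover have "h \<otimes> E = e1 \<otimes> (h' \<otimes> e2) \<otimes> e3 \<otimes> e4 \<otimes> k"
      using e(5) G hG by (simp add: m_assoc h'_def F2_def inv_mult_cancel)
    ultimately show ?thesis unfolding polygon_def using e by blast
  next
    case 3
    define h' where "h' = inv F3 \<otimes> h \<otimes> F3"
    have "gp x3 (\<phi> e3 x4) (\<phi> (inv F3) v) \<le> 8 * \<delta>"
      using 3 act_gp_inv[of F3 x3 "\<phi> e3 x4" v] FG X G vX by (simp add: q(2) q3_def)
    then have "side_el x3 x4 (h' \<otimes> e3)"
      using side_el_rotate[OF X(3,4) near(3) e(3)] conj_apex[OF FG(2) v] by (simp add: h'_def)
    moreover have "h \<otimes> E = e1 \<otimes> e2 \<otimes> (h' \<otimes> e3) \<otimes> e4 \<otimes> k"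
    proof -
      have "F3 \<otimes> h' = h \<otimes> F3" using FG hG by (simp add: h'_def m_assoc inv_mult_cancel)
      then have "F3 \<otimes> h' \<otimes> (e3 \<otimes> e4 \<otimes> k) = h \<otimes> F3 \<otimes> (e3 \<otimes> e4 \<otimes> k)" by simp
      then show ?thesis using e(5) G hG FG by (simp add: m_assoc h'_def F3_def)
    qed
    ultimately show ?thesis unfolding polygon_def using e by blast
  next
    case 4
    define h' where "h' = inv F4 \<otimes> h \<otimes> F4"
    have "gp x4 (\<phi> e4 (\<phi> k x1)) (\<phi> (inv F4) v) \<le> 8 * \<delta>"
      using 4 act_gp_inv[of F4 x4 "\<phi> e4 (\<phi> k x1)" v] FG X G vX by (simp add: q(3) q4_def)
    then have "side_el x4 (\<phi> k x1) (h' \<otimes> e4)"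
      using side_el_rotate[OF X(4) kG(2) near(4) e(4)] conj_apex[OF FG(3) v] by (simp add: h'_def)
    moreover have "h \<otimes> E = e1 \<otimes> e2 \<otimes> e3 \<otimes> (h' \<otimes> e4) \<otimes> k"
    proof -
      have "F4 \<otimes> h' = h \<otimes> F4" using FG hG by (simp add: h'_def m_assoc inv_mult_cancel)
      then have "F4 \<otimes> h' \<otimes> (e4 \<otimes> k) = h \<otimes> F4 \<otimes> (e4 \<otimes> k)" by simp
      then show ?thesis using e(5) G hG FG by (simp add: m_assoc h'_def F4_def)
    qed
    ultimately show ?thesis unfolding polygon_def using e by blast
  qed
qed

lemma polygon_start: "polygon k"
  unfolding polygon_def using side_el_one X kG by (intro exI[of _ \<one>]) auto

text \<open>Each rotation given by \<open>greendlinger\<close> brings the end point 4 \<delta>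
  closer to \<open>x1\<close>, and \<open>n\<close> counts the rotations still available. If the
  defect is itself a rotation, its inverse closes the polygon at once.\<close>

lemma polygon_close: "\<lbrakk>polygon E; d x1 (\<phi> E x1) \<le> 4 * \<delta> * real n\<rbrakk> \<Longrightarrow> \<exists>E. polygon E \<and> \<phi> E x1 = x1"
proof (induction n arbitrary: E)
  case 0
  have "\<phi> E x1 \<in> X" using polygon_K[OF 0(1)] K_carrier X by simp
  then show ?case using 0 X nonneg[of x1 "\<phi> E x1"] by auto
next
  case (Suc n)
  have EK: "E \<in> K" using polygon_K Suc by blast
  then have EG: "E \<in> carrier G" using K_carrier by blast
  from greendlinger[OF X(1) EK] consider "E = \<one>" | v where "v \<in> V" "E \<in> rot v" "E \<noteq> \<one>"
    | v h where "v \<in> V" "h \<in> rot v" "gp x1 (\<phi> E x1) v \<le> 6 * \<delta>" "d x1 (\<phi> (h \<otimes> E) x1) \<le> d x1 (\<phi> E x1) - 4 * \<delta>"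
    by blast
  then show ?case
  proof cases
    case 1
    then show ?thesis using Suc.prems X by auto
  next
    case 2
    have "inv E \<in> rot v" using subgroup.m_inv_closed[OF rot_subgroup] 2 by blast
    moreover have "gp x1 (\<phi> E x1) v \<le> 6 * \<delta>" using rot_gp[of v E x1] 2 X delta_pos by simp
    ultimately have "polygon (inv E \<otimes> E)" using polygon_rotate Suc.prems 2 by blast
    then show ?thesis using EG X by (intro exI[of _ "inv E \<otimes> E"]) simp
  next
    case 3
    then have "polygon (h \<otimes> E)" using polygon_rotate Suc.prems by blast
    then show ?thesis using Suc.IH[of "h \<otimes> E"] 3 Suc.prems(2) by (simp add: algebra_simps)
  qed
qed

text \<open>\<open>quad_center\<close> gives a point 2 \<delta>-close to two opposite drawn sides of
  the closed polygon. Each side costs 2 * 2 \<delta> + 55 \<delta> in \<open>side_el_near\<close>,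
  together 118 \<delta>.\<close>

lemma quotient_four_point_aux:
  "db x1 x3 + db x2 x4 \<le> max (db x1 x2 + db x3 x4) (db x2 x3 + db x4 x1) + 118 * \<delta>"
proof -
  obtain n where "d x1 (\<phi> k x1) < real n * (4 * \<delta>)"
    using reals_Archimedean3[of "4 * \<delta>"] delta_pos by fastforce
  then obtain E where E: "polygon E" "\<phi> E x1 = x1"
    using polygon_close[OF polygon_start, of n] by (auto simp: mult.commute)
  obtain e1 e2 e3 e4 where e: "side_el x1 x2 e1" "side_el x2 x3 e2" "side_el x3 x4 e3"
    "side_el x4 (\<phi> k x1) e4" "E = e1 \<otimes> e2 \<otimes> e3 \<otimes> e4 \<otimes> k" using E by (auto simp: polygon_def)
  have eK: "e1 \<in> K" "e2 \<in> K" "e3 \<in> K" "e4 \<in> K" using e side_el_K by blast+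
  then have eG: "e1 \<in> carrier G" "e2 \<in> carrier G" "e3 \<in> carrier G" "e4 \<in> carrier G"
    using K_carrier by blast+
  note G = eG kG
  define F2 F3 F4 where "F2 = e1" and "F3 = e1 \<otimes> e2" and "F4 = e1 \<otimes> e2 \<otimes> e3"
  have FK: "F2 \<in> K" "F3 \<in> K" "F4 \<in> K" using eK K_mult by (auto simp: F2_def F3_def F4_def)
  then have FG: "F2 \<in> carrier G" "F3 \<in> carrier G" "F4 \<in> carrier G" using K_carrier by blast+
  define q1 q2 q3 where "q1 = \<phi> e1 x2" and "q2 = \<phi> F2 (\<phi> e2 x3)" and "q3 = \<phi> F3 (\<phi> e3 x4)"
  have q: "q1 = \<phi> F2 x2" "q2 = \<phi> F3 x3" "q3 = \<phi> F4 x4" "\<phi> F4 (\<phi> e4 (\<phi> k x1)) = x1"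
    using X G e(5) E(2) by (auto simp: q1_def q2_def q3_def F2_def F3_def F4_def act_mult)
  have qX: "q1 \<in> X" "q2 \<in> X" "q3 \<in> X" using q X FG by auto
  obtain p where p: "p \<in> X" and c: "gp x1 q1 p \<le> 2 * \<delta> \<and> gp q2 q3 p \<le> 2 * \<delta> \<or>
      gp q1 q2 p \<le> 2 * \<delta> \<and> gp q3 x1 p \<le> 2 * \<delta>"
    using quad_center[OF X(1) qX] by blast
  have iF: "\<phi> (inv F2) p \<in> X" "\<phi> (inv F3) p \<in> X" "\<phi> (inv F4) p \<in> X" using FG p by auto
  have dbF: "db y (\<phi> (inv F) p) = db y p" "db (\<phi> (inv F) p) y = db p y" if "F \<in> K" for F y
    using that p K_inv by auto
  from c show ?thesis
  proof
    assume c: "gp x1 q1 p \<le> 2 * \<delta> \<and> gp q2 q3 p \<le> 2 * \<delta>"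
    have "db x1 p + db p x2 \<le> db x1 x2 + 2 * (2 * \<delta>) + 55 * \<delta>"
      using side_el_near[OF X(1,2) near(1) e(1) p, of "2 * \<delta>"] c by (simp add: q1_def)
    moreover have "gp x3 (\<phi> e3 x4) (\<phi> (inv F3) p) \<le> 2 * \<delta>"
      using c act_gp_inv[of F3 x3 "\<phi> e3 x4" p] FG X G p by (simp add: q(2) q3_def)
    then have "db x3 p + db p x4 \<le> db x3 x4 + 2 * (2 * \<delta>) + 55 * \<delta>"
      using side_el_near[OF X(3,4) near(3) e(3) iF(2), of "2 * \<delta>"] dbF[OF FK(2)] by simp
    moreover have "db x1 x3 \<le> db x1 p + db p x3" "db x2 x4 \<le> db x2 p + db p x4"
      using db_triangle X p by auto
    ultimately show ?thesis using db_commute[of p x3] db_commute[of x2 p] by linarith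
  next
    assume c: "gp q1 q2 p \<le> 2 * \<delta> \<and> gp q3 x1 p \<le> 2 * \<delta>"
    have "gp x2 (\<phi> e2 x3) (\<phi> (inv F2) p) \<le> 2 * \<delta>"
      using c act_gp_inv[of F2 x2 "\<phi> e2 x3" p] FG X G p by (simp add: q(1) q2_def)
    then have "db x2 p + db p x3 \<le> db x2 x3 + 2 * (2 * \<delta>) + 55 * \<delta>"
      using side_el_near[OF X(2,3) near(2) e(2) iF(1), of "2 * \<delta>"] dbF[OF FK(1)] by simp
    moreover have "gp x4 (\<phi> e4 (\<phi> k x1)) (\<phi> (inv F4) p) \<le> 2 * \<delta>"
      using c act_gp_inv[of F4 x4 "\<phi> e4 (\<phi> k x1)" p] FG X G p by (simp add: q(3,4))
    then have "db x4 p + db p x1 \<le> db x4 x1 + 2 * (2 * \<delta>) + 55 * \<delta>"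
      using side_el_near[OF X(4) kG(2) near(4) e(4) iF(3), of "2 * \<delta>"] dbF[OF FK(3)] k X by simp
    moreover have "db x1 x3 \<le> db x1 p + db p x3" "db x2 x4 \<le> db x2 p + db p x4"
      using db_triangle X p by auto
    ultimately show ?thesis using db_commute[of p x1] db_commute[of p x4] by linarith
  qed
qed

end

lemma quotient_four_point:
  assumes X: "x \<in> X" "y \<in> X" "z \<in> X" "t \<in> X"
  shows "db x z + db y t \<le> max (db x y + db z t) (db y z + db t x) + 118 * \<delta>"
proof -
  obtain k2 where k2: "k2 \<in> K" "d x (\<phi> k2 y) \<le> db x y + \<delta>" using db_approx X delta_pos by blast
  define y' where "y' = \<phi> k2 y"
  have y': "y' \<in> X" using k2 K_carrier X by (simp add: y'_def)
  obtain k3 where k3: "k3 \<in> K" "d y' (\<phi> k3 z) \<le> db y' z + \<delta>" using db_approx y' X delta_pos by blast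
  define z' where "z' = \<phi> k3 z"
  have z': "z' \<in> X" using k3 K_carrier X by (simp add: z'_def)
  obtain k4 where k4: "k4 \<in> K" "d z' (\<phi> k4 t) \<le> db z' t + \<delta>" using db_approx z' X delta_pos by blast
  define t' where "t' = \<phi> k4 t"
  have t': "t' \<in> X" using k4 K_carrier X by (simp add: t'_def)
  obtain k where k: "k \<in> K" "d t' (\<phi> k x) \<le> db t' x + \<delta>" using db_approx t' X delta_pos by blast
  have "db x z' + db y' t' \<le> max (db x y' + db z' t') (db y' z' + db t' x) + 118 * \<delta>"
    by (rule quotient_four_point_aux[OF X(1) y' z' t' k(1)])
      (use k k2 k3 k4 X y' z' t' in \<open>auto simp: y'_def z'_def t'_def\<close>)
  then show ?thesis using k2 k3 k4 X by (simp add: y'_def z'_def t'_def)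
qed

theorem quotient_hyperbolic: "hyperbolic (59 * \<delta>) (quotient_space G X \<phi> K) (quotient_dist d)"
  unfolding hyperbolic_def quotient_space_orb
proof (intro ballI)
  fix P Q R S
  assume "P \<in> orb ` X" "Q \<in> orb ` X" "R \<in> orb ` X" "S \<in> orb ` X"
  then obtain x y z t where xyzt: "x \<in> X" "y \<in> X" "z \<in> X" "t \<in> X" "P = orb x" "Q = orb y" "R = orb z" "S = orb t"
    by blast
  show "min (gromov_product (quotient_dist d) P Q S) (gromov_product (quotient_dist d) Q R S) - 59 * \<delta>
      \<le> gromov_product (quotient_dist d) P R S"
    using quotient_four_point[OF xyzt(1-4)] db_commute[of t x]
    unfolding xyzt(5-8) gromov_product_def db_def[symmetric] by (simp add: min_def max_def field_simps split: if_splits)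
qed

end

section \<open>Free products\<close>

context group
begin

lemma word_value_Nil [simp]: "word_value G [] = \<one>"
  by (simp add: word_value_def)

lemma word_value_Cons [simp]: "word_value G ((i, a) # w) = a \<otimes> word_value G w"
  by (simp add: word_value_def)

lemma reduced_words_Nil [simp]: "[] \<in> reduced_words G I A"
  by (simp add: reduced_words_def)

lemma reduced_words_Cons:
  "(i, a) # w \<in> reduced_words G I A \<longleftrightarrow>
    i \<in> I \<and> a \<in> A i \<and> a \<noteq> \<one> \<and> (w \<noteq> [] \<longrightarrow> i \<noteq> fst (hd w)) \<and> w \<in> reduced_words G I A"
  by (auto simp: reduced_words_def distinct_adj_Cons hd_map)

lemma reduced_words_append:
  "u @ w \<in> reduced_words G I A \<longleftrightarrow>
    u \<in> reduced_words G I A \<and> w \<in> reduced_words G I A \<and> (u \<noteq> [] \<and> w \<noteq> [] \<longrightarrow> fst (last u) \<noteq> fst (hd w))"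
  by (auto simp: reduced_words_def distinct_adj_append_iff hd_map last_map)

context
  fixes I :: "'i set" and A :: "'i \<Rightarrow> 'a set"
  assumes A: "\<And>i. i \<in> I \<Longrightarrow> subgroup (A i) G"
begin

lemma factor_carrier: "\<lbrakk>i \<in> I; a \<in> A i\<rbrakk> \<Longrightarrow> a \<in> carrier G"
  using A subgroup.subset by blast

lemma word_value_closed: "w \<in> reduced_words G I A \<Longrightarrow> word_value G w \<in> carrier G"
proof (induction w)
  case (Cons x w)
  then show ?case using factor_carrier by (cases x) (auto simp: reduced_words_Cons)
qed simp

lemma word_value_append:
  "\<lbrakk>u \<in> reduced_words G I A; w \<in> reduced_words G I A\<rbrakk>
    \<Longrightarrow> word_value G (u @ w) = word_value G u \<otimes> word_value G w"
proof (induction u)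
  case (Cons x u)
  obtain i a where x: "x = (i, a)" by force
  then have u: "i \<in> I" "a \<in> A i" "u \<in> reduced_words G I A" using Cons by (auto simp: reduced_words_Cons)
  have "a \<in> carrier G" using u factor_carrier by blast
  then show ?case using Cons x u word_value_closed by (simp add: m_assoc)
qed (simp add: word_value_closed)

lemma reduced_words_mult:
  assumes "i \<in> I" "a \<in> A i" "w \<in> reduced_words G I A"
  shows "\<exists>u\<in>reduced_words G I A. word_value G u = a \<otimes> word_value G w"
proof (cases "a = \<one>")
  case True
  then show ?thesis using assms word_value_closed by (intro bexI[of _ w]) auto
next
  case a1: False
  have aG: "a \<in> carrier G" using assms factor_carrier by blast
  show ?thesis
  proof (cases "w = [] \<or> fst (hd w) \<noteq> i")
    case True
    then show ?thesis using assms a1 by (intro bexI[of _ "(i, a) # w"]) (auto simp: reduced_words_Cons)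
  next
    case False
    then obtain b w' where w: "w = (i, b) # w'" by (cases w) auto
    have b: "b \<in> A i" and w': "w' \<in> reduced_words G I A" "w' \<noteq> [] \<Longrightarrow> i \<noteq> fst (hd w')"
      using assms(3) w by (auto simp: reduced_words_Cons)
    have bG: "b \<in> carrier G" using assms b factor_carrier by blast
    have ab: "a \<otimes> b \<in> A i" using subgroup.m_closed[OF A] assms b by blast
    have eq: "a \<otimes> word_value G w = (a \<otimes> b) \<otimes> word_value G w'"
      using w aG bG word_value_closed[OF w'(1)] by (simp add: m_assoc)
    show ?thesis
    proof (cases "a \<otimes> b = \<one>")
      case True
      then show ?thesis using eq w' word_value_closed by (intro bexI[of _ w']) auto
    next
      case False
      then show ?thesis using eq w' ab assms
        by (intro bexI[of _ "(i, a \<otimes> b) # w'"]) (auto simp: reduced_words_Cons)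
    qed
  qed
qed

lemma generate_word_value:
  assumes "x \<in> generate G (\<Union>i\<in>I. A i)"
  shows "x \<in> word_value G ` reduced_words G I A"
  using assms
proof (induction rule: generate.induct)
  case one
  show ?case by (intro image_eqI[of _ _ "[]"]) auto
next
  case (incl h)
  then obtain i where i: "i \<in> I" "h \<in> A i" by blast
  then show ?case using reduced_words_mult[OF i, of "[]"] factor_carrier by force
next
  case (inv h)
  then obtain i where i: "i \<in> I" "h \<in> A i" by blast
  then have "inv h \<in> A i" using subgroup.m_inv_closed[OF A] by blast
  then show ?case using reduced_words_mult[OF i(1), of "inv h" "[]"] factor_carrier i by force
next
  case (eng h1 h2)
  then obtain u w where uw: "u \<in> reduced_words G I A" "h1 = word_value G u"
    "w \<in> reduced_words G I A" "h2 = word_value G w" by blast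
  from uw(1) have "word_value G u \<otimes> word_value G w \<in> word_value G ` reduced_words G I A"
  proof (induction u)
    case Nil
    then show ?case using uw word_value_closed by simp
  next
    case (Cons x u)
    obtain i a where x: "x = (i, a)" by force
    then have u: "i \<in> I" "a \<in> A i" "u \<in> reduced_words G I A" using Cons.prems by (auto simp: reduced_words_Cons)
    then obtain v where v: "v \<in> reduced_words G I A" "word_value G u \<otimes> word_value G w = word_value G v"
      using Cons.IH by blast
    have "word_value G (x # u) \<otimes> word_value G w = a \<otimes> word_value G v"
      using x u uw v factor_carrier[OF u(1,2)] word_value_closed by (simp add: m_assoc)
    then show ?case using reduced_words_mult[OF u(1,2) v(1)] by force
  qed
  then show ?case using uw by simp
qed

definition inv_word :: "('i \<times> 'a) list \<Rightarrow> ('i \<times> 'a) list" where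
  "inv_word w = rev (map (\<lambda>(i, a). (i, inv a)) w)"

lemma inv_word_Nil [simp]: "inv_word [] = []"
  by (simp add: inv_word_def)

lemma inv_word_Cons: "inv_word ((i, a) # w) = inv_word w @ [(i, inv a)]"
  by (simp add: inv_word_def)

lemma inv_word_last: "w \<noteq> [] \<Longrightarrow> fst (last (inv_word w)) = fst (hd w)"
  by (cases w) (auto simp: inv_word_Cons)

lemma inv_word_is_Nil [simp]: "inv_word w = [] \<longleftrightarrow> w = []"
  by (simp add: inv_word_def)

lemma inv_word_reduced:
  "w \<in> reduced_words G I A \<Longrightarrow> inv_word w \<in> reduced_words G I A \<and> word_value G (inv_word w) = inv (word_value G w)"
proof (induction w)
  case (Cons x w)
  obtain i a where x: "x = (i, a)" by force
  then have w: "i \<in> I" "a \<in> A i" "a \<noteq> \<one>" "w \<noteq> [] \<Longrightarrow> i \<noteq> fst (hd w)" "w \<in> reduced_words G I A"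
    using Cons.prems by (auto simp: reduced_words_Cons)
  have aG: "a \<in> carrier G" using w factor_carrier by blast
  have "[(i, inv a)] \<in> reduced_words G I A"
    using w aG subgroup.m_inv_closed[OF A] by (auto simp: reduced_words_Cons inv_eq_1_iff)
  then show ?case
    using Cons.IH[OF w(5)] x w inv_word_last[of w] aG word_value_closed[OF w(5)]
    by (auto simp: inv_word_Cons reduced_words_append word_value_append inv_mult_group)
qed simp

text \<open>Words with equal values are compared by their first letters. If the factors differ, the
  inverse of one word followed by the other is reduced; if only the elements differ, the two first
  letters merge into one non-trivial letter. Both contradict \<open>nontriv\<close>.\<close>

lemma internal_free_productI:
  assumes L: "L = generate G (\<Union>i\<in>I. A i)"
    and nontriv: "\<And>w. \<lbrakk>w \<in> reduced_words G I A; w \<noteq> []\<rbrakk> \<Longrightarrow> word_value G w \<noteq> \<one>"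
  shows "internal_free_product G L I A"
proof -
  have sub: "subgroup L G" unfolding L using factor_carrier by (intro generate_is_subgroup) auto
  have inj: "u = w" if "u \<in> reduced_words G I A" "w \<in> reduced_words G I A" "word_value G u = word_value G w" for u w
    using that
  proof (induction u arbitrary: w)
    case Nil
    then show ?case using nontriv[of w] by auto
  next
    case (Cons x u)
    obtain i a where x: "x = (i, a)" by force
    have u: "i \<in> I" "a \<in> A i" "a \<noteq> \<one>" "u \<noteq> [] \<Longrightarrow> i \<noteq> fst (hd u)" "u \<in> reduced_words G I A"
      using Cons.prems x by (auto simp: reduced_words_Cons)
    have aG: "a \<in> carrier G" using u factor_carrier by blast
    have "w \<noteq> []" using Cons.prems nontriv[of "x # u"] by auto
    then obtain j b w' where w: "w = (j, b) # w'" by (metis list.exhaust prod.collapse)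
    have w': "j \<in> I" "b \<in> A j" "b \<noteq> \<one>" "w' \<noteq> [] \<Longrightarrow> j \<noteq> fst (hd w')" "w' \<in> reduced_words G I A"
      using Cons.prems w by (auto simp: reduced_words_Cons)
    have bG: "b \<in> carrier G" using w' factor_carrier by blast
    note V = word_value_closed[OF u(5)] word_value_closed[OF w'(5)]
    have eq: "a \<otimes> word_value G u = b \<otimes> word_value G w'" using Cons.prems x w by simp
    have ij: "i = j"
    proof (rule ccontr)
      assume "i \<noteq> j"
      define z where "z = inv_word (x # u) @ w"
      have "z \<in> reduced_words G I A"
        using inv_word_reduced[OF Cons.prems(1)] Cons.prems(2) inv_word_last[of "x # u"] \<open>i \<noteq> j\<close> x w
        by (simp add: z_def reduced_words_append)
      moreover have "word_value G z = \<one>"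
        using inv_word_reduced[OF Cons.prems(1)] Cons.prems word_value_closed[OF Cons.prems(2)]
        by (simp add: z_def word_value_append)
      ultimately show False using nontriv[of z] w by (simp add: z_def)
    qed
    have ab: "a = b"
    proof (rule ccontr)
      assume "a \<noteq> b"
      define c where "c = inv a \<otimes> b"
      have c: "c \<in> A i" using subgroup.m_closed[OF A] subgroup.m_inv_closed[OF A] u w' ij by (simp add: c_def)
      have cG: "c \<in> carrier G" using aG bG by (simp add: c_def)
      have c1: "c \<noteq> \<one>"
      proof
        assume "c = \<one>"
        then have "a \<otimes> (inv a \<otimes> b) = a" using aG by (simp add: c_def)
        then show False using aG bG \<open>a \<noteq> b\<close> by (simp add: inv_mult_cancel)
      qed
      define z where "z = inv_word u @ (i, c) # w'"
      have cw: "(i, c) # w' \<in> reduced_words G I A" using u w' c c1 ij by (auto simp: reduced_words_Cons)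
      then have "z \<in> reduced_words G I A"
        using inv_word_reduced[OF u(5)] inv_word_last[of u] u by (auto simp: z_def reduced_words_append)
      moreover have "word_value G z = \<one>"
      proof -
        have "word_value G u = inv a \<otimes> (a \<otimes> word_value G u)" using aG V by (simp add: inv_mult_cancel)
        also have "\<dots> = c \<otimes> word_value G w'" unfolding eq using aG bG V by (simp add: c_def m_assoc)
        finally have "word_value G u = c \<otimes> word_value G w'" .
        then show ?thesis
          using inv_word_reduced[OF u(5)] cw V by (simp add: z_def word_value_append)
      qed
      ultimately show False using nontriv[of z] by (simp add: z_def)
    qed
    have "word_value G u = word_value G w'" using eq ab bG V by simp
    then show ?case using Cons.IH[OF u(5) w'(5)] x w ij ab by simp
  qed
  have "word_value G w \<in> L" if "w \<in> reduced_words G I A" for w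
    using that
  proof (induction w)
    case (Cons x w)
    obtain i a where x: "x = (i, a)" by force
    then have "i \<in> I" "a \<in> A i" "w \<in> reduced_words G I A" using Cons.prems by (auto simp: reduced_words_Cons)
    then show ?case using Cons.IH x subgroup.m_closed[OF sub, of a] unfolding L by (auto intro: generate.incl)
  qed (simp add: subgroup.one_closed[OF sub])
  then have "bij_betw (word_value G) (reduced_words G I A) L"
    using inj generate_word_value L by (auto simp: bij_betw_def inj_on_def)
  then show ?thesis using sub A by (simp add: internal_free_product_def)
qed

end

end

section \<open>The free product decomposition given by a windmill\<close>

context windmill
begin

definition orbn :: "nat \<Rightarrow> 'x \<Rightarrow> 'x set" where
  "orbn n v = {\<phi> k v | k. k \<in> Nn n}"

text \<open>One apex for each \<open>Nn n\<close>-orbit in \<open>Wn n\<close>, chosen as a function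
  of the orbit. The rotation groups of the other apices are conjugates by elements of
  \<open>Nn n\<close> and must not be counted again.\<close>

definition Sn :: "nat \<Rightarrow> 'x set" where
  "Sn n = (\<lambda>Q. SOME u. u \<in> Q) ` orbn n ` Wn n"

lemma orbn_self: "v \<in> V \<Longrightarrow> v \<in> orbn n v"
  unfolding orbn_def using subgroup.one_closed[OF Nn_subgroup] by (intro CollectI exI[of _ \<one>]) simp

lemma orbn_subset: "\<lbrakk>v \<in> V; k \<in> Nn n\<rbrakk> \<Longrightarrow> orbn n (\<phi> k v) \<subseteq> orbn n v"
proof
  fix u assume *: "v \<in> V" "k \<in> Nn n" and "u \<in> orbn n (\<phi> k v)"
  then obtain l where l: "l \<in> Nn n" "u = \<phi> l (\<phi> k v)" by (auto simp: orbn_def)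
  then have "u = \<phi> (l \<otimes> k) v" using * Nn_carrier by (simp add: act_mult)
  then show "u \<in> orbn n v" using l * subgroup.m_closed[OF Nn_subgroup] by (auto simp: orbn_def)
qed

lemma orbn_eq:
  assumes "v \<in> V" "k \<in> Nn n"
  shows "orbn n (\<phi> k v) = orbn n v"
proof
  have "orbn n (\<phi> (inv k) (\<phi> k v)) \<subseteq> orbn n (\<phi> k v)"
    using assms V_inv Nn_carrier subgroup.m_inv_closed[OF Nn_subgroup] by (intro orbn_subset) auto
  then show "orbn n v \<subseteq> orbn n (\<phi> k v)" using assms Nn_carrier by simp
qed (rule orbn_subset[OF assms])

lemma Sn_rep:
  assumes "v \<in> Wn n"
  shows "\<exists>s\<in>Sn n. \<exists>k\<in>Nn n. v = \<phi> k s"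
proof -
  define s where "s = (SOME u. u \<in> orbn n v)"
  have "s \<in> orbn n v" using someI[of "\<lambda>u. u \<in> orbn n v", OF orbn_self[OF Wn_V[OF assms]]] by (simp add: s_def)
  then obtain k where k: "k \<in> Nn n" "s = \<phi> k v" by (auto simp: orbn_def)
  then have "v = \<phi> (inv k) s" using assms Wn_V Nn_carrier by simp
  moreover have "s \<in> Sn n" using assms by (simp add: Sn_def s_def)
  ultimately show ?thesis using k subgroup.m_inv_closed[OF Nn_subgroup] by blast
qed

lemma Sn_orbn:
  assumes "s \<in> Sn n"
  shows "s \<in> Wn n" "s = (SOME u. u \<in> orbn n s)"
proof -
  obtain v where v: "v \<in> Wn n" "s = (SOME u. u \<in> orbn n v)" using assms by (auto simp: Sn_def)
  have "s \<in> orbn n v" using someI[of "\<lambda>u. u \<in> orbn n v", OF orbn_self[OF Wn_V[OF v(1)]]] v by simp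
  then obtain k where k: "k \<in> Nn n" "s = \<phi> k v" by (auto simp: orbn_def)
  show "s \<in> Wn n" using Wn_inv k v by blast
  show "s = (SOME u. u \<in> orbn n s)" using orbn_eq[of v k n] k v Wn_V by simp
qed

lemma Sn_unique:
  assumes "s \<in> Sn n" "s' \<in> Sn n" "k \<in> Nn n" "s = \<phi> k s'"
  shows "s = s'"
  using Sn_orbn[OF assms(1)] Sn_orbn[OF assms(2)] orbn_eq[of s' k n] assms Wn_V by metis

definition Ln :: "nat \<Rightarrow> 'g set option set" where
  "Ln n = insert None (Some ` rot ` (\<Union>m<n. Sn m))"

lemma Sn_V: "s \<in> Sn n \<Longrightarrow> s \<in> V"
  using Sn_orbn Wn_V by blast

lemma Ln_Suc: "Ln (Suc n) = Ln n \<union> Some ` rot ` Sn n"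
  by (auto simp: Ln_def lessThan_Suc)

lemma factor_subgroup: "i \<in> insert None (Some ` rot ` (\<Union>n. Sn n)) \<Longrightarrow> subgroup (adjoin_factor N0 i) G"
  using N0_subgroup rot_subgroup Sn_V by (auto simp: adjoin_factor_def)

lemma Ln_factor_subgroup: "i \<in> Ln n \<Longrightarrow> subgroup (adjoin_factor N0 i) G"
  by (rule factor_subgroup) (auto simp: Ln_def)

context
  assumes stab: "\<And>\<gamma> v. \<lbrakk>\<gamma> \<in> generate G (N0 \<union> \<Union>(rot ` V)); v \<in> V; \<phi> \<gamma> v = v\<rbrakk> \<Longrightarrow> \<gamma> \<in> rot v"
    and free0: "\<And>\<gamma> v. \<lbrakk>\<gamma> \<in> N0; v \<in> V; \<phi> \<gamma> v = v\<rbrakk> \<Longrightarrow> \<gamma> = \<one>"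
    and far: "\<And>v. v \<in> V \<Longrightarrow> \<exists>y\<in>A. a0 + 2 * \<delta> < d y v"
begin

text \<open>By \<open>stab\<close>, a non-trivial \<open>\<gamma>\<close> fixing \<open>v\<close> is
  a rotation and turns \<open>Yn n\<close> away; yet it preserves \<open>Yn n\<close>, which
  \<open>v\<close> sees in one direction. At stage \<open>0\<close> there may be two directions, and
  \<open>free0\<close> is used.\<close>

lemma Nn_free:
  assumes \<gamma>: "\<gamma> \<in> Nn n" and v: "v \<in> Wn n" and fixed: "\<phi> \<gamma> v = v"
  shows "\<gamma> = \<one>"
proof (rule ccontr)
  assume n1: "\<gamma> \<noteq> \<one>"
  have vV: "v \<in> V" using v Wn_V by blast
  then obtain m where m: "n = Suc m" using \<gamma> fixed free0 n1 by (cases n) auto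
  have "\<gamma> \<in> rot v" using stab Nn_in_generate \<gamma> vV fixed by blast
  moreover obtain y where y: "y \<in> Yn n" using A_ne A_Yn by blast
  ultimately have "gp y (\<phi> \<gamma> y) v \<le> 2 * \<delta>" using rot_gp vV n1 Yn_X by blast
  moreover have "10 * \<delta> \<le> gp y (\<phi> \<gamma> y) v"
    using sees_Yn[OF quasi_all, of v m y "\<phi> \<gamma> y"] vV v y Yn_inv[OF \<gamma> y] m by (simp add: Wn_def)
  ultimately show False using delta_pos by simp
qed

text \<open>A word of the next stage is cut at its letters with an index outside
  \<open>Ln n\<close>. The stretches in between have values in \<open>Nn n\<close>; pushing these to
  the right conjugates the new letters into a reduced word of the tree step, to which
  \<open>reduced_not_one\<close> applies.\<close>

lemma word_value_nontrivial:
  "\<lbrakk>w \<in> reduced_words G (Ln n) (adjoin_factor N0); w \<noteq> []\<rbrakk>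
    \<Longrightarrow> word_value G w \<in> Nn n \<and> word_value G w \<noteq> \<one>"
proof (induction n arbitrary: w)
  case 0
  obtain i g w' where w: "w = (i, g) # w'" using 0 by (metis list.exhaust prod.collapse)
  have "i = None" "g \<in> adjoin_factor N0 None" "g \<noteq> \<one>" "w' \<noteq> [] \<longrightarrow> None \<noteq> fst (hd w')"
    "w' \<in> reduced_words G (Ln 0) (adjoin_factor N0)"
    using 0 w by (auto simp: reduced_words_Cons Ln_def)
  moreover have "adjoin_factor N0 None = N0" by (simp add: adjoin_factor_def)
  moreover have "w' = []" using calculation(4,5) by (cases w') (auto simp: reduced_words_Cons Ln_def)
  ultimately show ?case using w Nn_carrier[of _ 0] by simp
next
  case (Suc n)
  interpret T: tree_step X d \<delta> G \<phi> V rot \<sigma> "Nn n" "Yn n" "Wn n" a0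
    by (rule tree_step_all)
  let ?R = "\<lambda>m. reduced_words G (Ln m) (adjoin_factor N0)"
  have lower: "u \<in> ?R n" if "u \<in> ?R (Suc n)" "fst ` set u \<subseteq> Ln n" for u
    using that by (auto simp: reduced_words_def)
  have lower_N: "word_value G u \<in> Nn n" if "u \<in> ?R n" for u
    using Suc.IH[OF that] subgroup.one_closed[OF Nn_subgroup] by (cases "u = []") auto
  note mem = subgroup.m_closed[OF Nn_subgroup]
  have decomp: "\<exists>ws m. T.reduced ws \<and> m \<in> Nn n \<and> word_value G w = wprod ws \<otimes> m \<and>
      (ws = [] \<longrightarrow> fst ` set w \<subseteq> Ln n) \<and>
      (ws \<noteq> [] \<longrightarrow> (\<exists>u i h w' s. w = u @ (i, h) # w' \<and> fst ` set u \<subseteq> Ln n \<and> i = Some (rot s) \<and>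
        s \<in> Sn n \<and> i \<notin> Ln n \<and> fst (hd ws) = \<phi> (word_value G u) s))"
    if "w \<in> ?R (Suc n)" for w
    using that
  proof (induction w rule: length_induct)
    case (1 w)
    show ?case
    proof (cases "fst ` set w \<subseteq> Ln n")
      case True
      then show ?thesis
        using lower_N[OF lower[OF 1(2)]] Nn_carrier by (intro exI[of _ "[]"] exI[of _ "word_value G w"]) auto
    next
      case False
      define u where "u = takeWhile (\<lambda>x. fst x \<in> Ln n) w"
      have "dropWhile (\<lambda>x. fst x \<in> Ln n) w \<noteq> []" using False by (auto simp: dropWhile_eq_Nil_conv)
      then obtain i h w' where dw: "dropWhile (\<lambda>x. fst x \<in> Ln n) w = (i, h) # w'"
        by (metis list.exhaust prod.collapse)
      have i: "i \<notin> Ln n" using hd_dropWhile[of "\<lambda>x. fst x \<in> Ln n" w] dw by auto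
      have w: "w = u @ (i, h) # w'" using dw takeWhile_dropWhile_id u_def by metis
      have uL: "fst ` set u \<subseteq> Ln n" by (auto simp: u_def dest: set_takeWhileD)
      have R: "u \<in> ?R (Suc n)" "(i, h) # w' \<in> ?R (Suc n)" "w' \<in> ?R (Suc n)"
        using 1(2) unfolding w by (auto simp: reduced_words_append reduced_words_Cons)
      have "i \<in> Ln (Suc n)" "h \<in> adjoin_factor N0 i" "h \<noteq> \<one>" using R by (auto simp: reduced_words_Cons)
      then obtain s where s: "i = Some (rot s)" "s \<in> Sn n" "h \<in> rot s" "h \<noteq> \<one>"
        using i by (auto simp: Ln_Suc adjoin_factor_def)
      have sW: "s \<in> Wn n" "s \<in> V" using s Sn_orbn Sn_V by auto
      have hG: "h \<in> carrier G" using s sW rot_carrier by blast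
      define g where "g = word_value G u"
      have g: "g \<in> Nn n" using lower_N lower R uL by (simp add: g_def)
      then have gG: "g \<in> carrier G" using Nn_carrier by blast
      have len: "length w' < length w" using w by simp
      obtain ws m where ws: "T.reduced ws" "m \<in> Nn n" "word_value G w' = wprod ws \<otimes> m"
        and ws': "ws \<noteq> [] \<Longrightarrow> \<exists>u i h w'' s. w' = u @ (i, h) # w'' \<and> fst ` set u \<subseteq> Ln n \<and>
          i = Some (rot s) \<and> s \<in> Sn n \<and> i \<notin> Ln n \<and> fst (hd ws) = \<phi> (word_value G u) s"
        using 1(1)[rule_format, OF len R(3)] by blast
      have mG: "m \<in> carrier G" "wprod ws \<in> carrier G" using ws Nn_carrier T.reduced_is_word by auto
      \<comment> \<open>If neighbouring apices agreed, the stretch \<open>u'\<close> between two new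
        letters would fix \<open>s\<close>, since \<open>Sn n\<close> meets an orbit once. By
        \<open>Nn_free\<close> its value is trivial, so by induction it is empty, and the word would
        not be reduced.\<close>
      have ne: "ws \<noteq> [] \<longrightarrow> s \<noteq> fst (hd ws)"
      proof (intro impI notI)
        assume "ws \<noteq> []" and eq: "s = fst (hd ws)"
        then obtain u' i' h' w'' s' where u': "w' = u' @ (i', h') # w''" "fst ` set u' \<subseteq> Ln n"
          "i' = Some (rot s')" "s' \<in> Sn n" "fst (hd ws) = \<phi> (word_value G u') s'" using ws' by blast
        have u'R: "u' \<in> ?R n" using lower R(3) u' by (simp add: reduced_words_append)
        have "s = s'" using Sn_unique[OF s(2) u'(4) lower_N[OF u'R]] eq u' by simp
        then have "u' \<noteq> []" using R(2) u' s by (auto simp: reduced_words_Cons)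
        then have "word_value G u' \<noteq> \<one>" using Suc.IH u'R by blast
        then show False using Nn_free[OF lower_N[OF u'R] sW(1)] eq u' \<open>s = s'\<close> by simp
      qed
      have red: "T.reduced ((s, h) # ws)" using ws s sW ne by (simp add: T.reduced_Cons)
      define ws2 where "ws2 = conj_word g ((s, h) # ws)"
      have "T.reduced ws2" using T.reduced_conj[OF g red] by (simp add: ws2_def)
      moreover have "word_value G w = wprod ws2 \<otimes> (g \<otimes> m)"
      proof -
        have "word_value G w = g \<otimes> (h \<otimes> (wprod ws \<otimes> m))"
          unfolding w g_def using R ws word_value_append[OF Ln_factor_subgroup R(1,2)] by simp
        also have "\<dots> = wprod ws2 \<otimes> (g \<otimes> m)"
          using T.reduced_is_word[OF red] gG hG mG
          unfolding ws2_def by (simp add: wprod_conj m_assoc inv_mult_cancel del: conj_word_Cons)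
        finally show ?thesis .
      qed
      moreover have "g \<otimes> m \<in> Nn n" using mem g ws by blast
      moreover have "fst (hd ws2) = \<phi> (word_value G u) s" by (simp add: ws2_def g_def)
      moreover have "ws2 \<noteq> []" by (simp add: ws2_def)
      ultimately show ?thesis using w uL s i by (intro exI[of _ ws2] exI[of _ "g \<otimes> m"]) blast
    qed
  qed
  obtain ws m where ws: "T.reduced ws" "m \<in> Nn n" "word_value G w = wprod ws \<otimes> m"
    "ws = [] \<longrightarrow> fst ` set w \<subseteq> Ln n" using decomp[OF Suc.prems(1)] by blast
  have "word_value G w \<in> Nn (Suc n)"
    using ws mem[of _ "Suc n"] T.wprod_in_N'[OF ws(1)] Nn_mono_Suc[of n] by (auto simp: Nn_Suc)
  moreover have "word_value G w \<noteq> \<one>"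
  proof (cases "ws = []")
    case True
    then show ?thesis using Suc.IH[OF lower[OF Suc.prems(1)]] Suc.prems ws by blast
  next
    case False
    show ?thesis
      unfolding ws(3) by (rule T.reduced_not_one[OF ws(1) False ws(2)]) (use far A_Yn Wn_V in blast)
  qed
  ultimately show ?case by simp
qed

lemma windmill_free_product:
  "\<exists>S\<subseteq>V. internal_free_product G (generate G (N0 \<union> \<Union>(rot ` V))) (insert None (Some ` rot ` S)) (adjoin_factor N0)"
proof (intro exI[of _ "\<Union>n. Sn n"] conjI)
  let ?S = "\<Union>n. Sn n" and ?I = "insert None (Some ` rot ` (\<Union>n. Sn n))"
  show SV: "?S \<subseteq> V" using Sn_V by blast
  have U: "(\<Union>i\<in>?I. adjoin_factor N0 i) = N0 \<union> \<Union>(rot ` ?S)" by (auto simp: adjoin_factor_def)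
  have sub: "subgroup (generate G (N0 \<union> \<Union>(rot ` ?S))) G"
    using N0_subgroup subgroup.subset rot_carrier SV by (intro generate_is_subgroup) blast
  have gen: "Nn n \<subseteq> generate G (N0 \<union> \<Union>(rot ` ?S))" for n
  proof (induction n)
    case (Suc n)
    have "h \<in> generate G (N0 \<union> \<Union>(rot ` ?S))" if v: "v \<in> Wn n" and h: "h \<in> rot v" for v h
    proof -
      obtain s k where s: "s \<in> Sn n" "k \<in> Nn n" "v = \<phi> k s" using Sn_rep[OF v] by blast
      have kG: "k \<in> carrier G" and hG: "h \<in> carrier G" using s Nn_carrier h v Wn_V rot_carrier by blast+
      have "inv k \<otimes> h \<otimes> inv (inv k) \<in> rot (\<phi> (inv k) v)" by (rule rot_conj) (use kG v Wn_V h in auto)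
      moreover have "\<phi> (inv k) v = s" using s kG Sn_V by simp
      ultimately have "inv k \<otimes> h \<otimes> k \<in> generate G (N0 \<union> \<Union>(rot ` ?S))"
        using s kG by (intro generate.incl) auto
      then have "k \<otimes> (inv k \<otimes> h \<otimes> k) \<otimes> inv k \<in> generate G (N0 \<union> \<Union>(rot ` ?S))"
        using s Suc subgroup.m_closed[OF sub] subgroup.m_inv_closed[OF sub] by blast
      then show ?thesis using kG hG by (simp add: m_assoc inv_mult_cancel)
    qed
    then show ?case unfolding Nn_Suc using Suc by (intro generate_subgroup_incl[OF _ sub]) blast
  qed (auto intro: generate.incl)
  show "internal_free_product G (generate G (N0 \<union> \<Union>(rot ` V))) ?I (adjoin_factor N0)"
  proof (rule internal_free_productI[OF factor_subgroup])
    show "generate G (N0 \<union> \<Union>(rot ` V)) = generate G (\<Union>i\<in>?I. adjoin_factor N0 i)"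
      unfolding U
    proof
      show "generate G (N0 \<union> \<Union>(rot ` V)) \<subseteq> generate G (N0 \<union> \<Union>(rot ` ?S))" using Nn_exhaust gen by blast
      show "generate G (N0 \<union> \<Union>(rot ` ?S)) \<subseteq> generate G (N0 \<union> \<Union>(rot ` V))"
        by (rule mono_generate) (use SV in blast)
    qed
    fix w assume w: "w \<in> reduced_words G ?I (adjoin_factor N0)" "w \<noteq> []"
    have "\<exists>n. fst ` set w \<subseteq> Ln n"
      using w(1)
    proof (induction w)
      case (Cons x w)
      obtain i h where x: "x = (i, h)" by force
      have "i \<in> ?I" "w \<in> reduced_words G ?I (adjoin_factor N0)" using Cons.prems x by (auto simp: reduced_words_Cons)
      then obtain m n where mn: "i \<in> Ln m" "fst ` set w \<subseteq> Ln n"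
        using Cons.IH by (force simp: Ln_def)
      have "Ln a \<subseteq> Ln b" if "a \<le> b" for a b using that unfolding Ln_def by fastforce
      then have "i \<in> Ln (max m n)" "fst ` set w \<subseteq> Ln (max m n)" using mn by (meson max.cobounded1 max.cobounded2 subset_iff)+
      then show ?case using x by (intro exI[of _ "max m n"]) simp
    qed simp
    then obtain n where "fst ` set w \<subseteq> Ln n" by blast
    then have "w \<in> reduced_words G (Ln n) (adjoin_factor N0)" using w(1) by (auto simp: reduced_words_def)
    then show "word_value G w \<noteq> \<one>" using word_value_nontrivial w(2) by blast
  qed
qed

end

end

section \<open>The axis of a loxodromic coset\<close>

context hyp
begin

lemma gp_change_base: "\<lbrakk>a \<in> X; b \<in> X; p \<in> X; q \<in> X\<rbrakk> \<Longrightarrow> gp a b p \<le> gp a b q + d p q"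
  using gp_eq[of a b p] gp_eq[of a b q] triangle[of a q p] triangle[of b q p] commute[of p q] by linarith

text \<open>One end point of a segment through \<open>y\<close> is behind \<open>y\<close> as seen from \<open>p\<close>.\<close>

lemma behind:
  assumes X: "a \<in> X" "b \<in> X" "y \<in> X" "p \<in> X" and c: "gp a b y \<le> c"
  shows "\<exists>o'\<in>{a, b}. d y p - c - \<delta> \<le> gp y o' p"
proof -
  have "gp a p y \<le> c + \<delta> \<or> gp p b y \<le> c + \<delta>" using hyp4[OF X(1,4,2,3)] c by linarith
  then show ?thesis
    using gp_swap[of y a p] gp_swap[of y b p] gp_commute[of p a y] gp_commute[of p b y] gp_commute[of a p y]
    by (smt (verit) gp_commute insert_iff)
qed

end

context hyp_act
begin

definition orbpt :: "'g \<Rightarrow> 'x \<Rightarrow> int \<Rightarrow> 'x" where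
  "orbpt g z n = \<phi> (g [^] n) z"

context
  fixes g z
  assumes g: "g \<in> carrier G" and z: "z \<in> X"
begin

lemma orbpt_X [simp]: "orbpt g z n \<in> X"
  using g z by (simp add: orbpt_def)

lemma orbpt_0: "orbpt g z 0 = z"
  using z by (simp add: orbpt_def)

lemma act_orbpt: "\<phi> (g [^] (m::int)) (orbpt g z n) = orbpt g z (m + n)"
  using g z by (simp add: orbpt_def int_pow_mult act_mult)

lemma act_orbpt_1: "\<phi> g (orbpt g z n) = orbpt g z (n + 1)"
  using act_orbpt[of 1 n] g by (simp add: int_pow_1 add.commute)

lemma orbpt_1: "orbpt g z 1 = \<phi> g z" "orbpt g z (-1) = \<phi> (inv g) z"
  using g by (simp_all add: orbpt_def int_pow_neg)

lemma orbpt_dist: "d (orbpt g z (m + i)) (orbpt g z (m + j)) = d (orbpt g z i) (orbpt g z j)"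
  using g by (simp flip: act_orbpt)

lemma orbpt_gp: "gp (orbpt g z (m + i)) (orbpt g z (m + j)) (orbpt g z (m + k)) = gp (orbpt g z i) (orbpt g z j) (orbpt g z k)"
  using g by (simp flip: act_orbpt)

context
  fixes a
  assumes turn: "gp (\<phi> (inv g) z) (\<phi> g z) z \<le> a" and long: "2 * a + 6 * \<delta> \<le> d z (\<phi> g z)"
begin

lemma orbpt_turn: "gp (orbpt g z (n - 1)) (orbpt g z (n + 1)) (orbpt g z n) \<le> a"
  using orbpt_gp[of n "-1" 1 0] turn by (simp add: orbpt_1 orbpt_0)

lemma orbpt_step: "d (orbpt g z n) (orbpt g z (n + 1)) = d z (\<phi> g z)"
  using orbpt_dist[of n 0 1] by (simp add: orbpt_1 orbpt_0)

lemma orbit_gp: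
  assumes "i < j" "j < k"
  shows "gp (orbpt g z i) (orbpt g z k) (orbpt g z j) \<le> a + 2 * \<delta>"
proof -
  define c where "c n = orbpt g z (i + int n)" for n
  have "gp (c 0) (c (nat (k - i))) (c (nat (j - i))) \<le> a + 2 * \<delta>"
  proof (rule chain_gp[where n = "nat (k - i)"])
    show "gp (c (n - 1)) (c (n + 1)) (c n) \<le> a" if "0 < n" "n < nat (k - i)" for n
      using orbpt_turn[of "i + int n"] that by (simp add: c_def of_nat_diff algebra_simps)
    show "2 * a + 6 * \<delta> \<le> d (c n) (c (n + 1))" if "0 < n" "n + 1 < nat (k - i)" for n
      using orbpt_step[of "i + int n"] long by (simp add: c_def algebra_simps)
  qed (use assms in \<open>auto simp: c_def\<close>)
  then show ?thesis using assms by (simp add: c_def)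
qed

lemma orbit_near:
  assumes "i < k" "p \<in> X"
  shows "\<exists>m. gp (orbpt g z m) (orbpt g z (m + 1)) p \<le> gp (orbpt g z i) (orbpt g z k) p + 2 * \<delta>"
proof -
  define c where "c n = orbpt g z (i + int n)" for n
  have "\<exists>m<nat (k - i). gp (c m) (c (m + 1)) p \<le> gp (c 0) (c (nat (k - i))) p + 2 * \<delta>"
  proof (rule chain_near[where n = "nat (k - i)"])
    show "gp (c (n - 1)) (c (n + 1)) (c n) \<le> a" if "0 < n" "n < nat (k - i)" for n
      using orbpt_turn[of "i + int n"] that by (simp add: c_def of_nat_diff algebra_simps)
    show "2 * a + 6 * \<delta> \<le> d (c n) (c (n + 1))" if "0 < n" "n + 1 < nat (k - i)" for n
      using orbpt_step[of "i + int n"] long by (simp add: c_def algebra_simps)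
  qed (use assms in \<open>auto simp: c_def\<close>)
  then obtain m where "gp (c m) (c (m + 1)) p \<le> gp (c 0) (c (nat (k - i))) p + 2 * \<delta>" by blast
  then show ?thesis using assms by (intro exI[of _ "i + int m"]) (simp add: c_def algebra_simps)
qed

end

end

text \<open>
  A point whose displacement is almost minimal does not turn back: otherwise the midpoint of
  \<open>z\<close> and \<open>\<phi> g z\<close> would be displaced by less.
\<close>

lemma min_displacement_turn:
  assumes g: "g \<in> carrier G" and z: "z \<in> X" and l: "\<And>q. q \<in> X \<Longrightarrow> l \<le> d q (\<phi> g q)"
    and c: "d z (\<phi> g z) \<le> l + c" "c + 6 * \<delta> < d z (\<phi> g z)"
  shows "gp (\<phi> (inv g) z) (\<phi> g z) z \<le> (c + \<delta>) / 2 + 2 * \<delta>"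
proof -
  define D where "D = d z (\<phi> g z)"
  have gz: "\<phi> g z \<in> X" "\<phi> (inv g) z \<in> X" using g z by auto
  obtain m where m: "m \<in> X" "d z m = D / 2" "d m (\<phi> g z) \<le> D - D / 2 + \<delta>"
    using almost_between[of z "\<phi> g z" "D / 2" \<delta>] z gz delta_pos by (auto simp: D_def)
  \<comment> \<open>\<open>n\<close> is the midpoint of the preceding segment and \<open>g\<close>
    moves it to \<open>m\<close>, so \<open>d n m\<close> is at least \<open>l\<close>. If the orbit
    turned back at \<open>z\<close>, the two midpoints would nearly coincide.\<close>
  define n where "n = \<phi> (inv g) m"
  have n: "n \<in> X" using m g by (simp add: n_def)
  have nz: "d n z = d m (\<phi> g z)" using act_dist_inv[of g m z] g m z by (simp add: n_def)
  have ngz: "d n (\<phi> (inv g) z) = D / 2" using m g z commute[of m z] by (simp add: n_def)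
  have zgz: "d z (\<phi> (inv g) z) = D" using act_dist_inv[of g z z] g z commute by (simp add: D_def)
  have "l \<le> d n m" using l[OF n] g m by (simp add: n_def)
  moreover have "D / 2 \<le> d m (\<phi> g z)" using triangle[of z m "\<phi> g z"] z gz m by (simp add: D_def)
  ultimately have 1: "gp n m z \<le> (c + \<delta>) / 2"
    using gp_eq[of n m z] nz m c commute[of m z] by (simp add: D_def)
  have 2: "(D - \<delta>) / 2 \<le> gp m (\<phi> g z) z"
    using gp_eq[of m "\<phi> g z" z] m commute[of m z] commute[of "\<phi> g z" z] by (simp add: D_def)
  have 3: "D / 2 \<le> gp (\<phi> (inv g) z) n z"
    using gp_eq[of "\<phi> (inv g) z" n z] ngz zgz nz commute[of n "\<phi> (inv g) z"] commute[of z "\<phi> (inv g) z"]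
      \<open>D / 2 \<le> d m (\<phi> g z)\<close> by simp
  define e r where "e = (c + \<delta>) / 2" and "r = (D - \<delta>) / 2"
  \<comment> \<open>This is \<open>c + 6 * \<delta> < D\<close> rewritten; it leaves only the middle
    product as the minimum in \<open>hyp5\<close>.\<close>
  have "e + 2 * \<delta> < r" using c(2) by (simp add: D_def e_def r_def field_simps)
  moreover have "gp n m z \<le> e" "r \<le> gp m (\<phi> g z) z" "r \<le> gp (\<phi> (inv g) z) n z"
    using 1 2 3 delta_pos by (simp_all add: e_def r_def field_simps)
  ultimately have "gp (\<phi> (inv g) z) (\<phi> g z) z \<le> e + 2 * \<delta>"
    using hyp5[OF n gz(2,1) m(1) z] gp_commute[of "\<phi> (inv g) z" n z] gp_commute[of m "\<phi> g z" z]
    by linarith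
  then show ?thesis by (simp add: e_def)
qed

lemma displacement_near_segment:
  assumes g: "g \<in> carrier G" and X: "a \<in> X" "b \<in> X" "p \<in> X"
    and D: "d a (\<phi> g a) \<le> D" "d b (\<phi> g b) \<le> D" and c: "gp a b p \<le> c"
  shows "d p (\<phi> g p) \<le> D + 2 * c + 2 * \<delta>"
proof -
  have gX: "\<phi> g p \<in> X" "\<phi> g a \<in> X" "\<phi> g b \<in> X" using g X by auto
  have "d (\<phi> g p) b \<le> d p b + D" "d (\<phi> g p) a \<le> d p a + D"
    using triangle[of "\<phi> g p" "\<phi> g b" b] triangle[of "\<phi> g p" "\<phi> g a" a] gX X D g commute[of "\<phi> g a" a] commute[of "\<phi> g b" b] by auto
  then show ?thesis
    using four_point[OF X(3) X(1) gX(1) X(2)] gp_eq[of a b p] c commute[of p a] commute[of p b]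
      commute[of a "\<phi> g p"] commute[of "\<phi> g p" b] by linarith
qed

end

section \<open>Powers of a coset with linear growth modulo \<open>K\<close>\<close>

context rot_fam
begin

lemma K_normal: "K \<lhd> G"
proof (rule normal_generateI[OF rots_carrier])
  fix h g assume "h \<in> \<Union>(rot ` V)" "g \<in> carrier G"
  then show "g \<otimes> h \<otimes> inv g \<in> \<Union>(rot ` V)" using rot_conj V_inv by blast
qed

context
  fixes C :: "'g set"
  assumes C: "C \<in> carrier (G Mod K)"
    and lox: "\<And>g x. \<lbrakk>g \<in> C; x \<in> X\<rbrakk> \<Longrightarrow> \<exists>c>0. \<exists>B. \<forall>n::int. \<forall>k\<in>K. c * real_of_int \<bar>n\<bar> - B \<le> d x (\<phi> (k \<otimes> g [^] n) x)"
begin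

lemma C_carrier: "g \<in> C \<Longrightarrow> g \<in> carrier G"
  using C K_subgroup by (auto simp: carrier_FactGroup r_coset_def K_carrier)

lemma C_coset: "g \<in> C \<Longrightarrow> C = K #> g"
  using C repr_independence[OF _ _ K_subgroup] by (auto simp: carrier_FactGroup)

lemma C_mult: "\<lbrakk>g \<in> C; h \<in> K\<rbrakk> \<Longrightarrow> h \<otimes> g \<in> C"
  using C_coset by (auto simp: r_coset_def)

lemma coset_hom: "group_hom G (G Mod K) (\<lambda>x. K #> x)"
proof -
  interpret N: normal K G by (rule K_normal)
  show ?thesis
    by (intro group_hom.intro group_hom_axioms.intro homI)
      (auto simp: N.factorgroup_is_group N.rcos_sum carrier_FactGroup group_axioms)
qed

lemma coset_mem: "\<lbrakk>x \<in> carrier G; y \<in> carrier G; K #> x = K #> y\<rbrakk> \<Longrightarrow> \<exists>k\<in>K. x = k \<otimes> y"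
  using rcos_self[OF _ K_subgroup] by (fastforce simp: r_coset_def)

text \<open>The power \<open>m\<close> of \<open>k \<otimes> g [^] n\<close> lies in the coset of
  \<open>g [^] (n * m)\<close>. If the element fixes \<open>v\<close>, so do its powers, against
  linear growth modulo \<open>K\<close> unless \<open>n = 0\<close>.\<close>

lemma fixing_power:
  assumes g: "g \<in> C" and k: "k \<in> K" and v: "v \<in> V" and fixed: "\<phi> (k \<otimes> g [^] (n::int)) v = v"
  shows "n = 0"
proof (rule ccontr)
  assume n: "n \<noteq> 0"
  interpret H: group_hom G "G Mod K" "\<lambda>x. K #> x" by (rule coset_hom)
  have G: "g \<in> carrier G" "k \<in> carrier G" using g k C_carrier K_carrier by auto
  define E where "E = k \<otimes> g [^] n"
  have E: "E \<in> carrier G" using G by (simp add: E_def)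
  have "(K #> k) #> g [^] n = K #> E"
    unfolding E_def by (rule coset_mult_assoc) (use K_carrier G in auto)
  then have "K #> E = K #> (g [^] n)" unfolding coset_join2[OF G(2) K_subgroup k] by simp
  then have pow: "K #> (E [^] (m::int)) = K #> (g [^] (n * m))" for m
    using E G by (simp add: H.hom_int_pow int_pow_pow[symmetric])
  have fixE: "\<phi> (E [^] (int m)) v = v" for m
  proof (induction m)
    case (Suc m)
    have "E [^] (int (Suc m)) = E [^] (int m) \<otimes> E" by (simp only: int_pow_int nat_pow_Suc)
    then show ?case using Suc E v fixed by (simp add: act_mult E_def)
  qed (use v in simp)
  obtain c B where c: "c > 0" "\<And>n k. k \<in> K \<Longrightarrow> c * real_of_int \<bar>n\<bar> - B \<le> d v (\<phi> (k \<otimes> g [^] n) v)"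
    using lox[OF g, of v] v by auto
  obtain m where m: "B < real m * c" using reals_Archimedean3[OF c(1)] by blast
  obtain k' where k': "k' \<in> K" "E [^] (int m) = k' \<otimes> g [^] (n * int m)"
    using coset_mem[OF _ _ pow] E G by blast
  have "c * real_of_int \<bar>n * int m\<bar> - B \<le> d v (\<phi> (k' \<otimes> g [^] (n * int m)) v)"
    using c(2) k'(1) by blast
  also have "\<dots> = 0" using fixE[of m] k'(2) v by simp
  finally have "c * real_of_int \<bar>n * int m\<bar> \<le> B" by simp
  moreover have "1 \<le> \<bar>n\<bar>" using n by linarith
  then have "int m \<le> \<bar>n * int m\<bar>" by (simp add: abs_mult mult_le_cancel_right1)
  then have "real m \<le> real_of_int \<bar>n * int m\<bar>" by linarith
  then have "c * real m \<le> c * real_of_int \<bar>n * int m\<bar>" using c(1) by simp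
  ultimately show False using m by (simp add: mult.commute)
qed

lemma generate_power_form:
  assumes g: "g \<in> C" and x: "x \<in> generate G (generate G {g} \<union> \<Union>(rot ` V))"
  shows "\<exists>k\<in>K. \<exists>n::int. x = k \<otimes> g [^] n"
proof -
  interpret H: group_hom G "G Mod K" "\<lambda>x. K #> x" by (rule coset_hom)
  have G: "g \<in> carrier G" using g C_carrier by auto
  have gen: "generate G {g} \<union> \<Union>(rot ` V) \<subseteq> carrier G"
    using generate_in_carrier[of "{g}"] G rots_carrier by blast
  have "x \<in> carrier G \<and> (\<exists>n::int. K #> x = K #> (g [^] n))"
    using x
  proof (induction rule: generate.induct)
    case one
    then show ?case using int_pow_0[of G g] by (metis one_closed)
  next
    case (incl h)
    then show ?case
    proof (cases "h \<in> generate G {g}")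
      case True
      then show ?thesis using generate_pow[OF G] G by auto
    next
      case False
      then have "h \<in> K" using incl rot_K by auto
      then show ?thesis
        using coset_join2[of h K] coset_join2[of \<one> K] K_subgroup K_carrier K_one int_pow_0[of G g] by metis
    qed
  next
    case (inv h)
    then show ?case
    proof (cases "h \<in> generate G {g}")
      case True
      then have "inv h \<in> generate G {g}" using generate_m_inv_closed[of "{g}" h] G by simp
      then show ?thesis using generate_pow[OF G] G by auto
    next
      case False
      then have "inv h \<in> K" using inv rot_K K_inv by auto
      then show ?thesis
        using coset_join2[of "inv h" K] coset_join2[of \<one> K] K_subgroup K_carrier K_one int_pow_0[of G g] by metis
    qed
  next
    case (eng h1 h2)
    then obtain m n :: int where mn: "K #> h1 = K #> (g [^] m)" "K #> h2 = K #> (g [^] n)"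
      "h1 \<in> carrier G" "h2 \<in> carrier G" by blast
    have "K #> (h1 \<otimes> h2) = K #> (g [^] (m + n))"
      using mn H.hom_mult[of h1 h2] H.hom_mult[of "g [^] m" "g [^] n"] G by (simp add: int_pow_mult)
    then show ?case using mn by auto
  qed
  then show ?thesis using coset_mem[of x] G int_pow_closed by blast
qed

lemma generate_eq:
  assumes g: "g \<in> C"
  shows "generate G (generate G {g} \<union> \<Union>(rot ` V)) = generate G (insert g K)"
proof
  have G: "g \<in> carrier G" using g C_carrier by auto
  have s1: "insert g K \<subseteq> carrier G" using G K_carrier by blast
  have s2: "generate G {g} \<union> \<Union>(rot ` V) \<subseteq> carrier G"
    using generate_in_carrier[of "{g}"] G rots_carrier by blast
  show "generate G (generate G {g} \<union> \<Union>(rot ` V)) \<subseteq> generate G (insert g K)"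
  proof (rule generate_subgroup_incl[OF _ generate_is_subgroup[OF s1]])
    have "generate G {g} \<subseteq> generate G (insert g K)" by (rule mono_generate) simp
    moreover have "\<Union>(rot ` V) \<subseteq> generate G (insert g K)" using rot_K by (auto intro: generate.incl)
    ultimately show "generate G {g} \<union> \<Union>(rot ` V) \<subseteq> generate G (insert g K)" by blast
  qed
  show "generate G (insert g K) \<subseteq> generate G (generate G {g} \<union> \<Union>(rot ` V))"
  proof (rule generate_subgroup_incl[OF _ generate_is_subgroup[OF s2]])
    have "K \<subseteq> generate G (generate G {g} \<union> \<Union>(rot ` V))" by (rule mono_generate) simp
    then show "insert g K \<subseteq> generate G (generate G {g} \<union> \<Union>(rot ` V))"
      by (auto intro: generate.incl)
  qed
qed

section \<open>The hull of an almost minimal orbit and the apices close to it\<close>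

context
  fixes l g x
  assumes l: "\<And>g q. \<lbrakk>g \<in> C; q \<in> X\<rbrakk> \<Longrightarrow> l \<le> d q (\<phi> g q)"
    and g: "g \<in> C" and x: "x \<in> X" and gx: "d x (\<phi> g x) \<le> l + \<delta>"
begin

abbreviation "pt \<equiv> orbpt g x"

text \<open>All pairs of orbit points are allowed, so that quasi-convexity holds before anything is
  known about the displacement of \<open>x\<close>.\<close>

definition axis :: "'x set" where
  "axis = {z \<in> X. \<exists>i j. gp (pt i) (pt j) z \<le> \<delta>}"

definition axis_apices :: "'x set" where
  "axis_apices = {v \<in> V. \<exists>y\<in>axis. d v y < 24 * \<delta>}"

lemma gG: "g \<in> carrier G"
  using g C_carrier by blast

lemma pt_X [simp]: "pt i \<in> X"
  using gG x by simp

lemma pt_axis: "pt i \<in> axis"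
  using delta_pos unfolding axis_def by (intro CollectI conjI exI[of _ i]) auto

lemma pow_gp: "\<lbrakk>a \<in> X; b \<in> X; c \<in> X\<rbrakk> \<Longrightarrow> gp (\<phi> (g [^] (n::int)) a) (\<phi> (g [^] n) b) (\<phi> (g [^] n) c) = gp a b c"
  using gG by simp

lemma axis_inv: "y \<in> axis \<Longrightarrow> \<phi> (g [^] (n::int)) y \<in> axis"
proof -
  assume y: "y \<in> axis"
  then obtain i j where ij: "y \<in> X" "gp (pt i) (pt j) y \<le> \<delta>" by (auto simp: axis_def)
  then have "gp (pt (n + i)) (pt (n + j)) (\<phi> (g [^] n) y) \<le> \<delta>"
    using gG x pow_gp[of "pt i" "pt j" y n] by (simp add: act_orbpt)
  then show ?thesis
    using gG ij unfolding axis_def by (intro CollectI conjI exI[of _ "n + i"] exI[of _ "n + j"]) auto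
qed

lemma axis_near: "s \<in> axis \<union> axis_apices \<Longrightarrow> s \<in> X \<and> (\<exists>i j. gp (pt i) (pt j) s \<le> 25 * \<delta>)"
proof (cases "s \<in> axis")
  case True
  then obtain i j where "s \<in> X" "gp (pt i) (pt j) s \<le> \<delta>" by (auto simp: axis_def)
  then show ?thesis using delta_pos by (intro conjI exI[of _ i] exI[of _ j]) auto
next
  case False
  assume "s \<in> axis \<union> axis_apices"
  then obtain y where y: "s \<in> X" "y \<in> axis" "d s y < 24 * \<delta>" using False by (auto simp: axis_apices_def)
  then obtain i j where ij: "y \<in> X" "gp (pt i) (pt j) y \<le> \<delta>" by (auto simp: axis_def)
  then have "gp (pt i) (pt j) s \<le> 25 * \<delta>" using gp_change_base[of "pt i" "pt j" s y] y by simp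
  then show ?thesis using y by blast
qed

text \<open>Behind each of \<open>y\<close>, \<open>y'\<close>, as seen from \<open>p\<close>, there
  is an orbit point. Hence \<open>y\<close> or \<open>y'\<close> is itself close to
  \<open>p\<close>, or \<open>p\<close> is close to the segment of the two orbit points, whose
  \<open>triangle_center\<close> lies in the hull.\<close>

lemma axis_quasiconvex:
  assumes y: "y \<in> axis" "y' \<in> axis" and p: "p \<in> X"
  shows "\<exists>z\<in>axis. d p z \<le> gp y y' p + 6 * \<delta>"
proof -
  define t where "t = gp y y' p"
  have X: "y \<in> X" "y' \<in> X" using y by (auto simp: axis_def)
  have dir: "\<exists>i. d s p - 2 * \<delta> \<le> gp s (pt i) p" if "s \<in> axis" for s
  proof -
    obtain i j where ij: "s \<in> X" "gp (pt i) (pt j) s \<le> \<delta>" using \<open>s \<in> axis\<close> by (auto simp: axis_def)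
    then show ?thesis using behind[of "pt i" "pt j" s p \<delta>] p by auto
  qed
  obtain i j where i: "d y p - 2 * \<delta> \<le> gp y (pt i) p" and j: "d y' p - 2 * \<delta> \<le> gp y' (pt j) p"
    using dir y by blast
  consider "gp y (pt i) p \<le> t + 2 * \<delta>" | "gp (pt i) (pt j) p \<le> t + 2 * \<delta>" | "gp y' (pt j) p \<le> t + 2 * \<delta>"
    using hyp5[of y "pt i" "pt j" y' p] X p gp_commute[of "pt j" y'] unfolding t_def by fastforce
  then show ?thesis
  proof cases
    case 1
    then show ?thesis using i y commute[of y p] delta_pos by (intro bexI[of _ y]) (auto simp: t_def)
  next
    case 2
    obtain z where z: "z \<in> X" "gp (pt i) (pt j) z \<le> \<delta>" "d p z \<le> gp (pt i) (pt j) p + 3 * \<delta>"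
      using triangle_center[of "pt i" "pt j" p] p by auto
    then have "z \<in> axis" by (auto simp: axis_def)
    then show ?thesis using z 2 delta_pos by (intro bexI[of _ z]) (auto simp: t_def)
  next
    case 3
    then show ?thesis using j y commute[of y' p] delta_pos by (intro bexI[of _ y']) (auto simp: t_def)
  qed
qed

context
  fixes v h
  assumes v: "v \<in> axis_apices" and h: "h \<in> rot v" "h \<noteq> \<one>"
begin

lemma vV: "v \<in> V" "v \<in> X"
  using v by (auto simp: axis_apices_def)

lemma hG: "h \<in> carrier G" "\<phi> h v = v"
  using h vV rot_carrier rot_fix by blast+

abbreviation "vt \<equiv> orbpt g v"

text \<open>\<open>v\<close> is 25 \<delta>-close to a segment of orbit points, all displaced
  equally, whence 2 * 25 \<delta> + 2 \<delta>. But \<open>g\<close> moves \<open>v\<close> to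
  another apex, at distance at least \<sigma>: the mere presence of \<open>v\<close> makes the
  displacement of \<open>x\<close> large.\<close>

lemma v_disp: "d v (\<phi> g v) \<le> d x (\<phi> g x) + 52 * \<delta>" "\<sigma> \<le> d v (\<phi> g v)"
proof -
  obtain i j where ij: "gp (pt i) (pt j) v \<le> 25 * \<delta>" using axis_near v by blast
  have "d (pt i) (\<phi> g (pt i)) = d x (\<phi> g x)" for i
    using orbpt_dist[OF gG x, of i 0 1] gG x by (simp add: act_orbpt_1 orbpt_0 orbpt_1)
  then show "d v (\<phi> g v) \<le> d x (\<phi> g x) + 52 * \<delta>"
    using displacement_near_segment[OF gG _ _ vV(2), of "pt i" "pt j" "d x (\<phi> g x)" "25 * \<delta>"] ij by simp
  have "\<phi> g v \<noteq> v" using fixing_power[OF g K_one vV(1), of 1] gG vV by auto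
  then show "\<sigma> \<le> d v (\<phi> g v)" using sep[of v "\<phi> g v"] V_inv gG vV by auto
qed

lemma x_turn: "gp (\<phi> (inv g) x) (\<phi> g x) x \<le> 3 * \<delta>" "2 * (3 * \<delta>) + 6 * \<delta> \<le> d x (\<phi> g x)"
proof -
  show "gp (\<phi> (inv g) x) (\<phi> g x) x \<le> 3 * \<delta>"
    using min_displacement_turn[OF gG x l[OF g] gx] v_disp sigma delta_pos by simp
  show "2 * (3 * \<delta>) + 6 * \<delta> \<le> d x (\<phi> g x)" using v_disp sigma delta_pos by simp
qed

text \<open>Minimality also applies to \<open>k \<otimes> g\<close>, which lies in the same coset.
  As \<open>k\<close> fixes \<open>v\<close>, it displaces \<open>v\<close> as far as
  \<open>g\<close> does and has the same preimage of \<open>v\<close>. That displacement is at most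
  \<open>l + 53 * \<delta>\<close>, and (53 + 1) / 2 + 2 = 29.\<close>

lemma v_turn: "k \<in> rot v \<Longrightarrow> gp (\<phi> (inv g) v) (\<phi> k (\<phi> g v)) v \<le> 29 * \<delta>"
proof -
  assume k: "k \<in> rot v"
  then have kG: "k \<in> carrier G" "\<phi> k v = v" using vV rot_carrier rot_fix by blast+
  then have ikv: "\<phi> (inv k) v = v" using act_inv[of k v] vV by simp
  define g1 where "g1 = k \<otimes> g"
  have g1: "g1 \<in> C" "g1 \<in> carrier G" using C_mult g rot_K k vV C_carrier by (auto simp: g1_def)
  have g1v: "\<phi> g1 v = \<phi> k (\<phi> g v)" using kG gG vV by (simp add: g1_def act_mult)
  have ig1v: "\<phi> (inv g1) v = \<phi> (inv g) v" using kG gG vV ikv by (simp add: g1_def act_mult inv_mult_group)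
  have "d v (\<phi> g1 v) = d v (\<phi> g v)" using act_dist[of k v "\<phi> g v"] kG gG vV g1v by simp
  then have "gp (\<phi> (inv g1) v) (\<phi> g1 v) v \<le> (53 * \<delta> + \<delta>) / 2 + 2 * \<delta>"
    using min_displacement_turn[OF g1(2) vV(2) l[OF g1(1)], of "53 * \<delta>"] v_disp gx sigma delta_pos by simp
  then show ?thesis using g1v ig1v by simp
qed

lemma v_turn_1: "gp (\<phi> (inv g) v) (\<phi> g v) v \<le> 29 * \<delta>" "2 * (29 * \<delta>) + 6 * \<delta> \<le> d v (\<phi> g v)"
  using v_turn[OF subgroup.one_closed[OF rot_subgroup]] vV gG v_disp sigma delta_pos by auto

text \<open>By equivariance one orbit point is enough: \<open>f\<close>, at the junction of the
  segment close to \<open>v\<close> and its translate close to \<open>\<phi> g v\<close>. The orbit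
  of \<open>x\<close> hardly turns there, so \<open>f\<close> is close to the segment from
  \<open>v\<close> to \<open>\<phi> g v\<close>, or one of these two apices is within 5 \<delta> +
  27 \<delta> of \<open>f\<close>.\<close>

lemma pt_near_vt: "\<exists>m0. \<forall>i. gp (vt (i - m0 - 1)) (vt (i - m0)) (pt i) \<le> 32 * \<delta>"
proof -
  obtain i j where ij: "gp (pt i) (pt j) v \<le> 25 * \<delta>" using axis_near v by blast
  have "\<exists>m. gp (pt m) (pt (m + 1)) v \<le> 27 * \<delta>"
  proof (cases i j rule: linorder_cases)
    case less
    obtain m where "gp (pt m) (pt (m + 1)) v \<le> gp (pt i) (pt j) v + 2 * \<delta>"
      using orbit_near[OF gG x x_turn less vV(2)] by blast
    then show ?thesis using ij by (intro exI[of _ m]) simp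
  next
    case equal
    then have "d (pt i) v \<le> 25 * \<delta>" using ij by simp
    then show ?thesis using gp_le[of "pt i" "pt (i + 1)" v] vV delta_pos by (intro exI[of _ i]) simp
  next
    case greater
    obtain m where "gp (pt m) (pt (m + 1)) v \<le> gp (pt j) (pt i) v + 2 * \<delta>"
      using orbit_near[OF gG x x_turn greater vV(2)] by blast
    then show ?thesis using ij gp_commute[of "pt i" "pt j" v] by (intro exI[of _ m]) simp
  qed
  then obtain m where m: "gp (pt m) (pt (m + 1)) v \<le> 27 * \<delta>" by blast
  define e f f' where "e = pt m" and "f = pt (m + 1)" and "f' = pt (m + 2)"
  have X: "e \<in> X" "f \<in> X" "f' \<in> X" "\<phi> g v \<in> X" using gG vV by (auto simp: e_def f_def f'_def)
  have "gp f f' (\<phi> g v) \<le> 27 * \<delta>"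
    using m act_gp[of g "pt m" "pt (m + 1)" v] gG x vV by (simp add: f_def f'_def act_orbpt_1 add.commute)
  moreover have "gp e f' f \<le> 3 * \<delta>"
    using orbpt_turn[OF gG x x_turn, of "m + 1"] by (simp add: e_def f_def f'_def add.commute)
  moreover have "gp e f v \<le> 27 * \<delta>" using m by (simp add: e_def f_def)
  ultimately have f: "gp v (\<phi> g v) f \<le> 32 * \<delta>"
    using hyp5[OF X(1) vV(2) X(4,3,2)] gp_swap[of v e f] gp_commute[of e f v] gp_commute[of e v f]
      gp_swap[of "\<phi> g v" f' f] gp_commute[of f f' "\<phi> g v"] gp_le[OF vV(2) X(4,2)] gp_le'[OF vV(2) X(4,2)]
      gp_commute[of f e v] gp_commute[of f' f "\<phi> g v"] delta_pos
    by linarith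
  have "gp (vt (i - (m + 1))) (vt (i - (m + 1) + 1)) (pt i) \<le> 32 * \<delta>" for i
    using f pow_gp[of v "\<phi> g v" f "i - (m + 1)"] X vV gG act_orbpt[OF gG x, of "i - (m + 1)" "m + 1"]
      act_orbpt[OF gG vV(2), of "i - (m + 1)" 0] act_orbpt[OF gG vV(2), of "i - (m + 1)" 1]
    by (simp add: f_def orbpt_0 orbpt_1)
  then show ?thesis by (intro exI[of _ m]) (simp add: algebra_simps)
qed

text \<open>The orbit of \<open>v\<close> is itself a chain with turns at most 29 \<delta>, so from
  \<open>v\<close> it is seen in two directions only, with a loss of 29 \<delta> + 2
  \<delta>.\<close>

lemma dir_vt:
  assumes T: "m \<noteq> 0"
  shows "\<exists>w\<in>{\<phi> g v, \<phi> (inv g) v}. \<sigma> - 31 * \<delta> \<le> gp (vt m) w v"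
proof -
  note orb = orbit_gp[OF gG vV(2) v_turn_1]
  have X: "\<phi> g v \<in> X" "\<phi> (inv g) v \<in> X" "vt m \<in> X" using gG vV by auto
  show ?thesis
  proof (cases "m > 0")
    case True
    have "gp v (vt m) (\<phi> g v) \<le> 31 * \<delta>"
    proof (cases "m = 1")
      case True
      then show ?thesis using X vV delta_pos gG by (simp add: orbpt_1)
    next
      case False
      then show ?thesis using orb[of 0 1 m] \<open>m > 0\<close> vV gG by (simp add: orbpt_0 orbpt_1)
    qed
    then show ?thesis
      using gp_swap[of v "vt m" "\<phi> g v"] gp_commute[of "vt m" "\<phi> g v"] v_disp(2) by (intro bexI[of _ "\<phi> g v"]) auto
  next
    case False
    have "gp v (vt m) (\<phi> (inv g) v) \<le> 31 * \<delta>"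
    proof (cases "m = -1")
      case True
      then show ?thesis using X vV delta_pos gG by (simp add: orbpt_1)
    next
      case False
      then show ?thesis using orb[of m "-1" 0] \<open>\<not> m > 0\<close> T vV gG by (simp add: orbpt_0 orbpt_1 gp_commute)
    qed
    moreover have "d v (\<phi> (inv g) v) = d v (\<phi> g v)" using act_dist_inv[of g v v] gG vV commute by simp
    ultimately show ?thesis
      using gp_swap[of v "vt m" "\<phi> (inv g) v"] gp_commute[of "vt m" "\<phi> (inv g) v"] v_disp(2)
      by (intro bexI[of _ "\<phi> (inv g) v"]) auto
  qed
qed

lemma dir_turn:
  assumes "w \<in> {\<phi> g v, \<phi> (inv g) v}" "w' \<in> {\<phi> g v, \<phi> (inv g) v}"
  shows "gp w (\<phi> h w') v \<le> 29 * \<delta>"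
proof -
  have X: "\<phi> g v \<in> X" "\<phi> (inv g) v \<in> X" using gG vV by auto
  have ih: "inv h \<in> rot v" using subgroup.m_inv_closed[OF rot_subgroup] h vV by blast
  have ihv: "\<phi> (inv h) v = v" using rot_fix ih vV by blast
  consider "w = w'" | "w = \<phi> (inv g) v" "w' = \<phi> g v" | "w = \<phi> g v" "w' = \<phi> (inv g) v" using assms by auto
  then show ?thesis
  proof cases
    case 1
    then show ?thesis using rot_gp[OF vV(1) h, of w] assms X delta_pos by auto
  next
    case 2
    then show ?thesis using v_turn[OF h(1)] by simp
  next
    case 3
    have "gp (\<phi> g v) (\<phi> h (\<phi> (inv g) v)) v = gp (\<phi> (inv h) (\<phi> g v)) (\<phi> (inv g) v) v"
      using act_gp[of "inv h" "\<phi> g v" "\<phi> h (\<phi> (inv g) v)" v] X hG ihv vV by simp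
    then show ?thesis using 3 v_turn[OF ih] gp_commute by simp
  qed
qed

text \<open>
  Seen from \<open>v\<close>, each point near the axis lies in the direction of an orbit point of \<open>x\<close>, that one
  in the direction of an orbit point of \<open>v\<close>, and the latter in the direction of a neighbour of \<open>v\<close>
  in its orbit; so it is enough to bound the turn between these two neighbours.
\<close>

lemma axis_turn:
  assumes s: "s \<in> axis \<union> (axis_apices - {v})" "s' \<in> axis \<union> (axis_apices - {v})"
  shows "gp s (\<phi> h s') v \<le> 100 * \<delta>"
proof (rule ccontr)
  assume "\<not> ?thesis"
  then have T: "100 * \<delta> < gp s (\<phi> h s') v" by simp
  have X: "s \<in> X" "s' \<in> X" "\<phi> h s' \<in> X" using axis_near s hG by auto
  have hd: "d (\<phi> h s') v = d s' v" if "s' \<in> X" for s' using act_dist[of h s' v] hG vV that by simp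
  have h_gp: "gp (\<phi> h a) (\<phi> h b) v = gp a b v" if "a \<in> X" "b \<in> X" for a b
    using act_gp[of h a b v] hG vV that by simp
  have dir1: "\<exists>i. d s v - 26 * \<delta> \<le> gp s (pt i) v" if s: "s \<in> axis \<union> axis_apices" for s
  proof -
    obtain i j where ij: "s \<in> X" "gp (pt i) (pt j) s \<le> 25 * \<delta>" using axis_near[OF s] by blast
    then show ?thesis using behind[of "pt i" "pt j" s v "25 * \<delta>"] vV by auto
  qed
  have dir2: "\<exists>m. d (pt i) v - 33 * \<delta> \<le> gp (pt i) (vt m) v" for i
  proof -
    obtain m0 where "gp (vt (i - m0 - 1)) (vt (i - m0)) (pt i) \<le> 32 * \<delta>" using pt_near_vt by blast
    then show ?thesis using behind[of "vt (i - m0 - 1)" "vt (i - m0)" "pt i" v "32 * \<delta>"] vV gG by auto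
  qed
  obtain i i' where i: "d s v - 26 * \<delta> \<le> gp s (pt i) v" "d s' v - 26 * \<delta> \<le> gp s' (pt i') v"
    using dir1 s by blast
  obtain m m' where m: "d (pt i) v - 33 * \<delta> \<le> gp (pt i) (vt m) v" "d (pt i') v - 33 * \<delta> \<le> gp (pt i') (vt m') v"
    using dir2 by blast
  have X2: "\<phi> h (pt i') \<in> X" "vt m \<in> X" "vt m' \<in> X" "\<phi> h (vt m') \<in> X" using hG gG vV by auto
  have "gp s (\<phi> h s') v \<le> d s v" "gp s (\<phi> h s') v \<le> d s' v"
    using gp_le[of s "\<phi> h s'" v] gp_le'[of s "\<phi> h s'" v] X vV hd by auto
  \<comment> \<open>A product is at most the distances to \<open>v\<close>, so losses relative to
    these distances do no harm. The first two passages cost what \<open>behind\<close> lost plus 2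
    \<delta>, the last one only 2 \<delta>: 100 - 26 - 2 = 72, 72 - 33 - 2 = 37, 37 - 2 = 35,
    against the 29 of \<open>dir_turn\<close>.\<close>
  then have 1: "72 * \<delta> < gp (pt i) (\<phi> h (pt i')) v"
    using hyp5[OF pt_X X(1,3) X2(1) vV(2), of i] i T h_gp[OF X(2) pt_X, of i'] gp_commute[of "pt i" s v] delta_pos by linarith
  moreover have "gp (pt i) (\<phi> h (pt i')) v \<le> d (pt i) v" "gp (pt i) (\<phi> h (pt i')) v \<le> d (pt i') v"
    using gp_le[of "pt i" "\<phi> h (pt i')" v] gp_le'[of "pt i" "\<phi> h (pt i')" v] X2 vV hd by auto
  ultimately have 2: "37 * \<delta> < gp (vt m) (\<phi> h (vt m')) v"
    using hyp5[OF X2(2) pt_X X2(1,4) vV(2), of i] m h_gp[OF pt_X X2(3), of i'] gp_commute[of "vt m" "pt i" v] delta_pos by linarith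
  have "m \<noteq> 0" "m' \<noteq> 0" using 2 X2 vV gG hG delta_pos by (auto simp: orbpt_0)
  then obtain w w' where w: "w \<in> {\<phi> g v, \<phi> (inv g) v}" "\<sigma> - 31 * \<delta> \<le> gp (vt m) w v"
    "w' \<in> {\<phi> g v, \<phi> (inv g) v}" "\<sigma> - 31 * \<delta> \<le> gp (vt m') w' v" using dir_vt by meson
  have X3: "w \<in> X" "w' \<in> X" "\<phi> h w' \<in> X" using w gG vV hG by auto
  have "35 * \<delta> < gp w (\<phi> h w') v"
    using hyp5[OF X3(1) X2(2,4) X3(3) vV(2)] 2 w(2,4) h_gp[OF X2(3) X3(2)] gp_commute[of "vt m" w v] sigma delta_pos
    by linarith
  then show False using dir_turn[OF w(1,3)] delta_pos by simp
qed

end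

text \<open>Linear growth supplies the hypotheses of \<open>windmill_free_product\<close>: an
  element fixing an apex contains no power of \<open>g\<close> and is a rotation by
  \<open>K_stabilizer\<close>, powers of \<open>g\<close> act freely on apices, and the orbit of
  \<open>x\<close> leaves every ball.\<close>

lemma axis_free_product:
  "\<exists>S\<subseteq>V. internal_free_product G (generate G (insert g K)) (insert None (Some ` rot ` S)) (adjoin_factor (generate G {g}))"
proof -
  have gen: "n \<in> generate G {g} \<Longrightarrow> \<exists>i::int. n = g [^] i" for n
    using generate_pow[OF gG] by auto
  interpret W: windmill X d \<delta> G \<phi> V rot \<sigma> "generate G {g}" axis "100 * \<delta>"
  proof (intro windmill.intro rot_fam_axioms windmill_axioms.intro)
    show "subgroup (generate G {g}) G" using gG by (intro generate_is_subgroup) simp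
    show "axis \<noteq> {}" using pt_axis by blast
    show "\<phi> n y \<in> axis" if "n \<in> generate G {g}" "y \<in> axis" for n y using gen axis_inv that by blast
    show "gp s (\<phi> h s') v \<le> 100 * \<delta>"
      if "W = {v \<in> V. \<exists>y\<in>axis. d v y < 24 * \<delta>}" "v \<in> W" "h \<in> rot v" "h \<noteq> \<one>"
        "s \<in> axis \<union> (W - {v})" "s' \<in> axis \<union> (W - {v})" for W v h s s'
      using axis_turn[of v h s s'] that by (simp add: axis_apices_def)
  qed (use sigma delta_pos axis_quasiconvex in \<open>auto simp: axis_def\<close>)
  have "\<exists>S\<subseteq>V. internal_free_product G (generate G (generate G {g} \<union> \<Union>(rot ` V)))
      (insert None (Some ` rot ` S)) (adjoin_factor (generate G {g}))"
  proof (rule W.windmill_free_product)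
    fix \<gamma> v assume \<gamma>: "\<gamma> \<in> generate G (generate G {g} \<union> \<Union>(rot ` V))" and v: "v \<in> V" "\<phi> \<gamma> v = v"
    obtain k and n :: int where kn: "k \<in> K" "\<gamma> = k \<otimes> g [^] n" using generate_power_form[OF g \<gamma>] by blast
    then have "n = 0" using fixing_power[OF g] v by blast
    then have "\<gamma> = k" using kn K_carrier by simp
    then show "\<gamma> \<in> rot v" using K_stabilizer v kn by blast
  next
    fix \<gamma> v assume \<gamma>: "\<gamma> \<in> generate G {g}" and v: "v \<in> V" "\<phi> \<gamma> v = v"
    obtain n :: int where n: "\<gamma> = g [^] n" using gen \<gamma> by blast
    then have "n = 0" using fixing_power[OF g K_one v(1), of n] v gG by simp
    then show "\<gamma> = \<one>" using n by simp
  next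
    fix v assume v: "v \<in> V"
    obtain c B where c: "c > 0" "\<And>n k. k \<in> K \<Longrightarrow> c * real_of_int \<bar>n\<bar> - B \<le> d x (\<phi> (k \<otimes> g [^] n) x)"
      using lox[OF g x] by auto
    obtain m where m: "102 * \<delta> + d x v + B < real m * c" using reals_Archimedean3[OF c(1)] by blast
    have "c * real m - B \<le> d x (pt (int m))" using c(2)[OF K_one, of "int m"] gG by (simp add: orbpt_def)
    moreover have "d x (pt (int m)) \<le> d x v + d (pt (int m)) v"
      using triangle[of x v "pt (int m)"] x v commute[of v "pt (int m)"] by simp
    ultimately have "102 * \<delta> < d (pt (int m)) v" using m by (simp add: mult.commute)
    then show "\<exists>y\<in>axis. 100 * \<delta> + 2 * \<delta> < d y v" using pt_axis by (intro bexI[of _ "pt (int m)"]) auto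
  qed
  then show ?thesis using generate_eq[OF g] by simp
qed

end

lemma coset_free_product:
  assumes "X \<noteq> {}"
  shows "\<exists>g\<in>carrier G. \<exists>S\<subseteq>V. K #> g = C \<and>
    internal_free_product G (generate G (insert g K)) (insert None (Some ` rot ` S)) (adjoin_factor (generate G {g}))"
proof -
  \<comment> \<open>The infimum is over points and over the whole coset at once; this is what allows
    \<open>v_turn\<close> to change \<open>g\<close>.\<close>
  define D where "D = {d q (\<phi> g q) | q g. q \<in> X \<and> g \<in> C}"
  define l where "l = Inf D"
  have bdd: "bdd_below D" by (rule bdd_belowI[of _ 0]) (auto simp: D_def)
  obtain g0 where "g0 \<in> carrier G" "C = K #> g0" using C by (auto simp: carrier_FactGroup)
  then have "g0 \<in> C" using rcos_self[OF _ K_subgroup] by simp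
  then have ne: "D \<noteq> {}" using assms by (auto simp: D_def)
  have l: "l \<le> d q (\<phi> g q)" if "g \<in> C" "q \<in> X" for g q
    unfolding l_def by (rule cInf_lower[OF _ bdd]) (use that in \<open>auto simp: D_def\<close>)
  have "Inf D < l + \<delta>" using delta_pos by (simp add: l_def)
  then obtain e where "e \<in> D" "e < l + \<delta>" using cInf_less_iff[OF ne bdd] by blast
  then obtain g x where gx: "g \<in> C" "x \<in> X" "d x (\<phi> g x) < l + \<delta>" by (auto simp: D_def)
  show ?thesis
    using axis_free_product[OF l gx(1,2) less_imp_le[OF gx(3)]] C_carrier[OF gx(1)] C_coset[OF gx(1)] by blast
qed

end

text \<open>The quotient distance is an infimum over representatives, so the lower quasi-isometry
  bound passes to every \<open>k \<otimes> g [^] n\<close> with constants independent of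
  \<open>k\<close>.\<close>

lemma loxodromic_growth:
  assumes C: "C \<in> carrier (G Mod K)"
    and lox: "loxodromic (G Mod K) (quotient_space G X \<phi> K) (quotient_dist d) (quotient_action G X \<phi> K) C"
    and g: "g \<in> C" and x: "x \<in> X"
  shows "\<exists>c>0. \<exists>B. \<forall>n::int. \<forall>k\<in>K. c * real_of_int \<bar>n\<bar> - B \<le> d x (\<phi> (k \<otimes> g [^] n) x)"
proof -
  have gG: "g \<in> carrier G" using C g K_carrier by (auto simp: carrier_FactGroup r_coset_def)
  have Cg: "C = K #> g" using C g repr_independence[OF _ _ K_subgroup] by (auto simp: carrier_FactGroup)
  interpret N: normal K G by (rule K_normal)
  interpret H: group_hom G "G Mod K" "\<lambda>x. K #> x"
    by (intro group_hom.intro group_hom_axioms.intro homI)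
      (auto simp: N.factorgroup_is_group N.rcos_sum carrier_FactGroup group_axioms)
  have pow: "C [^]\<^bsub>G Mod K\<^esub> (n::int) = K #> (g [^] n)" for n
    using gG by (simp add: Cg H.hom_int_pow)
  define f where "f m = quotient_action G X \<phi> K (C [^]\<^bsub>G Mod K\<^esub> (m::int))" for m
  obtain P where P: "P \<in> quotient_space G X \<phi> K" and
    qi: "quasi_isometric_embedding (UNIV :: int set) (\<lambda>m n. real_of_int \<bar>m - n\<bar>) (quotient_space G X \<phi> K) (quotient_dist d) (\<lambda>m. f m P)"
    using lox by (auto simp: loxodromic_def f_def)
  then obtain x0 where x0: "x0 \<in> X" "P = orb x0" by (auto simp: quotient_space_orb)
  from qi obtain c l where c: "c \<ge> 1" "l \<ge> 0"
    "\<And>m n. real_of_int \<bar>m - n\<bar> / c - l \<le> quotient_dist d (f m P) (f n P)"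
    unfolding quasi_isometric_embedding_def by blast
  have mem: "\<phi> (k \<otimes> g [^] n) x0 \<in> f n P" if "k \<in> K" for k n
  proof -
    have "k \<otimes> g [^] n \<in> K #> (g [^] n)" using that by (auto simp: r_coset_def)
    then show ?thesis
      using P orb_self[OF x0(1)] x0(2) unfolding f_def quotient_action_def pow by auto
  qed
  have "1 / c * real_of_int \<bar>n\<bar> - (l + 2 * d x x0) \<le> d x (\<phi> (k \<otimes> g [^] n) x)" if k: "k \<in> K" for n k
  proof -
    define E where "E = k \<otimes> g [^] n"
    have E: "E \<in> carrier G" using k K_carrier gG by (simp add: E_def)
    have "x0 \<in> f 0 P" using mem[OF K_one, of 0] gG x0 by simp
    then have "quotient_dist d (f n P) (f 0 P) \<le> d (\<phi> E x0) x0"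
      using quotient_dist_le mem[OF k] by (simp add: E_def)
    then have "real_of_int \<bar>n\<bar> / c - l \<le> d (\<phi> E x0) x0" using c(3)[of n 0] by simp
    also have "\<dots> \<le> d (\<phi> E x0) (\<phi> E x) + d (\<phi> E x) x0" using triangle[of "\<phi> E x0" "\<phi> E x" x0] x x0 E by simp
    also have "\<dots> \<le> d x0 x + (d (\<phi> E x) x + d x x0)" using triangle[of "\<phi> E x" x x0] x x0 E by simp
    finally show ?thesis using commute[of x0 x] commute[of "\<phi> E x" x] by (simp add: E_def)
  qed
  moreover have "1 / c > 0" using c by simp
  ultimately show ?thesis by blast
qed

end

theorem theorem3p17:
  fixes \<delta> :: real
    and X :: "'x set" and d :: "'x \<Rightarrow> 'x \<Rightarrow> real"
    and G :: "('g, 'b) monoid_scheme" and \<phi> :: "'g \<Rightarrow> 'x \<Rightarrow> 'x"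
  assumes "\<delta> > 0"
    and "length_space X d" and "hyperbolic \<delta> X d"
    and "group G" and "acts_by_isometries G X d \<phi>"
  shows "\<exists>\<sigma>\<^sub>0>0. \<forall>\<sigma> \<R> K.
    \<sigma> > \<sigma>\<^sub>0 \<and> rotation_family G X d \<phi> \<sigma> \<R> \<and> K = generate G (\<Union>(rotation_groups \<R>)) \<longrightarrow>
      (\<exists>\<delta>'\<le>900 * \<delta>. hyperbolic \<delta>' (quotient_space G X \<phi> K) (quotient_dist d)) \<and>
      (\<forall>g'\<in>carrier (G Mod K).
         loxodromic (G Mod K) (quotient_space G X \<phi> K) (quotient_dist d)
           (quotient_action G X \<phi> K) g' \<longrightarrow>
         (\<exists>g\<in>carrier G. \<exists>\<S>\<subseteq>\<R>.
            K #>\<^bsub>G\<^esub> g = g' \<and>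
            internal_free_product G (generate G (insert g K))
              (insert None (Some ` rotation_groups \<S>))
              (adjoin_factor (generate G {g}))))"
proof (rule exI[of _ "1000 * \<delta>"], intro conjI allI impI)
  show "0 < 1000 * \<delta>" using assms(1) by simp
next
  fix \<sigma> \<R> K
  assume asm: "\<sigma> > 1000 * \<delta> \<and> rotation_family G X d \<phi> \<sigma> \<R> \<and> K = generate G (\<Union>(rotation_groups \<R>))"
  have MS: "Metric_space X d" using assms(2) by (simp add: length_space_def)
  interpret M: Metric_space X d by (rule MS)
  interpret H: hyp_act X d \<delta> G \<phi>
  proof (intro hyp_act.intro hyp_act_axioms.intro hyp.intro hyp_axioms.intro assms MS)
    show "min (gromov_product d x y t) (gromov_product d y z t) - \<delta> \<le> gromov_product d x z t"
      if "x \<in> X" "y \<in> X" "z \<in> X" "t \<in> X" for x y z t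
      using assms(3) that by (simp add: hyperbolic_def)
    show "\<exists>z\<in>X. d x z = s \<and> d z y \<le> d x y - s + \<epsilon>"
      if "x \<in> X" "y \<in> X" "0 \<le> s" "s \<le> d x y" "0 < \<epsilon>" for x y s \<epsilon>
      using length_space_almost_between[OF assms(2)] that by blast
  qed
  define V where "V = snd ` \<R>"
  \<comment> \<open>By (R2), two different pairs with the same point would give
    \<open>0 \<ge> \<sigma>\<close>; so the family is a function from apices to groups.\<close>
  define rot where "rot v = (THE H. (H, v) \<in> \<R>)" for v
  note rf = asm[THEN conjunct2, THEN conjunct1, unfolded rotation_family_def]
  note rf1 = rf[THEN conjunct2, THEN conjunct2]
  note rf2 = rf1[THEN conjunct2, THEN conjunct2]
  have R: "\<R> \<noteq> {}" "\<sigma> > 0" using rf by simp_all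
  have R3: "subgroup H G \<and> v \<in> X" if "(H, v) \<in> \<R>" for H v
    using bspec[OF rf1[THEN conjunct1] that] by simp
  have R4: "d v v' \<ge> \<sigma>" if "(H, v) \<in> \<R>" "(H', v') \<in> \<R>" "(H, v) \<noteq> (H', v')" for H v H' v'
  proof -
    have "\<forall>(H', v')\<in>\<R>. (H, v) \<noteq> (H', v') \<longrightarrow> d v v' \<ge> \<sigma>"
      using bspec[OF rf2[THEN conjunct1] that(1)] by simp
    from bspec[OF this that(2)] show ?thesis using that(3) by simp
  qed
  have R5: "((g <#\<^bsub>G\<^esub> H) #>\<^bsub>G\<^esub> inv\<^bsub>G\<^esub> g, \<phi> g v) \<in> \<R>" if "g \<in> carrier G" "(H, v) \<in> \<R>" for g H v
    using bspec[OF bspec[OF rf2[THEN conjunct2] that(1)] that(2)] by simp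
  have turn: "d (\<phi> h x) x = 2 * d v x"
    if "(H, v) \<in> \<R>" "x \<in> X" "d v x \<le> \<sigma> / 10" "h \<in> H" "h \<noteq> \<one>\<^bsub>G\<^esub>" for H v x h
  proof -
    have "x \<in> M.mcball v (\<sigma> / 10)" using that R3 by (simp add: M.in_mcball)
    then show ?thesis using bspec[OF rf1[THEN conjunct2, THEN conjunct1] that(1)] that by simp
  qed
  have uniq: "H = H'" if "(H, v) \<in> \<R>" "(H', v) \<in> \<R>" for H H' v
    using R4[OF that] R(2) R3[OF that(1)] by (cases "H = H'") auto
  have rotI: "rot v = H" if "(H, v) \<in> \<R>" for H v
    unfolding rot_def using that by (rule the_equality) (rule uniq[OF _ that])
  have rotR: "(rot v, v) \<in> \<R>" if "v \<in> V" for v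
    using that rotI by (auto simp: V_def)
  have groups: "rotation_groups \<R> = rot ` V"
    using rotI by (force simp: rotation_groups_def V_def image_iff)
  interpret F: rot_fam X d \<delta> G \<phi> V rot \<sigma>
  proof (intro rot_fam.intro rot_fam_axioms.intro H.hyp_act_axioms)
    show "V \<subseteq> X" using R3 by (auto simp: V_def)
    show "subgroup (rot v) G" if "v \<in> V" for v using rotR[OF that] R3 by blast
    show "d (\<phi> h x) x = 2 * d v x"
      if "v \<in> V" "h \<in> rot v" "h \<noteq> \<one>\<^bsub>G\<^esub>" "x \<in> X" "d v x \<le> \<sigma> / 10" for v h x
      using turn[OF rotR[OF that(1)]] that by blast
    show "\<sigma> \<le> d v w" if "v \<in> V" "w \<in> V" "v \<noteq> w" for v w
      using R4[OF rotR rotR] that by blast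
    show "\<phi> g v \<in> V" if "g \<in> carrier G" "v \<in> V" for g v
      using R5[OF that(1) rotR[OF that(2)]] by (force simp: V_def)
    show "g \<otimes>\<^bsub>G\<^esub> h \<otimes>\<^bsub>G\<^esub> inv\<^bsub>G\<^esub> g \<in> rot (\<phi> g v)" if "g \<in> carrier G" "v \<in> V" "h \<in> rot v" for g v h
      using rotI[OF R5[OF that(1) rotR[OF that(2)]]] that(3) by (auto simp: r_coset_def l_coset_def)
    show "1000 * \<delta> < \<sigma>" using asm by blast
  qed
  have K: "K = F.K" using asm groups by simp
  show "\<exists>\<delta>'\<le>900 * \<delta>. hyperbolic \<delta>' (quotient_space G X \<phi> K) (quotient_dist d)"
    unfolding K using F.quotient_hyperbolic assms(1) by (intro exI[of _ "59 * \<delta>"]) simp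
  show "\<forall>g'\<in>carrier (G Mod K).
         loxodromic (G Mod K) (quotient_space G X \<phi> K) (quotient_dist d)
           (quotient_action G X \<phi> K) g' \<longrightarrow>
         (\<exists>g\<in>carrier G. \<exists>\<S>\<subseteq>\<R>.
            K #>\<^bsub>G\<^esub> g = g' \<and>
            internal_free_product G (generate G (insert g K))
              (insert None (Some ` rotation_groups \<S>))
              (adjoin_factor (generate G {g})))"
  proof (intro ballI impI)
    fix C assume C: "C \<in> carrier (G Mod K)"
      and lox: "loxodromic (G Mod K) (quotient_space G X \<phi> K) (quotient_dist d) (quotient_action G X \<phi> K) C"
    have "X \<noteq> {}" using R(1) R3 by auto
    then obtain g S where gS: "g \<in> carrier G" "S \<subseteq> V" "K #>\<^bsub>G\<^esub> g = C"
      "internal_free_product G (generate G (insert g K)) (insert None (Some ` rot ` S)) (adjoin_factor (generate G {g}))"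
      using F.coset_free_product[OF C[unfolded K] F.loxodromic_growth[OF C[unfolded K] lox[unfolded K]]] K by auto
    define \<S> where "\<S> = (\<lambda>v. (rot v, v)) ` S"
    have "\<S> \<subseteq> \<R>" using rotR gS(2) by (auto simp: \<S>_def)
    moreover have "rotation_groups \<S> = rot ` S" by (force simp: rotation_groups_def \<S>_def)
    ultimately show "\<exists>g\<in>carrier G. \<exists>\<S>\<subseteq>\<R>. K #>\<^bsub>G\<^esub> g = C \<and>
            internal_free_product G (generate G (insert g K))
              (insert None (Some ` rotation_groups \<S>)) (adjoin_factor (generate G {g}))"
      using gS by (intro bexI[of _ g] exI[of _ \<S>]) auto
  qed
qed

end
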